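(* Let $(M,g)$ be an $n$-dimensional connected complete Riemannian manifold. Let $W_e(M,g)$ be the vector space of smooth solutions $w:M\to\mathbf{R}$ of $\nabla dw=0$. Then $\dim W_e(M,g)\ge n$ if and only if $(M,g)$ is isometric to $\mathbf{R}^n$ or to $\mathbf{R}^{n-1}\times\mathbf{S}^1(\rho)$ for some $\rho>0$.
   Context: $\nabla dw$ is the Hessian of $w$. $\mathbf{S}^1(\rho)$ is the circle of radius $\rho$; $\mathbf{R}^n$ carries the Euclidean metric and products carry the product metric. *)

theory Defs
  imports "HOL-Analysis.Analysis" "HOL-Library.Function_Algebras"
begin

section \<open>Smooth maps between Euclidean spaces\<close>

text \<open>Only meant for open sets \<open>S\<close>: all iterated directional derivatives up to order \<open>k\<close> exist and
  are continuous, and those of order below \<open>k\<close> are (Frechet) differentiable.\<close>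

primrec Ck_on :: "nat \<Rightarrow> 'a::euclidean_space set \<Rightarrow> ('a \<Rightarrow> 'b::euclidean_space) \<Rightarrow> bool" where
  "Ck_on 0 S f \<longleftrightarrow> continuous_on S f"
| "Ck_on (Suc k) S f \<longleftrightarrow>
     (\<forall>x\<in>S. f differentiable (at x)) \<and> (\<forall>v. Ck_on k S (\<lambda>x. frechet_derivative f (at x) v))"

definition smooth_on :: "'a::euclidean_space set \<Rightarrow> ('a \<Rightarrow> 'b::euclidean_space) \<Rightarrow> bool" where
  "smooth_on S f \<longleftrightarrow> (\<forall>k. Ck_on k S f)"

definition partial :: "'n::finite \<Rightarrow> (real^'n \<Rightarrow> real) \<Rightarrow> real^'n \<Rightarrow> real" where
  "partial i f x = frechet_derivative f (at x) (axis i 1)"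


section \<open>Riemannian manifolds\<close>

text \<open>A chart is a domain together with a coordinate map; values of the map outside the domain are
  irrelevant. The dimension of the manifold is \<open>CARD('n)\<close>.\<close>

type_synonym ('a, 'n) chart = "'a set \<times> ('a \<Rightarrow> real^'n)"

abbreviation cdom :: "('a, 'n::finite) chart \<Rightarrow> 'a set" where "cdom c \<equiv> fst c"
abbreviation cmap :: "('a, 'n::finite) chart \<Rightarrow> 'a \<Rightarrow> real^'n" where "cmap c \<equiv> snd c"
abbreviation cran :: "('a, 'n::finite) chart \<Rightarrow> (real^'n) set" where "cran c \<equiv> snd c ` fst c"
abbreviation cinv :: "('a, 'n::finite) chart \<Rightarrow> real^'n \<Rightarrow> 'a" where
  "cinv c \<equiv> inv_into (fst c) (snd c)"

text \<open>The atlas need not be maximal; the smooth structure is the one it generates. The metric tensor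
  is given by its component matrices: \<open>gmat M c y $ i $ j\<close> is the inner product of the \<open>i\<close>th and
  \<open>j\<close>th coordinate vectors of the chart \<open>c\<close> at the point with coordinates \<open>y\<close>.\<close>

record ('a, 'n) riem =
  mtop :: "'a topology"
  atlas :: "('a, 'n) chart set"
  gmat :: "('a, 'n) chart \<Rightarrow> real^'n \<Rightarrow> real^'n^'n"

definition smooth_manifold :: "('a, 'n::finite) riem \<Rightarrow> bool" where
  "smooth_manifold M \<longleftrightarrow>
     Hausdorff_space (mtop M) \<and>
     second_countable (mtop M) \<and>
     topspace (mtop M) = (\<Union>c\<in>atlas M. cdom c) \<and>
     (\<forall>c\<in>atlas M. openin (mtop M) (cdom c) \<and> open (cran c) \<and>
        homeomorphic_map (subtopology (mtop M) (cdom c)) (top_of_set (cran c)) (cmap c)) \<and>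
     (\<forall>c\<in>atlas M. \<forall>d\<in>atlas M. smooth_on (cmap c ` (cdom c \<inter> cdom d)) (cmap d \<circ> cinv c))"

definition riemannian_manifold :: "('a, 'n::finite) riem \<Rightarrow> bool" where
  "riemannian_manifold M \<longleftrightarrow>
     smooth_manifold M \<and>
     (\<forall>c\<in>atlas M. smooth_on (cran c) (gmat M c)) \<and>
     (\<forall>c\<in>atlas M. \<forall>y\<in>cran c. transpose (gmat M c y) = gmat M c y \<and>
        (\<forall>v. v \<noteq> 0 \<longrightarrow> v \<bullet> (gmat M c y *v v) > 0)) \<and>
     (\<forall>c\<in>atlas M. \<forall>d\<in>atlas M. \<forall>p\<in>cdom c \<inter> cdom d.
        let J = jacobian (cmap d \<circ> cinv c) (at (cmap c p))
        in gmat M c (cmap c p) = transpose J ** gmat M d (cmap d p) ** J)"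

definition smooth_map :: "('a, 'n::finite) riem \<Rightarrow> ('b, 'm::finite) riem \<Rightarrow> ('a \<Rightarrow> 'b) \<Rightarrow> bool" where
  "smooth_map M N f \<longleftrightarrow>
     continuous_map (mtop M) (mtop N) f \<and>
     (\<forall>c\<in>atlas M. \<forall>d\<in>atlas N.
        smooth_on (cmap c ` {p \<in> cdom c. f p \<in> cdom d}) (cmap d \<circ> f \<circ> cinv c))"

definition isometry :: "('a, 'n::finite) riem \<Rightarrow> ('b, 'm::finite) riem \<Rightarrow> ('a \<Rightarrow> 'b) \<Rightarrow> bool" where
  "isometry M N f \<longleftrightarrow>
     smooth_map M N f \<and>
     (\<exists>h. smooth_map N M h \<and>
        (\<forall>p\<in>topspace (mtop M). h (f p) = p) \<and> (\<forall>q\<in>topspace (mtop N). f (h q) = q)) \<and>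
     (\<forall>c\<in>atlas M. \<forall>d\<in>atlas N. \<forall>p\<in>cdom c. f p \<in> cdom d \<longrightarrow>
        (let J = jacobian (cmap d \<circ> f \<circ> cinv c) (at (cmap c p))
         in gmat M c (cmap c p) = transpose J ** gmat N d (cmap d (f p)) ** J))"

definition isometric :: "('a, 'n::finite) riem \<Rightarrow> ('b, 'm::finite) riem \<Rightarrow> bool" where
  "isometric M N \<longleftrightarrow> (\<exists>f. isometry M N f)"


section \<open>Levi-Civita connection, Hessian, geodesics\<close>

definition christoffel ::
    "('a, 'n::finite) riem \<Rightarrow> ('a, 'n) chart \<Rightarrow> real^'n \<Rightarrow> 'n \<Rightarrow> 'n \<Rightarrow> 'n \<Rightarrow> real" where
  "christoffel M c y k i j =
     (1/2) * (\<Sum>l\<in>UNIV. matrix_inv (gmat M c y) $ k $ l *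
        (partial i (\<lambda>x. gmat M c x $ j $ l) y
       + partial j (\<lambda>x. gmat M c x $ i $ l) y
       - partial l (\<lambda>x. gmat M c x $ i $ j) y))"

text \<open>\<open>(\<nabla>\<alpha>)\<^sub>i\<^sub>j = \<partial>\<^sub>i \<alpha>\<^sub>j - \<Gamma>\<^sup>k\<^sub>i\<^sub>j \<alpha>\<^sub>k\<close> for a one-form \<open>\<alpha>\<close> with components \<open>\<alpha>\<^sub>j\<close> in the chart \<open>c\<close>.\<close>

definition cov_deriv_form ::
    "('a, 'n::finite) riem \<Rightarrow> ('a, 'n) chart \<Rightarrow> ('n \<Rightarrow> real^'n \<Rightarrow> real) \<Rightarrow> real^'n \<Rightarrow> 'n \<Rightarrow> 'n \<Rightarrow> real" where
  "cov_deriv_form M c \<alpha> y i j =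
     partial i (\<alpha> j) y - (\<Sum>k\<in>UNIV. christoffel M c y k i j * \<alpha> k y)"

definition differential_form :: "('a, 'n::finite) chart \<Rightarrow> ('a \<Rightarrow> real) \<Rightarrow> 'n \<Rightarrow> real^'n \<Rightarrow> real" where
  "differential_form c w j = partial j (w \<circ> cinv c)"

definition hessian ::
    "('a, 'n::finite) riem \<Rightarrow> ('a, 'n) chart \<Rightarrow> ('a \<Rightarrow> real) \<Rightarrow> real^'n \<Rightarrow> 'n \<Rightarrow> 'n \<Rightarrow> real" where
  "hessian M c w = cov_deriv_form M c (differential_form c w)"

definition geodesic :: "('a, 'n::finite) riem \<Rightarrow> (real \<Rightarrow> 'a) \<Rightarrow> bool" where
  "geodesic M \<gamma> \<longleftrightarrow>
     continuous_map euclideanreal (mtop M) \<gamma> \<and>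
     (\<forall>c\<in>atlas M. let x = cmap c \<circ> \<gamma>; x' = (\<lambda>t. vector_derivative x (at t)) in
        smooth_on {t. \<gamma> t \<in> cdom c} x \<and>
        (\<forall>t. \<gamma> t \<in> cdom c \<longrightarrow> (\<forall>k.
           vector_derivative x' (at t) $ k
           + (\<Sum>i\<in>UNIV. \<Sum>j\<in>UNIV. christoffel M c (x t) k i j * x' t $ i * x' t $ j) = 0)))"

text \<open>Completeness is geodesic completeness: the exponential map is defined on the whole tangent
  bundle. Geodesics here are defined on the whole real line.\<close>

definition complete_riem :: "('a, 'n::finite) riem \<Rightarrow> bool" where
  "complete_riem M \<longleftrightarrow>
     (\<forall>c\<in>atlas M. \<forall>p\<in>cdom c. \<forall>v. \<exists>\<gamma>. geodesic M \<gamma> \<and> \<gamma> 0 = p \<and>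
        vector_derivative (cmap c \<circ> \<gamma>) (at 0) = v)"


section \<open>The solution space\<close>

global_interpretation real_fun: vector_space "\<lambda>(r::real) (f::'a \<Rightarrow> real) x. r * f x"
  by unfold_locales (auto simp: fun_eq_iff algebra_simps)

text \<open>A function on the manifold is represented by its extension by zero to the whole type, so that
  distinct elements of the set below are distinct functions on the manifold.\<close>

definition W_e :: "('a, 'n::finite) riem \<Rightarrow> ('a \<Rightarrow> real) set" where
  "W_e M = {w. (\<forall>p. p \<notin> topspace (mtop M) \<longrightarrow> w p = 0) \<and>
     (\<forall>c\<in>atlas M. smooth_on (cran c) (w \<circ> cinv c)) \<and>
     (\<forall>c\<in>atlas M. \<forall>y\<in>cran c. \<forall>i j. hessian M c w y i j = 0)}"


section \<open>The model spaces\<close>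

text \<open>The Riemannian manifold given by a \<open>CARD('n)\<close>-dimensional embedded submanifold \<open>S\<close> of a Euclidean
  space with the induced metric. The charts are the inverses of all local parametrisations of \<open>S\<close>,
  that is, of smooth immersions that are homeomorphisms onto open subsets of \<open>S\<close>.\<close>

definition submanifold :: "'b::euclidean_space set \<Rightarrow> ('b, 'n::finite) riem" where
  "submanifold S =
     \<lparr> mtop = top_of_set S,
       atlas = {c. openin (top_of_set S) (cdom c) \<and> open (cran c) \<and>
                   homeomorphic_map (top_of_set (cdom c)) (top_of_set (cran c)) (cmap c) \<and>
                   smooth_on (cran c) (cinv c) \<and>
                   (\<forall>y\<in>cran c. inj (frechet_derivative (cinv c) (at y)))},
       gmat = (\<lambda>c y. \<chi> i j. frechet_derivative (cinv c) (at y) (axis i 1)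
                            \<bullet> frechet_derivative (cinv c) (at y) (axis j 1)) \<rparr>"

definition euclidean_riem :: "(real^'n, 'n::finite) riem" where
  "euclidean_riem = submanifold UNIV"

text \<open>With \<open>n = CARD('n)\<close>, the space \<open>R\<^sup>n\<^sup>-\<^sup>1\<close> is realised as the coordinate hyperplane \<open>x\<^sub>k = 0\<close> of \<open>R\<^sup>n\<close>
  (this includes \<open>n = 1\<close>), and the circle as the sphere of radius \<open>\<rho>\<close> in the complex plane. The metric
  induced from the product \<open>R\<^sup>n \<times> C\<close> on a product of submanifolds is the product metric.\<close>

definition cylinder_riem :: "'n \<Rightarrow> real \<Rightarrow> ((real^'n) \<times> complex, 'n::finite) riem" where
  "cylinder_riem k \<rho> = submanifold ({x. x $ k = 0} \<times> sphere 0 \<rho>)"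

end

theory Submission
  imports Defs
begin

text \<open>Differentials of functions with vanishing Hessian are parallel one-forms, so their inner products
  are constant. If \<open>dim W\<^sub>e \<ge> n\<close>, splitting off the constants and applying Gram--Schmidt gives functions
  \<open>w\<^sub>a\<close>, \<open>a \<noteq> k\<close>, whose \<open>n - 1\<close> differentials are orthonormal. Their unit conormal is parallel, hence
  closed, hence locally \<open>ds\<close>; thus \<open>(w\<^sub>a, s)\<close> are flat coordinates, in which geodesics are straight lines,
  and \<open>s\<close> is unique up to sign and translation. Completeness lets one continue an inverse of such
  coordinates along all rays to a surjective local isometry \<open>\<Phi> : R\<^sup>n \<rightarrow> M\<close>. Two points of a fibre differ by
  an isometry of the last coordinate that preserves \<open>\<Phi>\<close>; reflections are excluded by their fixed points,
  so either \<open>\<Phi>\<close> is injective or its fibres are the orbits of a discrete group of translations, and then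
  \<open>M\<close> is the cylinder. Conversely, pulling back by such a \<open>\<Phi>\<close> identifies \<open>W\<^sub>e\<close> with the affine functions on
  \<open>R\<^sup>n\<close> that are constant on the fibres.\<close>

section \<open>Calculus of smooth maps\<close>

text \<open>The bound \<open>n\<close> fits because constants use up one dimension:
  \<open>n - 1\<close> independent differentials remain, and the one missing direction is determined
  up to sign by orthogonality. Hence the transition maps of the flat coordinates are isometries of a
  line, not arbitrary Euclidean motions, which is why the fibres of \<Phi> are governed by a
  subgroup of the real line and only one family of quotients appears. No orientation is available to
  choose the sign of the missing direction globally, so reflections are carried through the whole
  construction. Completeness supplies, along every ray, a geodesic that exists beyond the part
  already covered, hence a flat chart at any point where the continuation could stop. Continuations
  live on convex domains, so that any two of them agree on their overlap. In the converse direction,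
  the affine functions on R^n form a space of dimension n + 1, and those invariant under a
  nontrivial translation along one axis have dimension n, so the bound is attained with equality by
  the cylinder.\<close>

lemma Ck_on_subset: "Ck_on k S f \<Longrightarrow> T \<subseteq> S \<Longrightarrow> Ck_on k T f"
  by (induction k arbitrary: f) (auto intro: continuous_on_subset)

lemma has_derivative_cong_open:
  assumes "open S" "x \<in> S" "\<And>y. y \<in> S \<Longrightarrow> f y = g y"
  shows "(f has_derivative f') (at x) \<longleftrightarrow> (g has_derivative f') (at x)"
  using has_derivative_transform_within_open[OF _ assms(1,2)] assms(3) by metis

lemma frechet_derivative_cong_open:
  assumes "open S" "x \<in> S" "\<And>y. y \<in> S \<Longrightarrow> f y = g y"
  shows "frechet_derivative f (at x) = frechet_derivative g (at x)"
  unfolding frechet_derivative_def using has_derivative_cong_open[OF assms] by simp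

lemma differentiable_cong_open:
  assumes "open S" "x \<in> S" "\<And>y. y \<in> S \<Longrightarrow> f y = g y"
  shows "f differentiable (at x) \<longleftrightarrow> g differentiable (at x)"
  unfolding differentiable_def using has_derivative_cong_open[OF assms] by simp

lemma Ck_on_cong:
  assumes "open S" "\<And>x. x \<in> S \<Longrightarrow> f x = g x"
  shows "Ck_on k S f \<longleftrightarrow> Ck_on k S g"
  using assms(2)
proof (induction k arbitrary: f g)
  case 0
  then show ?case by (simp cong: continuous_on_cong)
next
  case (Suc k)
  have "f differentiable (at x) \<longleftrightarrow> g differentiable (at x)" if "x \<in> S" for x
    using differentiable_cong_open[OF assms(1) that] Suc.prems by blast
  moreover have "Ck_on k S (\<lambda>x. frechet_derivative f (at x) v) \<longleftrightarrow>
      Ck_on k S (\<lambda>x. frechet_derivative g (at x) v)" for v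
    by (rule Suc.IH) (use frechet_derivative_cong_open[OF assms(1)] Suc.prems in metis)
  ultimately show ?case by auto
qed

lemma Ck_on_eqI:
  assumes "open S" "Ck_on k S g" "\<And>x. x \<in> S \<Longrightarrow> f x = g x"
  shows "Ck_on k S f"
  using Ck_on_cong[of S f g k] assms by blast

lemma Ck_on_SucI:
  assumes "open S" "\<And>x. x \<in> S \<Longrightarrow> (f has_derivative f' x) (at x)"
    and "\<And>v. Ck_on k S (\<lambda>x. f' x v)"
  shows "Ck_on (Suc k) S f"
proof -
  have "frechet_derivative f (at x) = f' x" if "x \<in> S" for x
    using frechet_derivative_at assms(2) that by metis
  then have "Ck_on k S (\<lambda>x. frechet_derivative f (at x) v)" for v
    using Ck_on_cong[OF assms(1), of "\<lambda>x. frechet_derivative f (at x) v" "\<lambda>x. f' x v"] assms(3) by simp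
  then show ?thesis using assms(2) by (auto simp: differentiable_def)
qed

lemma Ck_on_SucD:
  assumes "Ck_on (Suc k) S f" "x \<in> S"
  shows "(f has_derivative frechet_derivative f (at x)) (at x)"
  using assms frechet_derivative_works by auto

lemma Ck_on_Suc_imp: "Ck_on (Suc k) S f \<Longrightarrow> Ck_on k S f"
proof (induction k arbitrary: f)
  case 0
  then show ?case unfolding Ck_on.simps
    by (intro differentiable_imp_continuous_on) (simp add: differentiable_on_def differentiable_at_withinI)
next
  case (Suc k)
  then show ?case using Ck_on.simps(2) by metis
qed

text \<open>Derivatives in \<open>Ck_on\<close> are taken at the point, not within the set, so
  localising costs nothing at the differentiation steps; only the continuity at level 0 refers to
  the set. Smoothness on a manifold is later checked near one point at a time through this
  lemma.\<close>

lemma Ck_on_local: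
  assumes "\<And>x. x \<in> S \<Longrightarrow> \<exists>T. open T \<and> x \<in> T \<and> Ck_on k T f"
  shows "Ck_on k S f"
  using assms
proof (induction k arbitrary: f)
  case 0
  show ?case
    unfolding Ck_on.simps continuous_on_eq_continuous_within
  proof
    fix x assume "x \<in> S"
    then obtain T where "open T" "x \<in> T" "continuous_on T f" using 0 by auto
    then show "continuous (at x within S) f"
      using continuous_at_imp_continuous_at_within continuous_on_eq_continuous_at by blast
  qed
next
  case (Suc k)
  have "f differentiable (at x)" if "x \<in> S" for x
    using Suc.prems[OF that] by auto
  moreover have "Ck_on k S (\<lambda>x. frechet_derivative f (at x) v)" for v
    by (rule Suc.IH) (use Suc.prems in fastforce)
  ultimately show ?case by auto
qed

section \<open>Closure properties of the C^k classes\<close>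

lemma Ck_on_const: "Ck_on k S (\<lambda>x. c)"
proof (induction k arbitrary: c)
  case (Suc k)
  then show ?case by (simp add: frechet_derivative_const)
qed auto

lemma Ck_on_bounded_linear_compose:
  assumes L: "bounded_linear L" and "open S" "Ck_on k S f"
  shows "Ck_on k S (\<lambda>x. L (f x))"
  using assms(3)
proof (induction k arbitrary: f)
  case 0
  then show ?case using bounded_linear.continuous_on[OF L] by auto
next
  case (Suc k)
  show ?case
  proof (rule Ck_on_SucI[OF \<open>open S\<close>])
    show "((\<lambda>x. L (f x)) has_derivative (\<lambda>v. L (frechet_derivative f (at x) v))) (at x)" if "x \<in> S" for x
      using bounded_linear.has_derivative[OF L] Ck_on_SucD[OF Suc.prems that] by blast
    show "Ck_on k S (\<lambda>x. L (frechet_derivative f (at x) v))" for v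
      using Suc by auto
  qed
qed

lemma Ck_on_bounded_linear:
  assumes "bounded_linear L" "open S"
  shows "Ck_on k S L"
proof -
  have "Ck_on k S (\<lambda>x. x)"
  proof (cases k)
    case (Suc m)
    show ?thesis unfolding Suc
      by (rule Ck_on_SucI[OF assms(2)]) (auto intro!: derivative_eq_intros Ck_on_const)
  qed auto
  from Ck_on_bounded_linear_compose[OF assms this] show ?thesis by simp
qed

lemma Ck_on_add:
  assumes "open S" "Ck_on k S f" "Ck_on k S g"
  shows "Ck_on k S (\<lambda>x. f x + g x)"
  using assms(2,3)
proof (induction k arbitrary: f g)
  case 0
  then show ?case by (auto intro: continuous_on_add)
next
  case (Suc k)
  show ?case
    by (rule Ck_on_SucI[OF \<open>open S\<close> has_derivative_add[OF Ck_on_SucD[OF Suc.prems(1)] Ck_on_SucD[OF Suc.prems(2)]]])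
      (use Suc in auto)
qed

lemma Ck_on_bilinear:
  assumes B: "bounded_bilinear B" and "open S" "Ck_on k S f" "Ck_on k S g"
  shows "Ck_on k S (\<lambda>x. B (f x) (g x))"
  using assms(3,4)
proof (induction k arbitrary: f g)
  case 0
  then show ?case using bounded_bilinear.continuous_on[OF B] by auto
next
  case (Suc k)
  show ?case
  proof (rule Ck_on_SucI[OF \<open>open S\<close> bounded_bilinear.FDERIV[OF B Ck_on_SucD[OF Suc.prems(1)] Ck_on_SucD[OF Suc.prems(2)]]])
    fix v
    have "Ck_on k S (\<lambda>x. B (f x) (frechet_derivative g (at x) v))"
      "Ck_on k S (\<lambda>x. B (frechet_derivative f (at x) v) (g x))"
      using Suc.IH Suc.prems Ck_on_Suc_imp[OF Suc.prems(1)] Ck_on_Suc_imp[OF Suc.prems(2)] by auto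
    then show "Ck_on k S (\<lambda>x. B (f x) (frechet_derivative g (at x) v) + B (frechet_derivative f (at x) v) (g x))"
      using Ck_on_add[OF \<open>open S\<close>] by blast
  qed
qed

lemma Ck_on_sum:
  assumes "open S" "\<And>i. i \<in> I \<Longrightarrow> Ck_on k S (f i)"
  shows "Ck_on k S (\<lambda>x. \<Sum>i\<in>I. f i x)"
  using assms(2)
  by (induction I rule: infinite_finite_induct) (auto intro: Ck_on_const Ck_on_add[OF assms(1)])

lemma Ck_on_mult:
  fixes f g :: "'a::euclidean_space \<Rightarrow> real"
  assumes "open S" "Ck_on k S f" "Ck_on k S g"
  shows "Ck_on k S (\<lambda>x. f x * g x)"
  using Ck_on_bilinear[OF bounded_bilinear_mult assms] .

lemma Ck_on_scaleR:
  assumes "open S" "Ck_on k S f" "Ck_on k S g"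
  shows "Ck_on k S (\<lambda>x. f x *\<^sub>R g x)"
  using Ck_on_bilinear[OF bounded_bilinear_scaleR assms] .

lemma Ck_on_inner:
  assumes "open S" "Ck_on k S f" "Ck_on k S g"
  shows "Ck_on k S (\<lambda>x. f x \<bullet> g x)"
  using Ck_on_bilinear[OF bounded_bilinear_inner assms] .

lemma Ck_on_minus:
  assumes "open S" "Ck_on k S f" "Ck_on k S g"
  shows "Ck_on k S (\<lambda>x. f x - g x)"
  using Ck_on_add[OF assms(1,2) Ck_on_bounded_linear_compose[OF bounded_linear_minus[OF bounded_linear_ident] assms(1,3)]] by simp

lemma Ck_on_prod:
  fixes f :: "'i \<Rightarrow> 'a::euclidean_space \<Rightarrow> real"
  assumes "open S" "\<And>i. i \<in> I \<Longrightarrow> Ck_on k S (f i)"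
  shows "Ck_on k S (\<lambda>x. \<Prod>i\<in>I. f i x)"
  using assms(2)
  by (induction I rule: infinite_finite_induct) (auto intro: Ck_on_const Ck_on_mult[OF assms(1)])

lemma Ck_on_componentwise:
  fixes f :: "'a::euclidean_space \<Rightarrow> 'b::euclidean_space"
  assumes "open S"
  shows "Ck_on k S f \<longleftrightarrow> (\<forall>b\<in>Basis. Ck_on k S (\<lambda>x. f x \<bullet> b))"
proof
  assume "Ck_on k S f"
  then show "\<forall>b\<in>Basis. Ck_on k S (\<lambda>x. f x \<bullet> b)"
    by (intro ballI Ck_on_inner[OF assms _ Ck_on_const])
next
  assume *: "\<forall>b\<in>Basis. Ck_on k S (\<lambda>x. f x \<bullet> b)"
  have "Ck_on k S (\<lambda>x. \<Sum>b\<in>Basis. (f x \<bullet> b) *\<^sub>R b)"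
    by (intro Ck_on_sum Ck_on_scaleR Ck_on_const assms) (use * in blast)
  then show "Ck_on k S f" by (simp add: euclidean_representation)
qed

lemma Ck_on_vec:
  fixes f :: "'a::euclidean_space \<Rightarrow> 'b::euclidean_space^'n"
  assumes "open S" "\<And>i. Ck_on k S (\<lambda>x. f x $ i)"
  shows "Ck_on k S f"
proof (rule iffD2[OF Ck_on_componentwise[OF assms(1)]], rule ballI)
  fix b :: "'b^'n" assume "b \<in> Basis"
  then obtain i c where b: "b = axis i c" by (auto simp: Basis_vec_def)
  have "Ck_on k S (\<lambda>x. f x $ i \<bullet> c)"
    by (rule Ck_on_inner[OF assms Ck_on_const])
  then show "Ck_on k S (\<lambda>x. f x \<bullet> b)" by (simp add: b inner_axis)
qed

lemma Ck_on_nth: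
  fixes f :: "'a::euclidean_space \<Rightarrow> 'b::euclidean_space^'n"
  assumes "open S" "Ck_on k S f"
  shows "Ck_on k S (\<lambda>x. f x $ i)"
  using Ck_on_bounded_linear_compose[OF bounded_linear_vec_nth assms] .

lemma Ck_on_compose:
  fixes f :: "'b::euclidean_space \<Rightarrow> 'c::euclidean_space" and g :: "'a::euclidean_space \<Rightarrow> 'b"
  assumes "open S" "open T" "Ck_on k T g" "Ck_on k S f" "g ` T \<subseteq> S"
  shows "Ck_on k T (\<lambda>x. f (g x))"
  using assms(3,4)
proof (induction k arbitrary: f)
  case 0
  then show ?case using continuous_on_compose2 assms(5) by auto
next
  case (Suc k)
  note g = Ck_on_Suc_imp[OF Suc.prems(1)]
  show ?case
  proof (rule Ck_on_SucI[OF \<open>open T\<close>])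
    show "((\<lambda>x. f (g x)) has_derivative
        (\<lambda>v. frechet_derivative f (at (g x)) (frechet_derivative g (at x) v))) (at x)" if "x \<in> T" for x
      using has_derivative_compose[OF Ck_on_SucD[OF Suc.prems(1) that] Ck_on_SucD[OF Suc.prems(2), of "g x"]]
        that assms(5) by auto
    fix v
    \<comment> \<open>\<open>Ck_on\<close> controls derivatives only in fixed directions, whereas
      here the direction moves with \<open>x\<close>. Expanding it in the basis separates smooth
      coefficients from derivatives of \<open>f\<close> in constant directions, to which the
      induction hypothesis applies.\<close>
    have eq: "frechet_derivative f (at (g x)) (frechet_derivative g (at x) v) =
      (\<Sum>b\<in>Basis. (frechet_derivative g (at x) v \<bullet> b) *\<^sub>R frechet_derivative f (at (g x)) b)"
      if "x \<in> T" for x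
    proof -
      have "linear (frechet_derivative f (at (g x)))"
        using Ck_on_SucD[OF Suc.prems(2), of "g x"] that assms(5) has_derivative_linear by blast
      then show ?thesis
        by (subst euclidean_representation[symmetric, of "frechet_derivative g (at x) v"])
          (simp add: linear_sum linear_cmul)
    qed
    have "Ck_on k T (\<lambda>x. \<Sum>b\<in>Basis. (frechet_derivative g (at x) v \<bullet> b) *\<^sub>R frechet_derivative f (at (g x)) b)"
      by (intro Ck_on_sum Ck_on_scaleR Ck_on_inner Ck_on_const assms(2)) (use Suc.prems(1) Suc.IH[OF g, of "\<lambda>x. frechet_derivative f (at x) _"] Suc.prems(2) in auto)
    then show "Ck_on k T (\<lambda>x. frechet_derivative f (at (g x)) (frechet_derivative g (at x) v))"
      by (rule Ck_on_eqI[OF \<open>open T\<close>]) (rule eq)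
  qed
qed

text \<open>Real powers are closed under differentiation up to a constant factor, so the induction
  runs over all exponents at once. Exponent -1 later gives quotients, and exponent -1/2 the
  normalisation of a covector.\<close>

lemma Ck_on_powr: "Ck_on k {0<..} (\<lambda>x::real. x powr a)"
proof (induction k arbitrary: a)
  case 0
  then show ?case by (auto intro!: continuous_intros)
next
  case (Suc k)
  show ?case
  proof (rule Ck_on_SucI)
    show "((\<lambda>x. x powr a) has_derivative (\<lambda>v. v * (a * x powr (a - 1)))) (at x)" if "x \<in> {0<..}" for x::real
      using has_real_derivative_powr[of x a] that by (simp add: has_field_derivative_def mult.commute[of _ "a * _"])
    show "Ck_on k {0<..} (\<lambda>x::real. v * (a * x powr (a - 1)))" for v
      by (intro Ck_on_mult Ck_on_const Suc.IH) auto
  qed auto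
qed

lemma Ck_on_powr_compose:
  fixes f :: "'a::euclidean_space \<Rightarrow> real"
  assumes "open S" "Ck_on k S f" "\<And>x. x \<in> S \<Longrightarrow> f x > 0"
  shows "Ck_on k S (\<lambda>x. f x powr a)"
  using Ck_on_compose[OF _ assms(1,2) Ck_on_powr] assms(3) by auto

text \<open>The reciprocal of \<open>g\<close> is written as \<open>g * (g * g) powr (-1)\<close>:
  the square is positive whatever the sign of \<open>g\<close>, as the power function
  requires.\<close>

lemma Ck_on_divide:
  fixes f g :: "'a::euclidean_space \<Rightarrow> real"
  assumes "open S" "Ck_on k S f" "Ck_on k S g" "\<And>x. x \<in> S \<Longrightarrow> g x \<noteq> 0"
  shows "Ck_on k S (\<lambda>x. f x / g x)"
proof -
  have pos: "g x * g x > 0" if "x \<in> S" for x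
    using assms(4)[OF that] zero_less_power2[of "g x"] by (simp add: power2_eq_square)
  have "Ck_on k S (\<lambda>x. f x * (g x * (g x * g x) powr (-1)))"
    by (intro Ck_on_mult Ck_on_powr_compose assms(1-3) pos)
  moreover have "f x / g x = f x * (g x * (g x * g x) powr (-1))" if "x \<in> S" for x
  proof -
    have "(g x * g x) powr (-1) = 1 / (g x * g x)"
      using pos[OF that] by (simp add: powr_minus divide_inverse)
    then show ?thesis using assms(4)[OF that] by simp
  qed
  ultimately show ?thesis by (rule Ck_on_eqI[OF assms(1)])
qed

lemma Ck_on_det:
  fixes A :: "'a::euclidean_space \<Rightarrow> real^'n^'n"
  assumes "open S" "\<And>i j. Ck_on k S (\<lambda>x. A x $ i $ j)"
  shows "Ck_on k S (\<lambda>x. det (A x))"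
  unfolding det_def by (intro Ck_on_sum Ck_on_mult Ck_on_prod Ck_on_const assms)

section \<open>Matrix inversion and the inverse function theorem\<close>

lemma matrix_inv_works:
  fixes A :: "real^'n^'n"
  assumes "invertible A"
  shows "A ** matrix_inv A = mat 1" "matrix_inv A ** A = mat 1"
  using someI_ex[OF assms[unfolded invertible_def]] unfolding matrix_inv_def by auto

lemma matrix_apply:
  fixes f :: "real^'n \<Rightarrow> real^'m"
  assumes "linear f"
  shows "matrix f *v x = f x"
  using matrix_vector_mul(2)[OF assms] by metis

text \<open>Cramer's rule for the columns of the inverse. Each entry becomes a quotient of
  polynomials in the entries of \<open>A\<close>, which makes inversion smooth.\<close>

lemma matrix_inv_entry:
  fixes A :: "real^'n^'n"
  assumes "det A \<noteq> 0"
  shows "matrix_inv A $ i $ j = det (\<chi> r s. if s = i then axis j 1 $ r else A $ r $ s) / det A"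
proof -
  have "A ** matrix_inv A = mat 1"
    using assms by (simp add: invertible_det_nz matrix_inv_works)
  then have "A *v (matrix_inv A *v axis j 1) = axis j 1"
    by (simp add: matrix_vector_mul_assoc)
  then have "matrix_inv A *v axis j 1 = (\<chi> k. det (\<chi> r s. if s = k then axis j 1 $ r else A $ r $ s) / det A)"
    using cramer[OF assms] by blast
  then have "(matrix_inv A *v axis j 1) $ i = det (\<chi> r s. if s = i then axis j 1 $ r else A $ r $ s) / det A"
    by simp
  then show ?thesis by (simp add: matrix_vector_mult_basis column_def)
qed

lemma Ck_on_matrix_inv:
  fixes A :: "'a::euclidean_space \<Rightarrow> real^'n^'n"
  assumes "open S" "Ck_on k S A" "\<And>x. x \<in> S \<Longrightarrow> invertible (A x)"
  shows "Ck_on k S (\<lambda>x. matrix_inv (A x))"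
proof (intro Ck_on_vec assms(1))
  fix i j
  have A: "Ck_on k S (\<lambda>x. A x $ r $ s)" for r s
    by (intro Ck_on_nth assms)
  have "Ck_on k S (\<lambda>x. det (\<chi> r s. if s = i then axis j 1 $ r else A x $ r $ s) / det (A x))"
  proof (intro Ck_on_divide Ck_on_det assms(1) A)
    fix r s
    show "Ck_on k S (\<lambda>x. (\<chi> r s. if s = i then axis j 1 $ r else A x $ r $ s) $ r $ s)"
      by (cases "s = i") (simp_all add: A Ck_on_const)
  qed (use assms(3) in \<open>simp add: invertible_det_nz\<close>)
  then show "Ck_on k S (\<lambda>x. matrix_inv (A x) $ i $ j)"
    by (rule Ck_on_eqI[OF assms(1)]) (use assms(3) in \<open>simp add: invertible_det_nz matrix_inv_entry\<close>)
qed

text \<open>Bootstrapping: the derivative of \<open>g\<close> at \<open>y\<close> is the inverse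
  matrix of the derivative of \<open>f\<close> at \<open>g y\<close>, so if \<open>g\<close> is of
  class C^k, its derivative is too, and \<open>g\<close> gains one order.\<close>

lemma Ck_on_local_inverse:
  fixes f :: "real^'n \<Rightarrow> real^'n"
  assumes "open U" "open V" "\<And>k. Ck_on k U f" "continuous_on V g" "g ` V \<subseteq> U"
    and fg: "\<And>y. y \<in> V \<Longrightarrow> f (g y) = y"
    and inj: "\<And>y. y \<in> U \<Longrightarrow> inj (frechet_derivative f (at y))"
  shows "Ck_on k V g"
proof (induction k)
  case 0
  then show ?case using assms by auto
next
  case (Suc k)
  let ?A = "\<lambda>y. matrix (frechet_derivative f (at y))"
  have der: "(f has_derivative frechet_derivative f (at y)) (at y)" if "y \<in> U" for y
    using Ck_on_SucD[OF assms(3)] that by blast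
  have lin: "linear (frechet_derivative f (at y))" if "y \<in> U" for y
    using der[OF that] has_derivative_linear by blast
  have inv: "invertible (?A y)" if "y \<in> U" for y
    using matrix_left_invertible_injective[of "?A y"] inj[OF that] lin[OF that]
    by (simp add: invertible_left_inverse matrix_apply[OF lin[OF that]] fun_eq_iff inj_def)
  show ?case
  proof (rule Ck_on_SucI[OF \<open>open V\<close>])
    show "(g has_derivative (\<lambda>v. matrix_inv (?A (g y)) *v v)) (at y)" if "y \<in> V" for y
    proof (rule has_derivative_inverse_basic[OF der _ _ _ \<open>open V\<close> that fg])
      show gU: "g y \<in> U" using that assms(5) by auto
      show "bounded_linear ((*v) (matrix_inv (?A (g y))))" by simp
      show "(*v) (matrix_inv (?A (g y))) \<circ> frechet_derivative f (at (g y)) = id"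
      proof
        fix x
        have "matrix_inv (?A (g y)) *v (?A (g y) *v x) = x"
          using matrix_inv_works[OF inv[OF gU]] by (simp add: matrix_vector_mul_assoc)
        then show "((*v) (matrix_inv (?A (g y))) \<circ> frechet_derivative f (at (g y))) x = id x"
          by (simp add: matrix_apply[OF lin[OF gU]])
      qed
      show "continuous (at y) g" using assms(2,4) that continuous_on_eq_continuous_at by blast
    qed
    fix v
    have D: "Ck_on k V (\<lambda>y. frechet_derivative f (at (g y)) w)" for w
      using Ck_on_compose[OF assms(1,2) Suc, of "\<lambda>y. frechet_derivative f (at y) w"] assms(3)[of "Suc k"] assms(5) by auto
    have "Ck_on k V (\<lambda>y. ?A (g y))"
    proof (intro Ck_on_vec \<open>open V\<close>)
      fix i j
      show "Ck_on k V (\<lambda>y. ?A (g y) $ i $ j)"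
        unfolding matrix_def using Ck_on_nth[OF \<open>open V\<close> D] by simp
    qed
    then have "Ck_on k V (\<lambda>y. matrix_inv (?A (g y)))"
      by (rule Ck_on_matrix_inv[OF \<open>open V\<close>]) (use inv assms(5) in auto)
    then have "Ck_on k V (\<lambda>y. matrix_inv (?A (g y)) $ i $ j)" for i j
      by (intro Ck_on_nth \<open>open V\<close>)
    then show "Ck_on k V (\<lambda>y. matrix_inv (?A (g y)) *v v)"
      by (intro Ck_on_vec \<open>open V\<close>)
        (auto simp: matrix_vector_mult_def intro!: Ck_on_sum Ck_on_mult Ck_on_const \<open>open V\<close>)
  qed
qed

text \<open>The inverse function theorem also returns bijectivity of the derivative over the whole
  new domain, which is what the bootstrapping of \<open>Ck_on_local_inverse\<close> needs at every
  point.\<close>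

lemma local_inverse_exists:
  fixes f :: "real^'n \<Rightarrow> real^'n"
  assumes "open U" "\<And>k. Ck_on k U f" "x0 \<in> U" and inj: "inj (frechet_derivative f (at x0))"
  obtains U' V g where "open U'" "U' \<subseteq> U" "x0 \<in> U'" "open V" "f x0 \<in> V" "homeomorphism U' V f g"
    "\<And>y. y \<in> U' \<Longrightarrow> inj (frechet_derivative f (at y))" "\<And>k. Ck_on k V g"
proof -
  let ?D = "\<lambda>x. Blinfun (frechet_derivative f (at x))"
  have der: "(f has_derivative frechet_derivative f (at y)) (at y)" if "y \<in> U" for y
    using Ck_on_SucD[OF assms(2)] that by blast
  have D: "blinfun_apply (?D x) = frechet_derivative f (at x)" if "x \<in> U" for x
    using der[OF that] has_derivative_bounded_linear bounded_linear_Blinfun_apply by blast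
  have lin: "linear (frechet_derivative f (at x0))"
    using der[OF assms(3)] has_derivative_linear by blast
  obtain L where L: "linear L" "L \<circ> frechet_derivative f (at x0) = id"
    using linear_injective_left_inverse[OF lin inj] by blast
  have BL: "bounded_linear L" using L(1) linear_conv_bounded_linear by blast
  have "continuous_on U ?D"
  proof (rule continuous_on_blinfun_componentwise)
    fix i :: "real^'n"
    have "continuous_on U (\<lambda>x. frechet_derivative f (at x) i)"
      using assms(2)[of "Suc 0"] by auto
    then show "continuous_on U (\<lambda>x. blinfun_apply (?D x) i)"
      by (rule continuous_on_eq) (simp add: D)
  qed
  moreover have "Blinfun L o\<^sub>L ?D x0 = id_blinfun"
    using L(2) D[OF assms(3)] by (intro blinfun_eqI) (simp add: bounded_linear_Blinfun_apply[OF BL] o_def id_def fun_eq_iff)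
  ultimately obtain U' V g g' where *: "open U'" "U' \<subseteq> U" "x0 \<in> U'" "open V" "f x0 \<in> V" "homeomorphism U' V f g"
      "\<And>y. y \<in> V \<Longrightarrow> bij (blinfun_apply (?D (g y)))"
    using inverse_function_theorem[OF assms(1) _ _ assms(3), of f ?D "Blinfun L"] der D by metis
  have inj': "inj (frechet_derivative f (at y))" if "y \<in> U'" for y
  proof -
    have "f y \<in> V" "g (f y) = y" using *(6) that by (auto simp: homeomorphism_def)
    then show ?thesis using *(7)[of "f y"] D[of y] *(2) that bij_is_inj by (metis subsetD)
  qed
  have "Ck_on k V g" for k
    by (rule Ck_on_local_inverse[OF *(1,4) _ _ _ _ inj'])
      (use *(6) assms(2) *(2) in \<open>auto simp: homeomorphism_def intro: Ck_on_subset\<close>)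
  then show ?thesis using that * inj' by blast
qed

text \<open>The target of an immersion may have larger dimension, so the inverse function theorem is
  applied to \<open>L \<circ> F\<close>, with \<open>L\<close> a left inverse of the derivative of
  \<open>F\<close> at one point. Near that point \<open>g\<close> is the local inverse of
  \<open>L \<circ> F\<close> after the smooth map \<open>L \<circ> F \<circ> g\<close>.\<close>

lemma smooth_on_factor:
  fixes F :: "real^'n \<Rightarrow> 'b::euclidean_space" and g :: "'c::euclidean_space \<Rightarrow> real^'n"
  assumes "open U" "open T" "smooth_on U F" and inj: "\<And>y. y \<in> U \<Longrightarrow> inj (frechet_derivative F (at y))"
    and g: "continuous_on T g" "g ` T \<subseteq> U" and Fg: "smooth_on T (\<lambda>x. F (g x))"
  shows "smooth_on T g"
  unfolding smooth_on_def
proof (intro allI Ck_on_local)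
  fix k x0 assume x0: "x0 \<in> T"
  let ?y = "g x0"
  have y: "?y \<in> U" using x0 g by auto
  have der: "(F has_derivative frechet_derivative F (at y)) (at y)" if "y \<in> U" for y
    using Ck_on_SucD[of 0 U F y] assms(3) that unfolding smooth_on_def by blast
  have lin: "linear (frechet_derivative F (at ?y))"
    using der[OF y] has_derivative_linear by blast
  obtain L where L: "linear L" "L \<circ> frechet_derivative F (at ?y) = id"
    using linear_injective_left_inverse[OF lin inj[OF y]] by blast
  have BL: "bounded_linear L" using L(1) linear_conv_bounded_linear by blast
  let ?f = "\<lambda>y. L (F y)"
  have f: "Ck_on k U ?f" for k
    using Ck_on_bounded_linear_compose[OF BL assms(1)] assms(3) by (auto simp: smooth_on_def)
  have "frechet_derivative ?f (at ?y) = L \<circ> frechet_derivative F (at ?y)"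
    using frechet_derivative_at[OF bounded_linear.has_derivative[OF BL der[OF y]]] by (simp add: o_def)
  then have "inj (frechet_derivative ?f (at ?y))" using L(2) by simp
  then obtain U' V h where *: "open U'" "U' \<subseteq> U" "?y \<in> U'" "open V" "?f ?y \<in> V" "homeomorphism U' V ?f h"
      "\<And>k. Ck_on k V h"
    using local_inverse_exists[OF assms(1) f y] by metis
  let ?T = "g -` U' \<inter> T"
  have T: "open ?T" using continuous_on_open_vimage[OF assms(2)] g(1) *(1) by blast
  have eq: "h (?f (g x)) = g x" "?f (g x) \<in> V" if "x \<in> ?T" for x
    using that *(6) by (auto simp: homeomorphism_def)
  have "Ck_on k ?T (\<lambda>x. ?f (g x))"
    using Ck_on_subset[OF Ck_on_bounded_linear_compose[OF BL assms(2)]] Fg by (auto simp: smooth_on_def)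
  then have "Ck_on k ?T (\<lambda>x. h (?f (g x)))"
    by (rule Ck_on_compose[OF *(4) T _ *(7)]) (use eq in auto)
  then have "Ck_on k ?T g" using Ck_on_cong[OF T, of "\<lambda>x. h (?f (g x))" g] eq by simp
  then show "\<exists>T. open T \<and> x0 \<in> T \<and> Ck_on k T g" using T x0 *(3) by blast
qed

section \<open>Mixed second derivatives and the Poincare lemma\<close>

text \<open>The mean value theorem is applied twice: to the increment of \<open>f\<close> across
  \<open>h *\<^sub>R b\<close> as a function of the position along \<open>a\<close>, then to the
  derivative in direction \<open>a\<close> as a function of the position along
  \<open>b\<close>.\<close>

lemma second_difference_mean_value:
  fixes f :: "'a::euclidean_space \<Rightarrow> real"
  assumes S: "open S" "Ck_on (Suc (Suc 0)) S f" and "h > 0"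
    and box: "\<And>s t. 0 \<le> s \<Longrightarrow> s \<le> h \<Longrightarrow> 0 \<le> t \<Longrightarrow> t \<le> h \<Longrightarrow> y + s *\<^sub>R a + t *\<^sub>R b \<in> S"
  obtains s t where "0 < s" "s < h" "0 < t" "t < h"
    "f (y + h *\<^sub>R a + h *\<^sub>R b) - f (y + h *\<^sub>R a) - f (y + h *\<^sub>R b) + f y
      = h * h * frechet_derivative (\<lambda>x. frechet_derivative f (at x) a) (at (y + s *\<^sub>R a + t *\<^sub>R b)) b"
proof -
  let ?D = "\<lambda>x. frechet_derivative f (at x)"
  let ?DD = "\<lambda>x. frechet_derivative (\<lambda>x. ?D x a) (at x)"
  have D: "(f has_derivative ?D x) (at x)" if "x \<in> S" for x
    using Ck_on_SucD[OF S(2) that] .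
  have DD: "((\<lambda>x. ?D x a) has_derivative ?DD x) (at x)" if "x \<in> S" for x
    using Ck_on_SucD[of 0 S "\<lambda>x. ?D x a" x] S(2) that by simp
  let ?\<phi> = "\<lambda>s. f (y + s *\<^sub>R a + h *\<^sub>R b) - f (y + s *\<^sub>R a)"
  have "(?\<phi> has_derivative (\<lambda>v. v * (?D (y + s *\<^sub>R a + h *\<^sub>R b) a - ?D (y + s *\<^sub>R a) a))) (at s)"
    if "0 \<le> s" "s \<le> h" for s
  proof -
    have in_S: "y + s *\<^sub>R a + h *\<^sub>R b \<in> S" "y + s *\<^sub>R a \<in> S"
      using box[of s h] box[of s 0] that \<open>h > 0\<close> by auto
    have 1: "((\<lambda>s. f (y + s *\<^sub>R a + h *\<^sub>R b)) has_derivative (\<lambda>v. ?D (y + s *\<^sub>R a + h *\<^sub>R b) (v *\<^sub>R a))) (at s)"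
      by (rule has_derivative_compose[of "\<lambda>s. y + s *\<^sub>R a + h *\<^sub>R b", OF _ D[OF in_S(1)]])
        (auto intro!: derivative_eq_intros)
    have 2: "((\<lambda>s. f (y + s *\<^sub>R a)) has_derivative (\<lambda>v. ?D (y + s *\<^sub>R a) (v *\<^sub>R a))) (at s)"
      by (rule has_derivative_compose[of "\<lambda>s. y + s *\<^sub>R a", OF _ D[OF in_S(2)]])
        (auto intro!: derivative_eq_intros)
    show ?thesis
      using has_derivative_diff[OF 1 2] linear_cmul[OF has_derivative_linear[OF D[OF in_S(1)]]]
        linear_cmul[OF has_derivative_linear[OF D[OF in_S(2)]]]
      by (simp add: algebra_simps)
  qed
  then obtain s where s: "0 < s" "s < h"
    "?\<phi> h - ?\<phi> 0 = h * (?D (y + s *\<^sub>R a + h *\<^sub>R b) a - ?D (y + s *\<^sub>R a) a)"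
    using mvt_simple[OF \<open>h > 0\<close>, of ?\<phi> "\<lambda>s v. v * (?D (y + s *\<^sub>R a + h *\<^sub>R b) a - ?D (y + s *\<^sub>R a) a)"]
    by (force intro: has_derivative_at_withinI)
  let ?\<psi> = "\<lambda>t. ?D (y + s *\<^sub>R a + t *\<^sub>R b) a"
  have "(?\<psi> has_derivative (\<lambda>v. v * ?DD (y + s *\<^sub>R a + t *\<^sub>R b) b)) (at t)" if "0 \<le> t" "t \<le> h" for t
  proof -
    have in_S: "y + s *\<^sub>R a + t *\<^sub>R b \<in> S" using box[of s t] that s by auto
    have "(?\<psi> has_derivative (\<lambda>v. ?DD (y + s *\<^sub>R a + t *\<^sub>R b) (v *\<^sub>R b))) (at t)"
      by (rule has_derivative_compose[of "\<lambda>t. y + s *\<^sub>R a + t *\<^sub>R b", OF _ DD[OF in_S]])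
        (auto intro!: derivative_eq_intros)
    then show ?thesis using linear_cmul[OF has_derivative_linear[OF DD[OF in_S]]] by simp
  qed
  then obtain t where t: "0 < t" "t < h" "?\<psi> h - ?\<psi> 0 = h * ?DD (y + s *\<^sub>R a + t *\<^sub>R b) b"
    using mvt_simple[OF \<open>h > 0\<close>, of ?\<psi> "\<lambda>t v. v * ?DD (y + s *\<^sub>R a + t *\<^sub>R b) b"]
    by (force intro: has_derivative_at_withinI)
  show ?thesis
    by (rule that[OF s(1,2) t(1,2)]) (use s(3) t(3) in \<open>simp add: algebra_simps\<close>)
qed

text \<open>The second difference of \<open>f\<close> over a parallelogram is symmetric in
  \<open>a\<close> and \<open>b\<close>. Divided by the square of the scale it is a mixed derivative
  at some point of the parallelogram, in either order, and both points tend to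
  \<open>y\<close>.\<close>

lemma second_derivative_symmetric:
  fixes f :: "'a::euclidean_space \<Rightarrow> real"
  assumes S: "open S" "Ck_on (Suc (Suc 0)) S f" "y \<in> S"
  shows "frechet_derivative (\<lambda>x. frechet_derivative f (at x) a) (at y) b =
    frechet_derivative (\<lambda>x. frechet_derivative f (at x) b) (at y) a"
proof -
  define F where "F a b x = frechet_derivative (\<lambda>x. frechet_derivative f (at x) a) (at x) b" for a b x
  have cont: "isCont (F a b) y" for a b
    using S unfolding F_def by (simp add: continuous_on_eq_continuous_at)
  obtain r where r: "r > 0" "ball y r \<subseteq> S" using S openE by blast
  \<comment> \<open>Parallelograms with sides at most \<open>q\<close> times \<open>a\<close> and
    \<open>b\<close> stay within distance \<open>r / 2\<close> of \<open>y\<close>; the added 1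
    keeps the denominator positive when both vectors vanish.\<close>
  define q where "q = r / (2 * (norm a + norm b + 1))"
  have q: "q > 0" unfolding q_def using r(1) by (intro divide_pos_pos) (auto intro: add_nonneg_pos)
  define h where "h n = q / real (Suc n)" for n
  have h: "h n > 0" "h n \<le> q" for n using q by (auto simp: h_def divide_le_eq mult_le_cancel_left1)
  have lim_h: "h \<longlonglongrightarrow> 0" unfolding h_def
    using tendsto_mult[OF tendsto_const[of q] LIMSEQ_inverse_real_of_nat] by (simp add: divide_inverse)
  have bound: "norm (s *\<^sub>R a + t *\<^sub>R b) \<le> h n * (norm a + norm b)"
    if "0 \<le> s" "s \<le> h n" "0 \<le> t" "t \<le> h n" for s t n and a b :: 'a
    using norm_triangle_ineq[of "s *\<^sub>R a" "t *\<^sub>R b"] mult_right_mono[OF that(2), of "norm a"]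
      mult_right_mono[OF that(4), of "norm b"] that by (simp add: algebra_simps)
  have box: "y + s *\<^sub>R a' + t *\<^sub>R b' \<in> S"
    if "0 \<le> s" "s \<le> h n" "0 \<le> t" "t \<le> h n" "norm a' + norm b' = norm a + norm b" for s t n a' b'
  proof -
    have "norm (s *\<^sub>R a' + t *\<^sub>R b') \<le> q * (norm a + norm b)"
      using bound[of s n t a' b'] that h(2)[of n] mult_right_mono[OF h(2)[of n], of "norm a + norm b"] by simp
    also have "\<dots> < r"
    proof -
      have "norm a + norm b < 2 * (norm a + norm b + 1)"
        using add_nonneg_nonneg[OF norm_ge_zero[of a] norm_ge_zero[of b]] by (simp only: distrib_left)
      then show ?thesis unfolding q_def using r(1)
        by (simp add: divide_less_eq add_nonneg_pos mult_strict_left_mono)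
    qed
    finally have "dist (y + s *\<^sub>R a' + t *\<^sub>R b') y < r" by (simp add: dist_norm add.assoc)
    then show ?thesis using r(2) by (auto simp: dist_commute)
  qed
  \<comment> \<open>Both orders of the two directions are handled at once, since the second
    difference does not change when \<open>a\<close> and \<open>b\<close> are exchanged.\<close>
  have pts: "\<exists>p. dist y p \<le> h n * (norm a + norm b) \<and>
      f (y + h n *\<^sub>R a + h n *\<^sub>R b) - f (y + h n *\<^sub>R a) - f (y + h n *\<^sub>R b) + f y = h n * h n * F a' b' p"
    if ab: "(a' = a \<and> b' = b) \<or> (a' = b \<and> b' = a)" for n a' b'
  proof -
    have *: "norm a' + norm b' = norm a + norm b" using ab by auto
    have bx: "y + s *\<^sub>R a' + t *\<^sub>R b' \<in> S" if "0 \<le> s" "s \<le> h n" "0 \<le> t" "t \<le> h n" for s t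
      using box[OF that *] .
    obtain s t where st: "0 < s" "s < h n" "0 < t" "t < h n"
      "f (y + h n *\<^sub>R a' + h n *\<^sub>R b') - f (y + h n *\<^sub>R a') - f (y + h n *\<^sub>R b') + f y
        = h n * h n * F a' b' (y + s *\<^sub>R a' + t *\<^sub>R b')"
      unfolding F_def by (rule second_difference_mean_value[OF S(1,2) h(1)[of n] bx]) blast+
    have "dist y (y + s *\<^sub>R a' + t *\<^sub>R b') \<le> h n * (norm a + norm b)"
      using bound[of s n t a' b'] st * by (subst dist_commute) (simp add: dist_norm add.assoc)
    then show ?thesis using st(5) ab by (auto simp: algebra_simps)
  qed
  have lim: "(\<lambda>n. F a' b' (p n)) \<longlonglongrightarrow> F a' b' y" if "\<And>n. dist y (p n) \<le> h n * (norm a + norm b)" for p a' b'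
  proof -
    have "(\<lambda>n. h n * (norm a + norm b)) \<longlonglongrightarrow> 0"
      using tendsto_mult[OF lim_h tendsto_const] by simp
    then have "(\<lambda>n. dist (p n) y) \<longlonglongrightarrow> 0"
      by (rule Lim_null_comparison[rotated]) (use that in \<open>simp add: dist_commute\<close>)
    then have "p \<longlonglongrightarrow> y" using tendsto_dist_iff by blast
    then show ?thesis using cont isCont_tendsto_compose by blast
  qed
  obtain p where p: "\<And>n. dist y (p n) \<le> h n * (norm a + norm b)"
    "\<And>n. f (y + h n *\<^sub>R a + h n *\<^sub>R b) - f (y + h n *\<^sub>R a) - f (y + h n *\<^sub>R b) + f y = h n * h n * F a b (p n)"
    using pts[of a b] by metis
  obtain p' where p': "\<And>n. dist y (p' n) \<le> h n * (norm a + norm b)"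
    "\<And>n. f (y + h n *\<^sub>R a + h n *\<^sub>R b) - f (y + h n *\<^sub>R a) - f (y + h n *\<^sub>R b) + f y = h n * h n * F b a (p' n)"
    using pts[of b a] by metis
  have "F a b (p n) = F b a (p' n)" for n
    using p(2)[of n] p'(2)[of n] h(1)[of n] by simp
  then have "F a b y = F b a y"
    using LIMSEQ_unique[OF lim[OF p(1), of a b]] lim[OF p'(1), of b a] by simp
  then show ?thesis unfolding F_def .
qed

text \<open>The primitive is the integral of the form along the segment from the centre.
  Differentiating under the integral and using the symmetry of the derivative turns the integrand
  into the \<open>t\<close>-derivative of \<open>t *\<^sub>R \<alpha> (p y t)\<close>, which
  integrates to \<open>\<alpha> y\<close>.\<close>

lemma closed_form_exact_on_ball:
  fixes \<alpha> :: "'a::euclidean_space \<Rightarrow> 'a"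
  assumes "Ck_on (Suc 0) (ball y0 r) \<alpha>"
    and sym: "\<And>y v w. y \<in> ball y0 r \<Longrightarrow>
      frechet_derivative \<alpha> (at y) v \<bullet> w = frechet_derivative \<alpha> (at y) w \<bullet> v"
  obtains s where "\<And>y. y \<in> ball y0 r \<Longrightarrow> (s has_derivative (\<lambda>v. \<alpha> y \<bullet> v)) (at y)"
proof -
  let ?B = "ball y0 r"
  let ?D = "\<lambda>y. frechet_derivative \<alpha> (at y)"
  define p where "p y t = y0 + t *\<^sub>R (y - y0)" for y and t :: real
  have p: "p y t \<in> ?B" if "y \<in> ?B" "t \<in> cbox 0 1" for y t
  proof -
    have "\<bar>t\<bar> * norm (y0 - y) \<le> 1 * norm (y0 - y)" using that by (intro mult_right_mono) auto
    then show ?thesis using that by (simp add: p_def dist_norm norm_minus_commute)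
  qed
  have D: "(\<alpha> has_derivative ?D y) (at y)" if "y \<in> ?B" for y
    using Ck_on_SucD[OF assms(1) that] .
  have lin: "linear (?D y)" if "y \<in> ?B" for y using D[OF that] has_derivative_linear by blast
  \<comment> \<open>This is the derivative of the integrand with respect to \<open>y\<close>, with
    the symmetry already used to move \<open>y - y0\<close> into the derivative of \<alpha>; in this
    form it is also a derivative with respect to \<open>t\<close>.\<close>
  define fx where "fx y t = blinfun_inner_right (\<alpha> (p y t)) + t *\<^sub>R blinfun_inner_right (?D (p y t) (y - y0))" for y t
  have cont_p: "continuous_on (?B \<times> cbox 0 1) (\<lambda>z. p (fst z) (snd z))"
    unfolding p_def by (intro continuous_intros)
  have cont_\<alpha>: "continuous_on (?B \<times> cbox 0 1) (\<lambda>z. \<alpha> (p (fst z) (snd z)))"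
    by (rule continuous_on_compose2[OF _ cont_p, of ?B])
      (use Ck_on_Suc_imp[OF assms(1)] p in auto)
  have cont_D: "continuous_on (?B \<times> cbox 0 1) (\<lambda>z. ?D (p (fst z) (snd z)) (fst z - y0))"
  proof -
    have "continuous_on (?B \<times> cbox 0 1) (\<lambda>z. ?D (p (fst z) (snd z)) b)" for b
      by (rule continuous_on_compose2[OF _ cont_p, of ?B "\<lambda>x. ?D x b"]) (use assms(1) p in auto)
    then have "continuous_on (?B \<times> cbox 0 1)
        (\<lambda>z. \<Sum>b\<in>Basis. ((fst z - y0) \<bullet> b) *\<^sub>R ?D (p (fst z) (snd z)) b)"
      by (intro continuous_intros)
    then show ?thesis
    proof (rule continuous_on_eq)
      fix z assume "z \<in> ?B \<times> cbox 0 (1::real)"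
      then have "linear (?D (p (fst z) (snd z)))" using p lin by auto
      then show "(\<Sum>b\<in>Basis. ((fst z - y0) \<bullet> b) *\<^sub>R ?D (p (fst z) (snd z)) b) = ?D (p (fst z) (snd z)) (fst z - y0)"
        by (subst (2) euclidean_representation[symmetric, of "fst z - y0"]) (simp add: linear_sum linear_cmul)
    qed
  qed
  define s where "s y = integral (cbox 0 1) (\<lambda>t. \<alpha> (p y t) \<bullet> (y - y0))" for y
  have "(s has_derivative (\<lambda>v. \<alpha> y \<bullet> v)) (at y)" if y: "y \<in> ?B" for y
  proof -
    have 1: "((\<lambda>y. \<alpha> (p y t) \<bullet> (y - y0)) has_derivative blinfun_apply (fx y t)) (at y within ?B)"
      if "y \<in> ?B" "t \<in> cbox 0 1" for y t
    proof -
      have "((\<lambda>y. p y t) has_derivative (\<lambda>v. t *\<^sub>R v)) (at y)"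
        unfolding p_def by (auto intro!: derivative_eq_intros)
      then have "((\<lambda>y. \<alpha> (p y t)) has_derivative (\<lambda>v. ?D (p y t) (t *\<^sub>R v))) (at y)"
        using has_derivative_compose D[OF p[OF that]] by blast
      then have "((\<lambda>y. \<alpha> (p y t) \<bullet> (y - y0)) has_derivative
          (\<lambda>v. \<alpha> (p y t) \<bullet> v + ?D (p y t) (t *\<^sub>R v) \<bullet> (y - y0))) (at y)"
        by (auto intro!: derivative_eq_intros)
      moreover have "(\<lambda>v. \<alpha> (p y t) \<bullet> v + ?D (p y t) (t *\<^sub>R v) \<bullet> (y - y0)) = blinfun_apply (fx y t)"
        unfolding fx_def using sym[OF p[OF that]] lin[OF p[OF that]]
        by (auto simp: fun_eq_iff blinfun.add_left blinfun.scaleR_left linear_cmul)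
      ultimately show ?thesis using has_derivative_at_withinI by metis
    qed
    have cont_p1: "continuous_on (cbox 0 1) (\<lambda>t. p y t)" for y
      unfolding p_def by (intro continuous_intros)
    have 2: "(\<lambda>t. \<alpha> (p y t) \<bullet> (y - y0)) integrable_on cbox 0 1" if "y \<in> ?B" for y
      by (intro integrable_continuous continuous_intros continuous_on_compose2[OF _ cont_p1, of ?B \<alpha>])
        (use Ck_on_Suc_imp[OF assms(1)] p[OF that] in auto)
    have 3: "continuous_on (?B \<times> cbox 0 1) (\<lambda>(y, t). fx y t)"
      unfolding fx_def case_prod_beta
      by (intro continuous_intros cont_\<alpha> cont_D bounded_linear.continuous_on[OF bounded_linear_blinfun_inner_right])
    have "(fx y has_integral (1 *\<^sub>R blinfun_inner_right (\<alpha> (p y 1)) - 0 *\<^sub>R blinfun_inner_right (\<alpha> (p y 0)))) {0..1}"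
    proof (rule fundamental_theorem_of_calculus)
      fix t :: real assume t: "t \<in> {0..1}"
      have "((\<lambda>t. p y t) has_derivative (\<lambda>v. v *\<^sub>R (y - y0))) (at t)"
        unfolding p_def by (auto intro!: derivative_eq_intros)
      then have "((\<lambda>t. \<alpha> (p y t)) has_derivative (\<lambda>v. ?D (p y t) (v *\<^sub>R (y - y0)))) (at t)"
        using has_derivative_compose D[OF p[OF y, of t]] t by auto
      then have "((\<lambda>t. blinfun_inner_right (\<alpha> (p y t))) has_derivative
          (\<lambda>v. blinfun_inner_right (?D (p y t) (v *\<^sub>R (y - y0))))) (at t)"
        by (rule bounded_linear.has_derivative[OF bounded_linear_blinfun_inner_right])
      from has_derivative_scaleR[OF has_derivative_ident this]
      have "((\<lambda>t. t *\<^sub>R blinfun_inner_right (\<alpha> (p y t))) has_derivative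
          (\<lambda>v. t *\<^sub>R blinfun_inner_right (?D (p y t) (v *\<^sub>R (y - y0))) + v *\<^sub>R blinfun_inner_right (\<alpha> (p y t)))) (at t)" .
      moreover have "(\<lambda>v. t *\<^sub>R blinfun_inner_right (?D (p y t) (v *\<^sub>R (y - y0))) + v *\<^sub>R blinfun_inner_right (\<alpha> (p y t)))
          = (\<lambda>v. v *\<^sub>R fx y t)"
        using linear_cmul[OF lin[OF p[OF y, of t]]] t
        by (auto simp: fun_eq_iff fx_def distrib_left mult.left_commute intro!: blinfun_eqI simp: blinfun.add_left blinfun.scaleR_left)
      ultimately show "((\<lambda>t. t *\<^sub>R blinfun_inner_right (\<alpha> (p y t))) has_vector_derivative fx y t) (at t within {0..1})"
        unfolding has_vector_derivative_def using has_derivative_at_withinI by metis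
    qed simp
    then have "integral (cbox 0 1) (fx y) = blinfun_inner_right (\<alpha> y)"
      by (simp add: p_def integral_unique)
    moreover have "(s has_derivative integral (cbox 0 1) (fx y)) (at y within ?B)"
      using leibniz_rule[of ?B 0 1 "\<lambda>y t. \<alpha> (p y t) \<bullet> (y - y0)" fx, OF 1 2 3 y convex_ball]
      unfolding s_def by blast
    ultimately have "(s has_derivative blinfun_apply (blinfun_inner_right (\<alpha> y))) (at y)"
      using at_within_open[OF y open_ball] by simp
    then show ?thesis by (simp add: blinfun_inner_right.rep_eq)
  qed
  then show ?thesis using that by blast
qed

section \<open>Riemannian geometry in a chart\<close>

lemma bounded_bilinear_matrix_vector:
  "bounded_bilinear ((*v) :: real^'n^'m \<Rightarrow> real^'n \<Rightarrow> real^'m)"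
  unfolding bilinear_conv_bounded_bilinear[symmetric] bilinear_def linear_iff
  by (auto simp: matrix_vector_right_distrib matrix_vector_mult_add_rdistrib vec_eq_iff
      matrix_vector_mult_def sum_distrib_left sum.distrib[symmetric] algebra_simps)

lemma inner_matrix_symmetric:
  fixes A :: "real^'n^'n"
  assumes "transpose A = A"
  shows "x \<bullet> (A *v y) = (A *v x) \<bullet> y"
  using dot_lmul_matrix[of x A y] transpose_matrix_vector[of A x] assms by simp

lemma inner_pullback:
  fixes J G :: "real^'n^'n"
  shows "v \<bullet> ((transpose J ** G ** J) *v v') = (J *v v) \<bullet> (G *v (J *v v'))"
proof -
  have "v \<bullet> ((transpose J ** G ** J) *v v') = v \<bullet> (transpose J *v (G *v (J *v v')))"
    by (simp add: matrix_vector_mul_assoc matrix_mul_assoc del: transpose_matrix_vector)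
  also have "\<dots> = (J *v v) \<bullet> (G *v (J *v v'))"
    using dot_lmul_matrix[of v "transpose J"] transpose_matrix_vector[of "transpose J" v]
    by (simp add: transpose_transpose del: transpose_matrix_vector)
  finally show ?thesis .
qed

text \<open>Components of the differential as a covector, not the Riemannian gradient: no metric is
  involved.\<close>

definition cgrad :: "(real^'n::finite \<Rightarrow> real) \<Rightarrow> real^'n \<Rightarrow> real^'n" where
  "cgrad f y = (\<chi> j. partial j f y)"

text \<open>The connection matrix in direction \<open>l\<close>, arranged so that the covariant
  derivative of a covector field is its partial derivative minus this matrix applied to it.\<close>

definition conn :: "('a, 'n::finite) riem \<Rightarrow> ('a, 'n) chart \<Rightarrow> real^'n \<Rightarrow> 'n \<Rightarrow> real^'n^'n" where
  "conn M c y l = (\<chi> i k. christoffel M c y k l i)"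

text \<open>The metric on covectors, whose matrix is the inverse of the metric matrix.\<close>

definition pairing ::
    "('a, 'n::finite) riem \<Rightarrow> ('a, 'n) chart \<Rightarrow> (real^'n \<Rightarrow> real^'n) \<Rightarrow> (real^'n \<Rightarrow> real^'n) \<Rightarrow> real^'n \<Rightarrow> real" where
  "pairing M c \<alpha> \<beta> y = \<alpha> y \<bullet> (matrix_inv (gmat M c y) *v \<beta> y)"

definition parallel_form ::
    "('a, 'n::finite) riem \<Rightarrow> ('a, 'n) chart \<Rightarrow> (real^'n) set \<Rightarrow> (real^'n \<Rightarrow> real^'n) \<Rightarrow> bool" where
  "parallel_form M c S \<alpha> \<longleftrightarrow> smooth_on S \<alpha> \<and>
     (\<forall>y\<in>S. \<forall>l. frechet_derivative \<alpha> (at y) (axis l 1) = conn M c y l *v \<alpha> y)"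

text \<open>A local isometry into Euclidean space, read in the chart: the metric matrix is the Gram
  matrix of the images of the coordinate vectors.\<close>

definition flat_coords ::
    "('a, 'n::finite) riem \<Rightarrow> ('a, 'n) chart \<Rightarrow> (real^'n) set \<Rightarrow> (real^'n \<Rightarrow> real^'n) \<Rightarrow> bool" where
  "flat_coords M c S u \<longleftrightarrow> smooth_on S u \<and>
     (\<forall>y\<in>S. \<forall>i j. gmat M c y $ i $ j =
        frechet_derivative u (at y) (axis i 1) \<bullet> frechet_derivative u (at y) (axis j 1))"

lemma smooth_onD: "smooth_on S f \<Longrightarrow> Ck_on k S f"
  by (simp add: smooth_on_def)

lemma smooth_on_subset: "smooth_on S f \<Longrightarrow> T \<subseteq> S \<Longrightarrow> smooth_on T f"
  unfolding smooth_on_def using Ck_on_subset by blast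

lemma smooth_on_has_derivative:
  assumes "smooth_on S f" "x \<in> S"
  shows "(f has_derivative frechet_derivative f (at x)) (at x)"
  using Ck_on_SucD[OF smooth_onD[OF assms(1)] assms(2)] .

lemma smooth_on_has_vector_derivative:
  fixes f :: "real \<Rightarrow> 'b::euclidean_space"
  assumes "smooth_on S f" "x \<in> S"
  shows "(f has_vector_derivative vector_derivative f (at x)) (at x)"
  using differentiableI[OF smooth_on_has_derivative[OF assms]] vector_derivative_works by blast

lemma smooth_on_frechet: "smooth_on S f \<Longrightarrow> smooth_on S (\<lambda>x. frechet_derivative f (at x) v)"
  unfolding smooth_on_def using Ck_on.simps(2) by blast

lemma smooth_on_cgrad:
  assumes "open S" "smooth_on S f"
  shows "smooth_on S (cgrad f)"
  unfolding smooth_on_def cgrad_def partial_def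
  by (intro allI Ck_on_vec assms(1)) (simp add: smooth_onD[OF smooth_on_frechet[OF assms(2)]])

lemma linear_eq_axis:
  fixes L :: "real^'n \<Rightarrow> 'b::real_vector"
  assumes "linear L"
  shows "L v = (\<Sum>l\<in>UNIV. v $ l *\<^sub>R L (axis l 1))"
proof -
  have "v = (\<Sum>l\<in>UNIV. v $ l *\<^sub>R axis l 1)"
    using basis_expansion[of v] by (simp add: scalar_mult_eq_scaleR)
  then have "L v = L (\<Sum>l\<in>UNIV. v $ l *\<^sub>R axis l 1)" by simp
  then show ?thesis using assms by (simp add: linear_sum linear_cmul)
qed

lemma frechet_eq_cgrad:
  assumes "f differentiable (at y)"
  shows "frechet_derivative f (at y) v = cgrad f y \<bullet> v"
  using linear_eq_axis[OF has_derivative_linear[OF assms[unfolded frechet_derivative_works]], of v]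
  by (simp add: cgrad_def partial_def inner_vec_def mult.commute)

lemma differentiable_nth:
  fixes u :: "'b::real_normed_vector \<Rightarrow> 'c::real_normed_vector^'n"
  assumes "u differentiable (at y)"
  shows "(\<lambda>x. u x $ a) differentiable (at y)"
  using assms bounded_linear.has_derivative[OF bounded_linear_vec_nth]
  unfolding differentiable_def by blast

lemma frechet_nth:
  fixes u :: "'b::real_normed_vector \<Rightarrow> 'c::real_normed_vector^'n"
  assumes "u differentiable (at y)"
  shows "frechet_derivative (\<lambda>x. u x $ a) (at y) v = frechet_derivative u (at y) v $ a"
proof -
  have "((\<lambda>x. u x $ a) has_derivative (\<lambda>v. frechet_derivative u (at y) v $ a)) (at y)"
    using bounded_linear.has_derivative[OF bounded_linear_vec_nth] assms frechet_derivative_works by blast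
  from frechet_derivative_at[OF this] show ?thesis by metis
qed

text \<open>The transition maps between flat coordinates that share all coordinates except the \<open>k\<close>th one
  are the maps below with \<open>\<epsilon> = \<plusminus>1\<close>.\<close>

definition flip :: "'n::finite \<Rightarrow> real \<Rightarrow> real \<Rightarrow> real^'n \<Rightarrow> real^'n" where
  "flip k \<epsilon> d x = (\<chi> a. if a = k then \<epsilon> * x $ k + d else x $ a)"

locale riem_chart =
  fixes M :: "('a, 'n::finite) riem" and c :: "('a, 'n) chart"
  assumes open_cran: "open (cran c)"
    and smooth_gmat: "smooth_on (cran c) (gmat M c)"
    and sym_gmat: "y \<in> cran c \<Longrightarrow> transpose (gmat M c y) = gmat M c y"
    and pos_gmat: "y \<in> cran c \<Longrightarrow> v \<noteq> 0 \<Longrightarrow> v \<bullet> (gmat M c y *v v) > 0"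
begin

abbreviation "G \<equiv> gmat M c"
abbreviation "H y \<equiv> matrix_inv (gmat M c y)"
abbreviation "DG y l \<equiv> frechet_derivative G (at y) (axis l 1)"

lemma invertible_G: "y \<in> cran c \<Longrightarrow> invertible (G y)"
proof -
  assume y: "y \<in> cran c"
  have "\<forall>x. G y *v x = 0 \<longrightarrow> x = 0" using pos_gmat[OF y] by fastforce
  then show ?thesis using matrix_left_invertible_ker invertible_left_inverse by metis
qed

lemma G_H: "y \<in> cran c \<Longrightarrow> G y *v (H y *v v) = v"
  and H_G: "y \<in> cran c \<Longrightarrow> H y *v (G y *v v) = v"
  using matrix_inv_works[OF invertible_G] by (simp_all add: matrix_vector_mul_assoc)

lemma sym_H: "y \<in> cran c \<Longrightarrow> transpose (H y) = H y"
proof -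
  assume y: "y \<in> cran c"
  have "transpose (H y) ** G y = mat 1"
    using arg_cong[OF matrix_inv_works(1)[OF invertible_G[OF y]], of transpose] sym_gmat[OF y]
    by (simp add: matrix_transpose_mul transpose_mat)
  then have "(transpose (H y) ** G y) ** H y = H y" by simp
  then show ?thesis
    using matrix_inv_works(1)[OF invertible_G[OF y]] by (simp add: matrix_mul_assoc[symmetric])
qed

lemma pos_H: "y \<in> cran c \<Longrightarrow> v \<noteq> 0 \<Longrightarrow> v \<bullet> (H y *v v) > 0"
proof -
  assume y: "y \<in> cran c" and v: "v \<noteq> 0"
  have "H y *v v \<noteq> 0" using G_H[OF y, of v] v by auto
  then have "(H y *v v) \<bullet> (G y *v (H y *v v)) > 0" using pos_gmat[OF y] by blast
  then show ?thesis using G_H[OF y] by (simp add: inner_commute)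
qed

lemma G_has_derivative: "y \<in> cran c \<Longrightarrow> (G has_derivative frechet_derivative G (at y)) (at y)"
  using smooth_on_has_derivative[OF smooth_gmat] .

lemma G_entry_sym: "y \<in> cran c \<Longrightarrow> G y $ i $ j = G y $ j $ i"
  using arg_cong[OF sym_gmat[of y], of "\<lambda>A. A $ j $ i"] by (simp add: transpose_def)

lemma partial_G: "y \<in> cran c \<Longrightarrow> partial l (\<lambda>x. G x $ i $ j) y = DG y l $ i $ j"
proof -
  assume y: "y \<in> cran c"
  have d: "G differentiable (at y)" using G_has_derivative[OF y] by (auto simp: differentiable_def)
  show ?thesis
    unfolding partial_def frechet_nth[OF differentiable_nth[OF d]] frechet_nth[OF d] ..
qed

lemma DG_sym: "y \<in> cran c \<Longrightarrow> DG y l $ i $ j = DG y l $ j $ i"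
proof -
  assume y: "y \<in> cran c"
  have "frechet_derivative (\<lambda>x. G x $ i $ j) (at y) = frechet_derivative (\<lambda>x. G x $ j $ i) (at y)"
    by (rule frechet_derivative_cong_open[OF open_cran y]) (rule G_entry_sym)
  then show ?thesis unfolding partial_G[OF y, symmetric] by (simp add: partial_def)
qed

lemma christoffel_DG:
  "y \<in> cran c \<Longrightarrow> christoffel M c y k l i =
    (1/2) * (\<Sum>m\<in>UNIV. H y $ k $ m * (DG y l $ i $ m + DG y i $ l $ m - DG y m $ l $ i))"
  unfolding christoffel_def by (simp add: partial_G)

lemma christoffel_sym: "y \<in> cran c \<Longrightarrow> christoffel M c y k l i = christoffel M c y k i l"
  by (simp add: christoffel_DG add.commute DG_sym[of y _ l i])

lemma christoffel_lower:
  assumes y: "y \<in> cran c"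
  shows "(\<Sum>k\<in>UNIV. christoffel M c y k l i * G y $ k $ j) =
    (1/2) * (DG y l $ i $ j + DG y i $ l $ j - DG y j $ l $ i)"
proof -
  let ?T = "\<chi> m. DG y l $ i $ m + DG y i $ l $ m - DG y m $ l $ i"
  have ch: "christoffel M c y k l i = (1/2) * (H y *v ?T) $ k" for k
    by (simp add: christoffel_DG[OF y] matrix_vector_mult_def)
  have "(\<Sum>k\<in>UNIV. christoffel M c y k l i * G y $ k $ j) =
      (1/2) * (G y *v (H y *v ?T)) $ j"
    unfolding ch matrix_vector_mult_def[of "G y"]
    by (simp add: sum_distrib_left G_entry_sym[OF y, of _ j] mult.commute)
  then show ?thesis by (simp add: G_H[OF y])
qed

text \<open>Compatibility of the connection with the metric: in the sum of two symbols of the first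
  kind, the terms not differentiated in direction \<open>l\<close> cancel in pairs.\<close>

lemma DG_conn:
  assumes y: "y \<in> cran c"
  shows "DG y l = conn M c y l ** G y + G y ** transpose (conn M c y l)"
proof -
  have "DG y l $ i $ j = (conn M c y l ** G y) $ i $ j + (G y ** transpose (conn M c y l)) $ i $ j" for i j
  proof -
    have 1: "(conn M c y l ** G y) $ i $ j = (1/2) * (DG y l $ i $ j + DG y i $ l $ j - DG y j $ l $ i)"
      using christoffel_lower[OF y, of l i j] by (simp add: matrix_matrix_mult_def conn_def)
    have 2: "(G y ** transpose (conn M c y l)) $ i $ j = (1/2) * (DG y l $ j $ i + DG y j $ l $ i - DG y i $ l $ j)"
      using christoffel_lower[OF y, of l j i]
      by (simp add: matrix_matrix_mult_def conn_def transpose_def G_entry_sym[OF y, of i] mult.commute)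
    show ?thesis unfolding 1 2 using DG_sym[OF y, of l i j] by (simp add: field_simps)
  qed
  then show ?thesis by (simp add: vec_eq_iff)
qed

lemma smooth_H: "smooth_on (cran c) H"
  unfolding smooth_on_def using Ck_on_matrix_inv[OF open_cran smooth_onD[OF smooth_gmat]] invertible_G by blast

lemma pairing_sym: "y \<in> cran c \<Longrightarrow> pairing M c \<alpha> \<beta> y = pairing M c \<beta> \<alpha> y"
  unfolding pairing_def using inner_matrix_symmetric[OF sym_H] by (metis inner_commute)

lemma Ck_on_pairing:
  assumes "open S" "S \<subseteq> cran c" "Ck_on k S \<alpha>" "Ck_on k S \<beta>"
  shows "Ck_on k S (pairing M c \<alpha> \<beta>)"
proof -
  have "Ck_on k S (\<lambda>y. H y *v \<beta> y)"
    using Ck_on_bilinear[OF bounded_bilinear_matrix_vector assms(1) Ck_on_subset[OF smooth_onD[OF smooth_H] assms(2)] assms(4)] .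
  then have "Ck_on k S (\<lambda>y. \<alpha> y \<bullet> (H y *v \<beta> y))" by (rule Ck_on_inner[OF assms(1,3)])
  then show ?thesis by (rule Ck_on_eqI[OF assms(1)]) (simp add: pairing_def)
qed

text \<open>The product rule for the metric on covectors. General covariant derivatives are kept,
  not only vanishing ones, because the unit conormal is later shown to be parallel by reading this
  identity backwards.\<close>

lemma pairing_has_derivative:
  assumes y: "y \<in> cran c" and \<alpha>: "(\<alpha> has_derivative \<alpha>') (at y)" and \<beta>: "(\<beta> has_derivative \<beta>') (at y)"
  obtains D where "(pairing M c \<alpha> \<beta> has_derivative D) (at y)"
    "\<And>l. D (axis l 1) = (\<alpha>' (axis l 1) - conn M c y l *v \<alpha> y) \<bullet> (H y *v \<beta> y)
       + (\<beta>' (axis l 1) - conn M c y l *v \<beta> y) \<bullet> (H y *v \<alpha> y)"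
proof -
  let ?H' = "frechet_derivative H (at y)"
  have H': "(H has_derivative ?H') (at y)" using smooth_on_has_derivative[OF smooth_H y] .
  define b where "b x = H x *v \<beta> x" for x
  define b' where "b' v = H y *v \<beta>' v + ?H' v *v \<beta> y" for v
  have b: "(b has_derivative b') (at y)"
    unfolding b_def b'_def using bounded_bilinear.FDERIV[OF bounded_bilinear_matrix_vector H' \<beta>] .
  \<comment> \<open>Instead of differentiating the inverse matrix, the identity
    \<open>G x *v b x = \<beta> x\<close> is differentiated and compared with the derivative of
    \<beta>.\<close>
  have "((\<lambda>x. G x *v b x) has_derivative (\<lambda>v. G y *v b' v + frechet_derivative G (at y) v *v b y)) (at y)"
    using bounded_bilinear.FDERIV[OF bounded_bilinear_matrix_vector G_has_derivative[OF y] b] .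
  moreover have "((\<lambda>x. G x *v b x) has_derivative \<beta>') (at y)"
    using has_derivative_cong_open[OF open_cran y, of "\<lambda>x. G x *v b x" \<beta> \<beta>'] \<beta> G_H by (simp add: b_def)
  ultimately have "(\<lambda>v. G y *v b' v + frechet_derivative G (at y) v *v b y) = \<beta>'"
    by (rule has_derivative_unique)
  then have Gb': "G y *v b' v = \<beta>' v - frechet_derivative G (at y) v *v b y" for v
    unfolding fun_eq_iff eq_diff_eq by blast
  have pd: "(pairing M c \<alpha> \<beta> has_derivative (\<lambda>v. \<alpha> y \<bullet> b' v + \<alpha>' v \<bullet> b y)) (at y)"
    using has_derivative_inner[OF \<alpha> b] by (simp add: pairing_def[abs_def] b_def)
  show ?thesis
  proof (rule that[OF pd])
    fix l
    let ?e = "axis l 1" and ?A = "conn M c y l"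
    let ?a = "H y *v \<alpha> y"
    have "\<alpha> y \<bullet> b' ?e = (G y *v ?a) \<bullet> b' ?e" by (simp add: G_H[OF y])
    also have "\<dots> = ?a \<bullet> (G y *v b' ?e)" using inner_matrix_symmetric[OF sym_gmat[OF y]] by metis
    also have "\<dots> = ?a \<bullet> \<beta>' ?e - ?a \<bullet> (?A *v (G y *v b y)) - ?a \<bullet> (G y *v (transpose ?A *v b y))"
      by (simp add: Gb' DG_conn[OF y] matrix_vector_mult_add_rdistrib matrix_vector_mul_assoc inner_diff_right inner_add_right
          del: transpose_matrix_vector)
    also have "?A *v (G y *v b y) = ?A *v \<beta> y" by (simp add: b_def G_H[OF y])
    also have "?a \<bullet> (G y *v (transpose ?A *v b y)) = \<alpha> y \<bullet> (transpose ?A *v b y)"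
      using inner_matrix_symmetric[OF sym_gmat[OF y], of ?a] by (simp add: G_H[OF y])
    also have "\<dots> = (?A *v \<alpha> y) \<bullet> b y"
      using dot_lmul_matrix[of "\<alpha> y" "transpose ?A" "b y"] transpose_matrix_vector[of "transpose ?A" "\<alpha> y"]
      by (simp add: transpose_transpose)
    finally show "\<alpha> y \<bullet> b' ?e + \<alpha>' ?e \<bullet> b y =
      (\<alpha>' ?e - ?A *v \<alpha> y) \<bullet> (H y *v \<beta> y) + (\<beta>' ?e - ?A *v \<beta> y) \<bullet> ?a"
      by (simp add: b_def inner_diff_left inner_diff_right inner_commute)
  qed
qed

lemma pairing_constant_on_ball:
  assumes B: "ball y0 r \<subseteq> cran c" and \<alpha>: "parallel_form M c (ball y0 r) \<alpha>" and \<beta>: "parallel_form M c (ball y0 r) \<beta>"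
    and "y \<in> ball y0 r" "z \<in> ball y0 r"
  shows "pairing M c \<alpha> \<beta> y = pairing M c \<alpha> \<beta> z"
proof (rule has_derivative_zero_unique[where s = "ball y0 r" and f = "pairing M c \<alpha> \<beta>"])
  fix x assume x: "x \<in> ball y0 r"
  have d: "(\<alpha> has_derivative frechet_derivative \<alpha> (at x)) (at x)" "(\<beta> has_derivative frechet_derivative \<beta> (at x)) (at x)"
    using \<alpha> \<beta> x smooth_on_has_derivative unfolding parallel_form_def by blast+
  have xc: "x \<in> cran c" using x B by blast
  have z: "frechet_derivative \<alpha> (at x) (axis l 1) - conn M c x l *v \<alpha> x = 0"
    "frechet_derivative \<beta> (at x) (axis l 1) - conn M c x l *v \<beta> x = 0" for l
    using \<alpha> \<beta> x unfolding parallel_form_def by auto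
  obtain D where D: "(pairing M c \<alpha> \<beta> has_derivative D) (at x)" "\<And>l. D (axis l 1) = 0"
    by (rule pairing_has_derivative[OF xc d]) (simp add: z)
  have "D = (\<lambda>h. 0)"
    using linear_eq_axis[OF has_derivative_linear[OF D(1)]] D(2) by auto
  then show "(pairing M c \<alpha> \<beta> has_derivative (\<lambda>h. 0)) (at x within ball y0 r)"
    using D(1) has_derivative_at_withinI by blast
qed (use assms in auto)

section \<open>Orthonormal coframes and flat coordinates in a chart\<close>

lemma parallel_form_iff:
  assumes "open S" "smooth_on S \<alpha>"
  shows "parallel_form M c S \<alpha> \<longleftrightarrow>
    (\<forall>y\<in>S. \<forall>l i. partial l (\<lambda>x. \<alpha> x $ i) y = (\<Sum>k\<in>UNIV. christoffel M c y k l i * \<alpha> y $ k))"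
proof -
  have "partial l (\<lambda>x. \<alpha> x $ i) y = frechet_derivative \<alpha> (at y) (axis l 1) $ i" if "y \<in> S" for y l i
  proof -
    have "\<alpha> differentiable (at y)" using smooth_on_has_derivative[OF assms(2) that] differentiable_def by blast
    then show ?thesis unfolding partial_def by (rule frechet_nth)
  qed
  then show ?thesis
    using assms(2) by (auto simp: parallel_form_def vec_eq_iff conn_def matrix_vector_mult_def)
qed

text \<open>Both sides say that the square matrices \<open>A\<close> and
  \<open>H y ** transpose A\<close> are inverse to each other, in the two possible orders. This
  converts a Gram matrix of vectors into orthonormality of the rows of \<open>A\<close> as
  covectors.\<close>

lemma gram_inverse:
  fixes A :: "real^'n^'n"
  assumes y: "y \<in> cran c"
  shows "transpose A ** A = G y \<longleftrightarrow> A ** (H y ** transpose A) = mat 1"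
proof
  assume "transpose A ** A = G y"
  then have "(H y ** transpose A) ** A = mat 1"
    using matrix_inv_works(2)[OF invertible_G[OF y]] by (simp add: matrix_mul_assoc[symmetric])
  then show "A ** (H y ** transpose A) = mat 1" using matrix_left_right_inverse by blast
next
  assume "A ** (H y ** transpose A) = mat 1"
  then have "(H y ** transpose A) ** A = mat 1" using matrix_left_right_inverse by blast
  then have "G y ** ((H y ** transpose A) ** A) = G y" by simp
  then show "transpose A ** A = G y"
    using matrix_inv_works(1)[OF invertible_G[OF y]] by (simp add: matrix_mul_assoc)
qed

lemma gram_entry: "(A ** (H y ** transpose A)) $ a $ b = (A $ a) \<bullet> (H y *v (A $ b))"
  by (simp add: matrix_matrix_mult_def matrix_vector_mult_def inner_vec_def transpose_def)

text \<open>By \<open>gram_inverse\<close>, \<open>transpose A ** A\<close> lowers the index that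
  \<open>H y\<close> raises; the result is the expansion of a covector in an orthonormal
  coframe.\<close>

lemma gram_expand:
  fixes A :: "real^'n^'n"
  assumes y: "y \<in> cran c" and A: "A ** (H y ** transpose A) = mat 1"
  shows "v = (\<Sum>a\<in>UNIV. ((A $ a) \<bullet> (H y *v v)) *\<^sub>R (A $ a))"
proof -
  have "v = transpose A *v (A *v (H y *v v))"
    unfolding matrix_vector_mul_assoc[of "transpose A" A] gram_inverse[OF y, of A, THEN iffD2, OF A] G_H[OF y] ..
  also have "\<dots> = (\<Sum>a\<in>UNIV. ((A $ a) \<bullet> (H y *v v)) *\<^sub>R (A $ a))"
  proof -
    have "(transpose A *v z) $ i = (\<Sum>a\<in>UNIV. z $ a * A $ a $ i)" for z i
      by (simp add: matrix_vector_mult_def transpose_def mult.commute del: transpose_matrix_vector)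
    then show ?thesis
      by (simp add: vec_eq_iff matrix_vector_mul_component sum_component del: transpose_matrix_vector)
  qed
  finally show ?thesis .
qed

text \<open>\<open>gram_inverse\<close> turns the isometry condition on vectors into orthonormality
  of the coordinate differentials, the form in which flat coordinates are built and
  compared.\<close>

lemma flat_coords_pairing:
  assumes "S \<subseteq> cran c" and u: "smooth_on S u"
  shows "flat_coords M c S u \<longleftrightarrow>
    (\<forall>y\<in>S. \<forall>a b. pairing M c (cgrad (\<lambda>x. u x $ a)) (cgrad (\<lambda>x. u x $ b)) y = (if a = b then 1 else 0))"
proof -
  have "(\<forall>i j. G y $ i $ j = frechet_derivative u (at y) (axis i 1) \<bullet> frechet_derivative u (at y) (axis j 1))
    \<longleftrightarrow> (\<forall>a b. pairing M c (cgrad (\<lambda>x. u x $ a)) (cgrad (\<lambda>x. u x $ b)) y = (if a = b then 1 else 0))"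
    if yS: "y \<in> S" for y
  proof -
    have y: "y \<in> cran c" using yS assms(1) by blast
    have d: "u differentiable (at y)" using smooth_on_has_derivative[OF u yS] differentiable_def by blast
    define A where "A = (\<chi> a. cgrad (\<lambda>x. u x $ a) y)"
    have A: "A $ a $ i = frechet_derivative u (at y) (axis i 1) $ a" for a i
      by (simp add: A_def cgrad_def partial_def frechet_nth[OF d])
    have "(\<forall>i j. G y $ i $ j = frechet_derivative u (at y) (axis i 1) \<bullet> frechet_derivative u (at y) (axis j 1))
        \<longleftrightarrow> transpose A ** A = G y"
      by (auto simp: vec_eq_iff matrix_matrix_mult_def transpose_def inner_vec_def A)
    also have "\<dots> \<longleftrightarrow> (\<forall>a b. pairing M c (cgrad (\<lambda>x. u x $ a)) (cgrad (\<lambda>x. u x $ b)) y = (if a = b then 1 else 0))"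
      unfolding gram_inverse[OF y] by (auto simp: vec_eq_iff gram_entry pairing_def A_def mat_def)
    finally show ?thesis .
  qed
  then show ?thesis using u unfolding flat_coords_def by blast
qed

text \<open>The metric consists of inner products of the first derivatives \<open>J i\<close>, so
  its derivatives are products of \<open>J\<close> with second derivatives. As these are symmetric,
  the combination in the Christoffel symbols collapses to a single product with
  \<open>T l i\<close>; the \<open>J j\<close> span, so the second derivatives of \<open>u\<close>
  are the Christoffel combination of the first ones.\<close>

lemma flat_coords_parallel:
  assumes S: "open S" "S \<subseteq> cran c" and flat: "flat_coords M c S u"
  shows "parallel_form M c S (cgrad (\<lambda>x. u x $ a))"
proof -
  have u: "smooth_on S u" using flat by (simp add: flat_coords_def)
  define J where "J i y = frechet_derivative u (at y) (axis i 1)" for i y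
  define T where "T l i y = frechet_derivative (J i) (at y) (axis l 1)" for l i y
  have J: "smooth_on S (J i)" for i unfolding J_def using smooth_on_frechet[OF u] .
  have du: "u differentiable (at y)" if "y \<in> S" for y
    using smooth_on_has_derivative[OF u that] differentiable_def by blast
  have dJ: "J i differentiable (at y)" if "y \<in> S" for y i
    using smooth_on_has_derivative[OF J that] differentiable_def by blast
  have J_nth: "frechet_derivative (\<lambda>x. u x $ a) (at y) (axis i 1) = J i y $ a" if "y \<in> S" for y i a
    unfolding J_def using frechet_nth[OF du[OF that]] .
  have T_nth: "frechet_derivative (\<lambda>x. frechet_derivative (\<lambda>x. u x $ a) (at x) (axis i 1)) (at y) (axis l 1)
      = T l i y $ a" if "y \<in> S" for y i l a
    unfolding T_def frechet_nth[OF dJ[OF that], symmetric]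
    using frechet_derivative_cong_open[OF S(1) that J_nth] by simp
  have T_sym: "T l i y = T i l y" if "y \<in> S" for l i y
  proof -
    have "Ck_on (Suc (Suc 0)) S (\<lambda>x. u x $ a)" for a
      by (rule Ck_on_nth[OF S(1) smooth_onD[OF u]])
    from second_derivative_symmetric[OF S(1) this that] show ?thesis
      unfolding vec_eq_iff T_nth[OF that, symmetric] by blast
  qed
  have DG_T: "DG y l $ i $ j = T l i y \<bullet> J j y + J i y \<bullet> T l j y" if y: "y \<in> S" for y l i j
  proof -
    have "DG y l $ i $ j = frechet_derivative (\<lambda>x. G x $ i $ j) (at y) (axis l 1)"
      using partial_G[of y l i j] y S(2) by (auto simp: partial_def)
    also have "frechet_derivative (\<lambda>x. G x $ i $ j) (at y) = frechet_derivative (\<lambda>x. J i x \<bullet> J j x) (at y)"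
      by (rule frechet_derivative_cong_open[OF S(1) y]) (use flat in \<open>simp add: flat_coords_def J_def\<close>)
    also have "\<dots> = (\<lambda>v. J i y \<bullet> frechet_derivative (J j) (at y) v + frechet_derivative (J i) (at y) v \<bullet> J j y)"
      using frechet_derivative_at[OF has_derivative_inner[OF smooth_on_has_derivative[OF J[of i] y]
            smooth_on_has_derivative[OF J[of j] y]]] by simp
    finally show ?thesis by (simp add: T_def)
  qed
  have T_conn: "(\<Sum>k\<in>UNIV. christoffel M c y k l i *\<^sub>R J k y) = T l i y" if y: "y \<in> S" for y l i
  proof -
    have yc: "y \<in> cran c" using y S(2) by blast
    define d where "d = (\<Sum>k\<in>UNIV. christoffel M c y k l i *\<^sub>R J k y) - T l i y"
    define A where "A = (\<chi> j. J j y)"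
    have GJ: "G y $ i $ j = J i y \<bullet> J j y" for i j
      using flat y by (simp add: flat_coords_def J_def)
    \<comment> \<open>Invertibility of the Jacobian comes from that of the metric matrix, so that
      orthogonality to all \<open>J j y\<close> forces \<open>d\<close> to vanish.\<close>
    have "G y = A ** transpose A"
      by (simp add: vec_eq_iff matrix_matrix_mult_def transpose_def A_def GJ inner_vec_def)
    then have "det A \<noteq> 0" using invertible_G[OF yc] by (auto simp: invertible_det_nz det_mul)
    then have A: "invertible A" by (simp add: invertible_det_nz)
    have "J j y \<bullet> d = 0" for j
    proof -
      have "J j y \<bullet> (\<Sum>k\<in>UNIV. christoffel M c y k l i *\<^sub>R J k y) =
          (\<Sum>k\<in>UNIV. christoffel M c y k l i * G y $ k $ j)"
        by (simp add: inner_sum_right GJ inner_commute)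
      also have "\<dots> = (1/2) * (DG y l $ i $ j + DG y i $ l $ j - DG y j $ l $ i)"
        by (rule christoffel_lower[OF yc])
      also have "\<dots> = J j y \<bullet> T l i y"
        unfolding DG_T[OF y] T_sym[OF y, of i l] T_sym[OF y, of j l] T_sym[OF y, of j i]
        by (simp add: inner_commute)
      finally show ?thesis by (simp add: d_def inner_diff_right)
    qed
    then have "A *v d = 0" by (simp add: vec_eq_iff matrix_vector_mul_component A_def)
    then have "matrix_inv A *v (A *v d) = 0" by simp
    then have "d = 0" using matrix_inv_works(2)[OF A] by (simp add: matrix_vector_mul_assoc)
    then show ?thesis by (simp add: d_def)
  qed
  have sm: "smooth_on S (\<lambda>x. u x $ a)"
    unfolding smooth_on_def using Ck_on_nth[OF S(1) smooth_onD[OF u]] by blast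
  show ?thesis
    unfolding parallel_form_iff[OF S(1) smooth_on_cgrad[OF S(1) sm]]
  proof (intro ballI allI)
    fix y l i assume y: "y \<in> S"
    have "partial l (\<lambda>x. cgrad (\<lambda>x. u x $ a) x $ i) y = T l i y $ a"
      using T_nth[OF y] by (simp add: cgrad_def partial_def)
    also have "\<dots> = (\<Sum>k\<in>UNIV. christoffel M c y k l i * J k y $ a)"
      by (simp add: T_conn[OF y, symmetric])
    finally show "partial l (\<lambda>x. cgrad (\<lambda>x. u x $ a) x $ i) y =
        (\<Sum>k\<in>UNIV. christoffel M c y k l i * cgrad (\<lambda>x. u x $ a) y $ k)"
      using J_nth[OF y] by (simp add: cgrad_def partial_def)
  qed
qed

text \<open>Parallel forms have constant inner products, so the coefficients of
  \<open>cgrad f\<close> in the coframe of \<open>u\<close> are constants \<open>b\<close>, and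
  \<open>f\<close> minus \<open>b \<bullet> u\<close> has zero derivative on the ball. The formula
  for \<open>cgrad f\<close> is exported because transition maps are determined from it.\<close>

lemma parallel_affine_in_flat_coords:
  assumes B: "ball y0 r \<subseteq> cran c" and flat: "flat_coords M c (ball y0 r) u"
    and f: "smooth_on (ball y0 r) f" "parallel_form M c (ball y0 r) (cgrad f)"
  obtains a b where "\<And>y. y \<in> ball y0 r \<Longrightarrow> f y = a + b \<bullet> u y"
    "\<And>y. y \<in> ball y0 r \<Longrightarrow> cgrad f y = (\<Sum>i\<in>UNIV. b $ i *\<^sub>R cgrad (\<lambda>x. u x $ i) y)"
proof -
  have u: "smooth_on (ball y0 r) u" using flat by (simp add: flat_coords_def)
  define b :: "real^'n" where "b = (\<chi> a. pairing M c (cgrad (\<lambda>x. u x $ a)) (cgrad f) y0)"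
  have b: "pairing M c (cgrad (\<lambda>x. u x $ a)) (cgrad f) y = b $ a" if y: "y \<in> ball y0 r" for y a
  proof -
    have "y0 \<in> ball y0 r" using y by (auto intro: le_less_trans[OF zero_le_dist])
    then show ?thesis
      using pairing_constant_on_ball[OF B flat_coords_parallel[OF open_ball B flat] f(2) y] by (simp add: b_def)
  qed
  have cf: "cgrad f y = (\<Sum>a\<in>UNIV. b $ a *\<^sub>R cgrad (\<lambda>x. u x $ a) y)" if y: "y \<in> ball y0 r" for y
  proof -
    have yc: "y \<in> cran c" using y B by blast
    let ?A = "\<chi> a. cgrad (\<lambda>x. u x $ a) y"
    have "?A ** (H y ** transpose ?A) = mat 1"
      using flat_coords_pairing[OF B u] flat y by (simp add: vec_eq_iff gram_entry pairing_def mat_def)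
    from gram_expand[OF yc this, of "cgrad f y"] show ?thesis
      using b[OF y] by (simp add: pairing_def)
  qed
  have der: "((\<lambda>x. f x - b \<bullet> u x) has_derivative (\<lambda>v. 0)) (at y)" if y: "y \<in> ball y0 r" for y
  proof -
    have du: "(u has_derivative frechet_derivative u (at y)) (at y)"
      using smooth_on_has_derivative[OF u y] .
    have df: "(f has_derivative frechet_derivative f (at y)) (at y)"
      using smooth_on_has_derivative[OF f(1) y] .
    have "frechet_derivative f (at y) v = b \<bullet> frechet_derivative u (at y) v" for v
    proof -
      have "frechet_derivative f (at y) v = (\<Sum>a\<in>UNIV. b $ a * (cgrad (\<lambda>x. u x $ a) y \<bullet> v))"
        using frechet_eq_cgrad[of f y v] df by (simp add: cf[OF y] inner_sum_left differentiable_def) blast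
      also have "\<dots> = (\<Sum>a\<in>UNIV. b $ a * frechet_derivative u (at y) v $ a)"
        using frechet_eq_cgrad[OF differentiable_nth[of u y], of _ v] frechet_nth[of u y _ v] du
        by (metis (no_types, lifting) differentiableI)
      finally show ?thesis by (simp add: inner_vec_def)
    qed
    then show ?thesis
      using has_derivative_diff[OF df has_derivative_inner_right[OF du, of b]] by simp
  qed
  have "f y = (f y0 - b \<bullet> u y0) + b \<bullet> u y" if y: "y \<in> ball y0 r" for y
  proof -
    have "y0 \<in> ball y0 r" using y by (auto intro: le_less_trans[OF zero_le_dist])
    then have "f y - b \<bullet> u y = f y0 - b \<bullet> u y0"
      using has_derivative_zero_unique[of "ball y0 r" "\<lambda>x. f x - b \<bullet> u x" y y0] der y
      by (simp add: has_derivative_at_withinI)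
    then show ?thesis by simp
  qed
  then show ?thesis using that cf by blast
qed

text \<open>The unit conormal \<alpha> of the given differentials is parallel because its covariant
  derivative is orthogonal to the whole coframe: to \<alpha> since \<alpha> has constant length, and
  to the others since they are parallel and their product with \<alpha> is constantly 0. For a
  parallel form, closedness is the symmetry of the Christoffel symbols in the lower indices. A
  primitive of \<alpha> serves as coordinate \<open>k\<close>.\<close>

lemma flat_coords_exist:
  fixes w :: "'n \<Rightarrow> real^'n \<Rightarrow> real"
  assumes S: "open S" "S \<subseteq> cran c" "y0 \<in> S"
    and w: "\<And>a. a \<noteq> k \<Longrightarrow> smooth_on S (w a)" "\<And>a. a \<noteq> k \<Longrightarrow> parallel_form M c S (cgrad (w a))"
    and on: "\<And>a b y. a \<noteq> k \<Longrightarrow> b \<noteq> k \<Longrightarrow> y \<in> S \<Longrightarrow>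
      pairing M c (cgrad (w a)) (cgrad (w b)) y = (if a = b then 1 else 0)"
  obtains r u where "r > 0" "ball y0 r \<subseteq> S" "flat_coords M c (ball y0 r) u"
    "\<And>a y. a \<noteq> k \<Longrightarrow> u y $ a = w a y"
proof -
  let ?I = "UNIV - {k}"
  let ?\<alpha> = "\<lambda>a. cgrad (w a)"
  have sm: "smooth_on S (?\<alpha> a)" if "a \<noteq> k" for a using smooth_on_cgrad[OF S(1) w(1)[OF that]] .
  have "span ((\<lambda>a. ?\<alpha> a y0) ` ?I) \<noteq> UNIV"
  proof
    assume sp: "span ((\<lambda>a. ?\<alpha> a y0) ` ?I) = UNIV"
    have "dim (UNIV :: (real^'n) set) \<le> card ((\<lambda>a. ?\<alpha> a y0) ` ?I)"
      by (rule dim_le_card) (use sp in auto)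
    also have "\<dots> \<le> card ?I" by (rule card_image_le) simp
    also have "\<dots> < CARD('n)" by (rule psubset_card_mono) auto
    finally show False by simp
  qed
  then obtain e where e: "e \<notin> span ((\<lambda>a. ?\<alpha> a y0) ` ?I)" by blast
  \<comment> \<open>A Gram-Schmidt step on the constant covector \<open>e\<close>, which is known to
    lie outside the span only at \<open>y0\<close>. Nonvanishing of \<beta> is an open condition,
    hence the passage to a ball.\<close>
  define \<beta> where "\<beta> y = e - (\<Sum>a\<in>?I. pairing M c (\<lambda>_. e) (?\<alpha> a) y *\<^sub>R ?\<alpha> a y)" for y
  have sm\<beta>: "Ck_on m S \<beta>" for m
    unfolding \<beta>_def
    by (intro Ck_on_minus Ck_on_sum Ck_on_scaleR Ck_on_pairing Ck_on_const S) (use sm smooth_onD in auto)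
  have "\<beta> y0 \<noteq> 0"
  proof
    assume "\<beta> y0 = 0"
    then have "e = (\<Sum>a\<in>?I. pairing M c (\<lambda>_. e) (?\<alpha> a) y0 *\<^sub>R ?\<alpha> a y0)" by (simp add: \<beta>_def)
    also have "\<dots> \<in> span ((\<lambda>a. ?\<alpha> a y0) ` ?I)"
      by (intro span_sum span_scale span_base) auto
    finally show False using e by blast
  qed
  moreover have "open (S \<inter> \<beta> -` (- {0}))"
    using continuous_open_preimage[OF _ S(1), of \<beta> "- {0}"] sm\<beta>[of 0] by auto
  ultimately obtain r where r: "r > 0" "ball y0 r \<subseteq> S \<inter> \<beta> -` (- {0})"
    using S(3) openE[of "S \<inter> \<beta> -` (- {0})" y0] by auto
  let ?B = "ball y0 r"
  have BS: "?B \<subseteq> S" and Bc: "?B \<subseteq> cran c" and \<beta>0: "\<And>y. y \<in> ?B \<Longrightarrow> \<beta> y \<noteq> 0"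
    using r S by auto
  have \<beta>\<alpha>: "pairing M c \<beta> (?\<alpha> b) y = 0" if y: "y \<in> ?B" and b: "b \<noteq> k" for y b
  proof -
    have "pairing M c \<beta> (?\<alpha> b) y = pairing M c (\<lambda>_. e) (?\<alpha> b) y
        - (\<Sum>a\<in>?I. pairing M c (\<lambda>_. e) (?\<alpha> a) y * pairing M c (?\<alpha> a) (?\<alpha> b) y)"
      by (simp add: pairing_def \<beta>_def inner_diff_left inner_sum_left)
    also have "(\<Sum>a\<in>?I. pairing M c (\<lambda>_. e) (?\<alpha> a) y * pairing M c (?\<alpha> a) (?\<alpha> b) y)
        = (\<Sum>a\<in>?I. if a = b then pairing M c (\<lambda>_. e) (?\<alpha> a) y else 0)"
      by (rule sum.cong) (use on[OF _ b] y BS in auto)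
    finally show ?thesis using b by simp
  qed
  define N where "N y = pairing M c \<beta> \<beta> y" for y
  have N: "N y > 0" if "y \<in> ?B" for y
    unfolding N_def pairing_def using pos_H[of y "\<beta> y"] \<beta>0[OF that] that Bc by blast
  define \<alpha> where "\<alpha> y = (N y powr (-1/2)) *\<^sub>R \<beta> y" for y
  have smB\<beta>: "Ck_on m ?B \<beta>" for m using Ck_on_subset[OF sm\<beta> BS] .
  have smN: "Ck_on m ?B N" for m
    unfolding N_def[abs_def] by (intro Ck_on_pairing open_ball Bc smB\<beta>)
  have sm\<alpha>: "smooth_on ?B \<alpha>"
    unfolding smooth_on_def \<alpha>_def[abs_def] by (intro allI Ck_on_scaleR Ck_on_powr_compose open_ball smN smB\<beta> N)
  have \<alpha>\<alpha>: "pairing M c \<alpha> \<alpha> y = 1" if "y \<in> ?B" for y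
  proof -
    have "pairing M c \<alpha> \<alpha> y = (N y powr (-1/2) * N y powr (-1/2)) * N y"
      by (simp add: \<alpha>_def N_def pairing_def matrix_vector_mult_scaleR)
    also have "N y powr (-1/2) * N y powr (-1/2) = N y powr (-1)"
      by (simp add: powr_add[symmetric])
    finally show ?thesis using N[OF that] by (simp add: powr_minus)
  qed
  have \<alpha>w: "pairing M c \<alpha> (?\<alpha> b) y = 0" if "y \<in> ?B" "b \<noteq> k" for y b
    using \<beta>\<alpha>[OF that] by (simp add: \<alpha>_def pairing_def)
  define A where "A y = (\<chi> a. if a = k then \<alpha> y else ?\<alpha> a y)" for y
  have A: "A y ** (H y ** transpose (A y)) = mat 1" if y: "y \<in> ?B" for y
  proof -
    have yc: "y \<in> cran c" using y Bc by blast
    have "pairing M c (?\<alpha> b) \<alpha> y = 0" if "b \<noteq> k" for b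
      using \<alpha>w[OF y that] pairing_sym[OF yc] by metis
    then show ?thesis
      using \<alpha>\<alpha>[OF y] \<alpha>w[OF y] on y BS
      by (auto simp: vec_eq_iff gram_entry A_def mat_def pairing_def subset_iff)
  qed
  have par: "parallel_form M c ?B \<alpha>"
    unfolding parallel_form_def
  proof (intro conjI sm\<alpha> ballI allI)
    fix y l assume y: "y \<in> ?B"
    have yc: "y \<in> cran c" using y Bc by blast
    let ?\<nu> = "frechet_derivative \<alpha> (at y) (axis l 1) - conn M c y l *v \<alpha> y"
    have d\<alpha>: "(\<alpha> has_derivative frechet_derivative \<alpha> (at y)) (at y)"
      using smooth_on_has_derivative[OF sm\<alpha> y] .
    have "\<alpha> y \<bullet> (H y *v ?\<nu>) = 0"
    proof -
      obtain D where D: "(pairing M c \<alpha> \<alpha> has_derivative D) (at y)"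
        "D (axis l 1) = ?\<nu> \<bullet> (H y *v \<alpha> y) + ?\<nu> \<bullet> (H y *v \<alpha> y)"
        by (rule pairing_has_derivative[OF yc d\<alpha> d\<alpha>]) blast
      have "((\<lambda>_. 1) has_derivative D) (at y)"
        using D(1) has_derivative_cong_open[OF open_ball y, of "pairing M c \<alpha> \<alpha>" "\<lambda>_. 1"] \<alpha>\<alpha> by simp
      then have "D = (\<lambda>_. 0)" using has_derivative_unique has_derivative_const by blast
      then have "?\<nu> \<bullet> (H y *v \<alpha> y) = 0" using D(2) by simp
      then show ?thesis using inner_matrix_symmetric[OF sym_H[OF yc]] by (metis inner_commute)
    qed
    moreover have "?\<alpha> a y \<bullet> (H y *v ?\<nu>) = 0" if a: "a \<noteq> k" for a
    proof -
      have d: "(?\<alpha> a has_derivative frechet_derivative (?\<alpha> a) (at y)) (at y)"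
        using smooth_on_has_derivative[OF sm[OF a]] y BS by blast
      have z: "frechet_derivative (?\<alpha> a) (at y) (axis l 1) - conn M c y l *v ?\<alpha> a y = 0"
        using w(2)[OF a] y BS by (auto simp: parallel_form_def)
      obtain D where D: "(pairing M c \<alpha> (?\<alpha> a) has_derivative D) (at y)"
        "D (axis l 1) = ?\<nu> \<bullet> (H y *v ?\<alpha> a y)"
        by (rule pairing_has_derivative[OF yc d\<alpha> d]) (use z in \<open>simp add: parallel_form_def\<close>)
      have "((\<lambda>_. 0) has_derivative D) (at y)"
        using D(1) has_derivative_cong_open[OF open_ball y, of "pairing M c \<alpha> (?\<alpha> a)" "\<lambda>_. 0"] \<alpha>w[OF _ a] by simp
      then have "D = (\<lambda>_. 0)" using has_derivative_unique has_derivative_const by blast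
      then have "?\<nu> \<bullet> (H y *v ?\<alpha> a y) = 0" using D(2) by simp
      then show ?thesis using inner_matrix_symmetric[OF sym_H[OF yc]] by (metis inner_commute)
    qed
    ultimately have "(A y $ a) \<bullet> (H y *v ?\<nu>) = 0" for a by (simp add: A_def)
    then have "?\<nu> = 0" using gram_expand[OF yc A[OF y], of ?\<nu>] by simp
    then show "frechet_derivative \<alpha> (at y) (axis l 1) = conn M c y l *v \<alpha> y" by simp
  qed
  have closed: "frechet_derivative \<alpha> (at y) v \<bullet> v' = frechet_derivative \<alpha> (at y) v' \<bullet> v" if y: "y \<in> ?B" for y v v'
  proof -
    have yc: "y \<in> cran c" using y Bc by blast
    have lin: "linear (frechet_derivative \<alpha> (at y))"
      using smooth_on_has_derivative[OF sm\<alpha> y] has_derivative_linear by blast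
    have ax: "frechet_derivative \<alpha> (at y) (axis l 1) $ i = frechet_derivative \<alpha> (at y) (axis i 1) $ l" for l i
      using par y christoffel_sym[OF yc, of _ l i]
      by (simp add: parallel_form_def conn_def matrix_vector_mult_def)
    have "frechet_derivative \<alpha> (at y) v \<bullet> v' =
        (\<Sum>i\<in>UNIV. \<Sum>l\<in>UNIV. v $ l * v' $ i * frechet_derivative \<alpha> (at y) (axis l 1) $ i)" for v v'
      by (subst linear_eq_axis[OF lin, of v])
        (simp add: inner_vec_def sum_component sum_distrib_left sum_distrib_right mult_ac)
    note ex = this
    show ?thesis
      unfolding ex[of v v'] ex[of v' v]
      by (subst sum.swap, intro sum.cong refl) (simp add: ax mult_ac)
  qed
  obtain s where s: "\<And>y. y \<in> ?B \<Longrightarrow> (s has_derivative (\<lambda>v. \<alpha> y \<bullet> v)) (at y)"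
    using closed_form_exact_on_ball[OF smooth_onD[OF sm\<alpha>] closed] by blast
  have sm_s: "Ck_on m ?B s" for m
    by (rule Ck_on_Suc_imp, rule Ck_on_SucI[OF open_ball s])
      (auto intro!: Ck_on_inner Ck_on_const smooth_onD[OF sm\<alpha>])
  define u where "u y = (\<chi> a. if a = k then s y else w a y)" for y
  have u: "smooth_on ?B u"
    unfolding smooth_on_def
  proof (intro allI Ck_on_vec open_ball)
    fix m i
    show "Ck_on m ?B (\<lambda>y. u y $ i)"
      using sm_s Ck_on_subset[OF smooth_onD[OF w(1)] BS] by (cases "i = k") (simp_all add: u_def)
  qed
  have cgrad_u: "cgrad (\<lambda>y. u y $ a) y = A y $ a" if y: "y \<in> ?B" for a y
  proof (cases "a = k")
    case True
    have "frechet_derivative s (at y) = (\<lambda>v. \<alpha> y \<bullet> v)" using frechet_derivative_at[OF s[OF y]] by simp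
    then have "cgrad s y = \<alpha> y"
      by (simp add: cgrad_def partial_def vec_eq_iff inner_axis)
    then show ?thesis using True by (simp add: u_def A_def)
  qed (simp add: u_def A_def)
  have "flat_coords M c ?B u"
    unfolding flat_coords_pairing[OF Bc u]
    using A by (simp add: pairing_def cgrad_u gram_entry[symmetric] mat_def)
  then show ?thesis using that[of r u] r(1) BS by (simp add: u_def)
qed

lemma flat_coords_inner:
  assumes "flat_coords M c S u" "y \<in> S"
  shows "v \<bullet> (G y *v v') = frechet_derivative u (at y) v \<bullet> frechet_derivative u (at y) v'"
proof -
  have lin: "linear (frechet_derivative u (at y))"
    using assms smooth_on_has_derivative has_derivative_linear unfolding flat_coords_def by blast
  have G: "G y $ i $ j = frechet_derivative u (at y) (axis i 1) \<bullet> frechet_derivative u (at y) (axis j 1)" for i j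
    using assms by (simp add: flat_coords_def)
  show ?thesis
    by (subst linear_eq_axis[OF lin, of v], subst linear_eq_axis[OF lin, of v'],
      simp add: inner_vec_def[of v] matrix_vector_mult_def G inner_sum_left inner_sum_right
        sum_distrib_left mult_ac, rule sum.swap)
qed

lemma flat_coords_inj:
  assumes "flat_coords M c S u" "y \<in> S" "S \<subseteq> cran c"
  shows "inj (frechet_derivative u (at y))"
proof -
  have lin: "linear (frechet_derivative u (at y))"
    using assms smooth_on_has_derivative has_derivative_linear unfolding flat_coords_def by blast
  have "v = 0" if "frechet_derivative u (at y) v = 0" for v
    using flat_coords_inner[OF assms(1,2), of v v] pos_gmat[of y v] that assms by force
  then show ?thesis using linear_injective_0[OF lin] by blast
qed

text \<open>The differential of coordinate \<open>k\<close> is multiplied by \<epsilon> and the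
  others are unchanged; the products survive because
  \<open>\<epsilon> * \<epsilon> = 1\<close>.\<close>

lemma flat_coords_flip:
  assumes S: "open S" "S \<subseteq> cran c" and u: "flat_coords M c S u" and \<epsilon>: "\<epsilon> = 1 \<or> \<epsilon> = -1"
  shows "flat_coords M c S (\<lambda>y. flip k \<epsilon> d (u y))"
proof -
  have smu: "smooth_on S u" using u by (simp add: flat_coords_def)
  have sm: "smooth_on S (\<lambda>y. flip k \<epsilon> d (u y))"
    unfolding smooth_on_def
  proof (intro allI Ck_on_vec S)
    fix m i
    have "Ck_on m S (\<lambda>y. \<epsilon> * u y $ k + d)" "Ck_on m S (\<lambda>y. u y $ i)"
      by (intro Ck_on_add Ck_on_mult Ck_on_const Ck_on_nth smooth_onD[OF smu] S)+
    then show "Ck_on m S (\<lambda>y. flip k \<epsilon> d (u y) $ i)"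
      by (cases "i = k") (simp_all add: flip_def)
  qed
  have cg: "cgrad (\<lambda>y. flip k \<epsilon> d (u y) $ a) y = (if a = k then \<epsilon> else 1) *\<^sub>R cgrad (\<lambda>y. u y $ a) y"
    if y: "y \<in> S" for y a
  proof -
    have "((\<lambda>y. u y $ k) has_derivative frechet_derivative (\<lambda>y. u y $ k) (at y)) (at y)"
      using Ck_on_SucD[OF Ck_on_nth[OF S(1) smooth_onD[OF smu]] y] .
    then have "((\<lambda>y. \<epsilon> * u y $ k + d) has_derivative (\<lambda>v. \<epsilon> * frechet_derivative (\<lambda>y. u y $ k) (at y) v)) (at y)"
      by (auto intro!: derivative_eq_intros)
    from frechet_derivative_at[OF this]
    have "frechet_derivative (\<lambda>y. \<epsilon> * u y $ k + d) (at y) = (\<lambda>v. \<epsilon> * frechet_derivative (\<lambda>y. u y $ k) (at y) v)" ..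
    then show ?thesis
      by (cases "a = k") (simp_all add: flip_def cgrad_def partial_def vec_eq_iff)
  qed
  show ?thesis
    using u \<epsilon> unfolding flat_coords_pairing[OF S(2) sm] flat_coords_pairing[OF S(2) smu]
    by (auto simp: pairing_def cg matrix_vector_mult_scaleR)
qed

text \<open>The new coordinate \<open>k\<close> is affine in the old ones with coefficient vector
  \<open>b\<close>. Orthogonality to the shared differentials kills \<open>b $ j\<close> for
  \<open>j \<noteq> k\<close>, and unit length gives \<open>b $ k * b $ k = 1\<close>. Evaluation at
  the centre is enough because the coefficients are constant.\<close>

lemma flat_coords_transition:
  assumes B: "ball y0 r \<subseteq> cran c" "r > 0" and u: "flat_coords M c (ball y0 r) u" and u': "flat_coords M c (ball y0 r) u'"
    and eq: "\<And>a y. a \<noteq> k \<Longrightarrow> y \<in> ball y0 r \<Longrightarrow> u y $ a = u' y $ a"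
  obtains \<epsilon> d where "\<epsilon> = 1 \<or> \<epsilon> = -1" "\<And>y. y \<in> ball y0 r \<Longrightarrow> u' y = flip k \<epsilon> d (u y)"
proof -
  let ?B = "ball y0 r"
  have sm: "smooth_on ?B u" "smooth_on ?B u'" using u u' by (auto simp: flat_coords_def)
  have "smooth_on ?B (\<lambda>x. u' x $ k)"
    unfolding smooth_on_def using Ck_on_nth[OF open_ball smooth_onD[OF sm(2)]] by blast
  then obtain d b where b: "\<And>y. y \<in> ?B \<Longrightarrow> u' y $ k = d + b \<bullet> u y"
    "\<And>y. y \<in> ?B \<Longrightarrow> cgrad (\<lambda>x. u' x $ k) y = (\<Sum>i\<in>UNIV. b $ i *\<^sub>R cgrad (\<lambda>x. u x $ i) y)"
    by (rule parallel_affine_in_flat_coords[OF B(1) u _ flat_coords_parallel[OF open_ball B(1) u', of k]]) blast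
  have y0: "y0 \<in> ?B" using B(2) by simp
  have p: "pairing M c (cgrad (\<lambda>x. u x $ a)) (cgrad (\<lambda>x. u x $ b)) y0 = (if a = b then 1 else 0)" for a b
    using u y0 flat_coords_pairing[OF B(1) sm(1)] by blast
  have p': "pairing M c (cgrad (\<lambda>x. u' x $ a)) (cgrad (\<lambda>x. u' x $ b)) y0 = (if a = b then 1 else 0)" for a b
    using u' y0 flat_coords_pairing[OF B(1) sm(2)] by blast
  have bj: "pairing M c (cgrad (\<lambda>x. u' x $ k)) (cgrad (\<lambda>x. u x $ j)) y0 = b $ j" for j
  proof -
    have "pairing M c (cgrad (\<lambda>x. u' x $ k)) (cgrad (\<lambda>x. u x $ j)) y0
        = (\<Sum>i\<in>UNIV. b $ i * pairing M c (cgrad (\<lambda>x. u x $ i)) (cgrad (\<lambda>x. u x $ j)) y0)"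
      by (simp add: pairing_def b(2)[OF y0] inner_sum_left)
    also have "\<dots> = (\<Sum>i\<in>UNIV. if i = j then b $ i else 0)"
      by (rule sum.cong) (simp_all add: p)
    finally show ?thesis by simp
  qed
  have b0: "b $ j = 0" if j: "j \<noteq> k" for j
  proof -
    have "cgrad (\<lambda>x. u x $ j) y0 = cgrad (\<lambda>x. u' x $ j) y0"
      unfolding cgrad_def partial_def
      using frechet_derivative_cong_open[OF open_ball y0 eq[OF j]] by simp
    then have "b $ j = pairing M c (cgrad (\<lambda>x. u' x $ k)) (cgrad (\<lambda>x. u' x $ j)) y0"
      using bj[of j] by (simp add: pairing_def)
    then show ?thesis using p'[of k j] j by simp
  qed
  have sum_b: "(\<Sum>i\<in>UNIV. f i (b $ i)) = f k (b $ k)" if "\<And>i. f i 0 = (0::'z::comm_monoid_add)" for f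
    using sum.remove[of UNIV k "\<lambda>i. f i (b $ i)"] b0 that by simp
  have "cgrad (\<lambda>x. u' x $ k) y0 = b $ k *\<^sub>R cgrad (\<lambda>x. u x $ k) y0"
    using b(2)[OF y0] sum_b[of "\<lambda>i t. t *\<^sub>R cgrad (\<lambda>x. u x $ i) y0"] by simp
  then have "b $ k * b $ k = 1"
    using p'[of k k] p[of k k] by (simp add: pairing_def matrix_vector_mult_scaleR)
  then have "b $ k = 1 \<or> b $ k = -1" by algebra
  moreover have "u' y = flip k (b $ k) d (u y)" if y: "y \<in> ?B" for y
    using b(1)[OF y] eq[OF _ y] sum_b[of "\<lambda>i t. t * u y $ i"]
    by (auto simp: flip_def vec_eq_iff inner_vec_def)
  ultimately show ?thesis using that by blast
qed

text \<open>The differential of each coordinate is parallel and the curve satisfies the geodesic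
  equation, so their pairing \<open>f'\<close>, which is the derivative of the coordinate along the
  curve, is constant.\<close>

lemma geodesic_affine_in_flat_coords:
  assumes S: "open S" "S \<subseteq> cran c" and u: "flat_coords M c S u"
    and x: "smooth_on (ball t \<delta>) x" "x ` ball t \<delta> \<subseteq> S" and "\<delta> > 0"
    and geo: "\<And>s k. s \<in> ball t \<delta> \<Longrightarrow> vector_derivative (\<lambda>s. vector_derivative x (at s)) (at s) $ k
      + (\<Sum>i\<in>UNIV. \<Sum>j\<in>UNIV. christoffel M c (x s) k i j * vector_derivative x (at s) $ i * vector_derivative x (at s) $ j) = 0"
    and s: "s \<in> ball t \<delta>"
  shows "u (x s) = u (x t) + (s - t) *\<^sub>R frechet_derivative u (at (x t)) (vector_derivative x (at t))"
proof -
  let ?I = "ball t \<delta>"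
  have smu: "smooth_on S u" using u by (simp add: flat_coords_def)
  define x' where "x' s = vector_derivative x (at s)" for s
  have dx: "(x has_vector_derivative x' s) (at s)" if "s \<in> ?I" for s
    unfolding x'_def using smooth_on_has_vector_derivative[OF x(1) that] .
  have fx: "frechet_derivative x (at s) 1 = x' s" if "s \<in> ?I" for s
    using frechet_derivative_at[OF dx[OF that, unfolded has_vector_derivative_def], symmetric] by simp
  have "smooth_on ?I x'"
    unfolding smooth_on_def
    by (intro allI Ck_on_eqI[OF open_ball smooth_onD[OF smooth_on_frechet[OF x(1), of 1]]]) (simp add: fx)
  then have dx': "(x' has_vector_derivative vector_derivative x' (at s)) (at s)" if "s \<in> ?I" for s
    using smooth_on_has_vector_derivative that by blast
  let ?b = "frechet_derivative u (at (x t)) (x' t)"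
  have du: "(u has_derivative frechet_derivative u (at y)) (at y)" if "y \<in> S" for y
    using smooth_on_has_derivative[OF smu that] .
  have "u (x s) $ a = u (x t) $ a + (s - t) * ?b $ a" for a
  proof -
    let ?g = "cgrad (\<lambda>y. u y $ a)"
    have par: "parallel_form M c S ?g" using flat_coords_parallel[OF S u] .
    define f' where "f' s = ?g (x s) \<bullet> x' s" for s
    have f: "((\<lambda>s. u (x s) $ a) has_real_derivative f' s) (at s)" if s: "s \<in> ?I" for s
    proof -
      have xs: "x s \<in> S" using x s by blast
      have dua: "((\<lambda>y. u y $ a) has_derivative frechet_derivative (\<lambda>y. u y $ a) (at (x s))) (at (x s))"
        using Ck_on_SucD[OF Ck_on_nth[OF S(1) smooth_onD[OF smu]] xs] .
      have "((\<lambda>s. u (x s) $ a) has_derivative (\<lambda>v. frechet_derivative (\<lambda>y. u y $ a) (at (x s)) (v *\<^sub>R x' s))) (at s)"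
        using has_derivative_compose[OF dx[OF s, unfolded has_vector_derivative_def] dua] .
      moreover have "frechet_derivative (\<lambda>y. u y $ a) (at (x s)) (v *\<^sub>R x' s) = v * f' s" for v
        using frechet_eq_cgrad[OF differentiableI[OF dua]] by (simp add: f'_def)
      ultimately show ?thesis by (simp add: has_field_derivative_def mult_commute_abs)
    qed
    have "(f' has_derivative (\<lambda>h. 0)) (at s)" if s: "s \<in> ?I" for s
    proof -
      have xs: "x s \<in> S" using x s by blast
      have dg: "(?g has_derivative frechet_derivative ?g (at (x s))) (at (x s))"
        using par smooth_on_has_derivative[OF _ xs] by (auto simp: parallel_form_def)
      have "((\<lambda>s. ?g (x s)) has_derivative (\<lambda>v. frechet_derivative ?g (at (x s)) (v *\<^sub>R x' s))) (at s)"
        using has_derivative_compose[OF dx[OF s, unfolded has_vector_derivative_def] dg] .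
      from has_derivative_inner[OF this dx'[OF s, unfolded has_vector_derivative_def]]
      have 1: "(f' has_derivative (\<lambda>v. ?g (x s) \<bullet> (v *\<^sub>R vector_derivative x' (at s))
          + frechet_derivative ?g (at (x s)) (v *\<^sub>R x' s) \<bullet> x' s)) (at s)"
        by (simp add: f'_def[abs_def])
      \<comment> \<open>The connection term of the parallel form and the quadratic term of the
        geodesic equation are the same triple sum; the summations are reordered so that
        \<open>?g\<close> can be factored out.\<close>
      have "frechet_derivative ?g (at (x s)) (x' s) = (\<Sum>l\<in>UNIV. x' s $ l *\<^sub>R (conn M c (x s) l *v ?g (x s)))"
        using linear_eq_axis[OF has_derivative_linear[OF dg], of "x' s"] par xs by (simp add: parallel_form_def)
      moreover have "(conn M c (x s) l *v ?g (x s)) \<bullet> x' s =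
          (\<Sum>i\<in>UNIV. \<Sum>k\<in>UNIV. christoffel M c (x s) k l i * ?g (x s) $ k * x' s $ i)" for l
        by (simp add: inner_vec_def conn_def matrix_vector_mult_def sum_distrib_right)
      ultimately have "frechet_derivative ?g (at (x s)) (x' s) \<bullet> x' s =
          (\<Sum>l\<in>UNIV. \<Sum>i\<in>UNIV. \<Sum>k\<in>UNIV. x' s $ l * (christoffel M c (x s) k l i * ?g (x s) $ k * x' s $ i))"
        by (simp add: inner_sum_left sum_distrib_left)
      also have "\<dots> = (\<Sum>l\<in>UNIV. \<Sum>k\<in>UNIV. \<Sum>i\<in>UNIV. x' s $ l * (christoffel M c (x s) k l i * ?g (x s) $ k * x' s $ i))"
        by (intro sum.cong refl sum.swap)
      also have "\<dots> = (\<Sum>k\<in>UNIV. \<Sum>l\<in>UNIV. \<Sum>i\<in>UNIV. x' s $ l * (christoffel M c (x s) k l i * ?g (x s) $ k * x' s $ i))"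
        by (rule sum.swap)
      also have "\<dots> = (\<Sum>k\<in>UNIV. ?g (x s) $ k * (\<Sum>i\<in>UNIV. \<Sum>j\<in>UNIV. christoffel M c (x s) k i j * x' s $ i * x' s $ j))"
        by (simp add: sum_distrib_left mult_ac)
      also have "\<dots> = (\<Sum>k\<in>UNIV. ?g (x s) $ k * (- vector_derivative x' (at s) $ k))"
        using geo[OF s] by (intro sum.cong refl arg_cong2[of _ _ _ _ "(*)"]) (simp_all add: x'_def[abs_def] eq_neg_iff_add_eq_0 add.commute)
      also have "\<dots> = - (?g (x s) \<bullet> vector_derivative x' (at s))"
        by (simp add: inner_vec_def sum_negf)
      finally have 2: "frechet_derivative ?g (at (x s)) (x' s) \<bullet> x' s = - (?g (x s) \<bullet> vector_derivative x' (at s))" .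
      have "?g (x s) \<bullet> (v *\<^sub>R vector_derivative x' (at s)) + frechet_derivative ?g (at (x s)) (v *\<^sub>R x' s) \<bullet> x' s = 0" for v
        using 2 linear_cmul[OF has_derivative_linear[OF dg]] by simp
      then show ?thesis using 1 by simp
    qed
    then have const: "f' s = f' t" if "s \<in> ?I" for s
      using has_derivative_zero_unique[of ?I f' s t] that \<open>\<delta> > 0\<close>
      by (auto intro: has_derivative_at_withinI)
    have "((\<lambda>s. u (x s) $ a - s * f' t) has_derivative (\<lambda>h. 0)) (at s within ?I)" if "s \<in> ?I" for s
    proof -
      have "((\<lambda>s. u (x s) $ a - s * f' t) has_real_derivative 0) (at s)"
        using f[OF that] const[OF that] by (auto intro!: derivative_eq_intros)
      then show ?thesis by (simp add: has_field_derivative_def has_derivative_at_withinI zero_fun_def)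
    qed
    then have "u (x s) $ a - s * f' t = u (x t) $ a - t * f' t"
      using has_derivative_zero_unique[of ?I "\<lambda>s. u (x s) $ a - s * f' t" s t] s \<open>\<delta> > 0\<close> by simp
    moreover have "f' t = ?b $ a"
    proof -
      have xt: "x t \<in> S" using x \<open>\<delta> > 0\<close> by (meson centre_in_ball image_subset_iff)
      have d: "u differentiable (at (x t))" using du[OF xt] differentiableI by blast
      show ?thesis unfolding f'_def
        using frechet_eq_cgrad[OF differentiable_nth[OF d], of a "x' t"] frechet_nth[OF d, of a "x' t"] by simp
    qed
    ultimately show ?thesis by (simp add: algebra_simps)
  qed
  then show ?thesis by (simp add: vec_eq_iff x'_def)
qed

end

section \<open>Affine functions and flat coordinates on a Riemannian manifold\<close>

text \<open>Every preimage under a locally constant map is open, so each level set is clopen. The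
  codomain carries no topology, which allows truth values and derivatives as values besides real
  numbers.\<close>

lemma locally_constant_on_connected_space:
  assumes "connected_space X"
    and loc: "\<And>p. p \<in> topspace X \<Longrightarrow> \<exists>U. openin X U \<and> p \<in> U \<and> (\<forall>q\<in>U. f q = f p)"
    and "p \<in> topspace X" "q \<in> topspace X"
  shows "f p = f q"
proof -
  have op: "openin X {x \<in> topspace X. P (f x)}" for P
  proof (subst openin_subopen, intro ballI)
    fix x assume x: "x \<in> {x \<in> topspace X. P (f x)}"
    then have "x \<in> topspace X" by simp
    from loc[OF this] obtain U where U: "openin X U" "x \<in> U" "\<And>q. q \<in> U \<Longrightarrow> f q = f x" by metis
    have "U \<subseteq> {x \<in> topspace X. P (f x)}"
    proof
      fix q assume "q \<in> U"
      then show "q \<in> {x \<in> topspace X. P (f x)}"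
        using U(3) x openin_subset[OF U(1)] by auto
    qed
    then show "\<exists>T. openin X T \<and> x \<in> T \<and> T \<subseteq> {x \<in> topspace X. P (f x)}"
      using U(1,2) by blast
  qed
  define T where "T = {x \<in> topspace X. f x = f p}"
  have "openin X T" unfolding T_def using op[of "\<lambda>z. z = f p"] .
  moreover have "topspace X - T = {x \<in> topspace X. f x \<noteq> f p}" by (auto simp: T_def)
  then have "closedin X T" unfolding closedin_def using op[of "\<lambda>z. z \<noteq> f p"] by (auto simp: T_def)
  ultimately have "T = {} \<or> T = topspace X"
    using assms(1) unfolding connected_space_clopen_in by blast
  moreover have "p \<in> T" using assms(3) by (simp add: T_def)
  ultimately have "q \<in> T" using assms(4) by blast
  then show ?thesis by (simp add: T_def)
qed

locale riemannian =
  fixes M :: "('a, 'n::finite) riem"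
  assumes riem: "riemannian_manifold M"
begin

abbreviation "X \<equiv> mtop M"

lemma smooth_manifold: "smooth_manifold M"
  using riem unfolding riemannian_manifold_def by blast

lemma Hausdorff: "Hausdorff_space X"
  and topspace_eq: "topspace X = (\<Union>c\<in>atlas M. cdom c)"
  using smooth_manifold unfolding smooth_manifold_def by blast+

lemma chart:
  assumes "c \<in> atlas M"
  shows openin_cdom: "openin X (cdom c)" and open_cran: "open (cran c)"
    and chart_homeo: "homeomorphic_map (subtopology X (cdom c)) (top_of_set (cran c)) (cmap c)"
  using smooth_manifold assms unfolding smooth_manifold_def by blast+

lemma chart_at:
  assumes "p \<in> topspace X"
  obtains c where "c \<in> atlas M" "p \<in> cdom c"
  using assms topspace_eq by blast

lemma cdom_subset: "c \<in> atlas M \<Longrightarrow> cdom c \<subseteq> topspace X"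
  using openin_cdom openin_subset by blast

lemma topspace_cdom: "c \<in> atlas M \<Longrightarrow> topspace (subtopology X (cdom c)) = cdom c"
  using cdom_subset by (simp add: topspace_subtopology Int_absorb1)

lemma chart_inj: "c \<in> atlas M \<Longrightarrow> inj_on (cmap c) (cdom c)"
  using homeomorphic_imp_injective_map[OF chart_homeo] topspace_cdom by metis

lemma cinv_cmap: "c \<in> atlas M \<Longrightarrow> p \<in> cdom c \<Longrightarrow> cinv c (cmap c p) = p"
  using chart_inj by (simp add: inv_into_f_f)

lemma openin_chart_image:
  assumes "c \<in> atlas M" "V \<subseteq> cdom c"
  shows "openin X V \<longleftrightarrow> open (cmap c ` V)"
proof -
  have "openin (top_of_set (cran c)) (cmap c ` V) \<longleftrightarrow> openin (subtopology X (cdom c)) V"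
    by (rule homeomorphic_map_openness[OF chart_homeo[OF assms(1)]]) (use assms topspace_cdom in auto)
  then show ?thesis
    using assms openin_open_subtopology[OF openin_cdom[OF assms(1)]] openin_open_eq[OF open_cran[OF assms(1)]]
    by auto
qed

lemma open_chart_image:
  assumes "c \<in> atlas M" "openin X V"
  shows "open (cmap c ` (V \<inter> cdom c))"
  using openin_chart_image[OF assms(1), of "V \<inter> cdom c"] openin_Int[OF assms(2) openin_cdom[OF assms(1)]] by auto

lemma openin_chart_vimage:
  assumes "c \<in> atlas M" "open W"
  shows "openin X {p \<in> cdom c. cmap c p \<in> W}"
proof -
  have "cmap c ` {p \<in> cdom c. cmap c p \<in> W} = cran c \<inter> W" by auto
  then show ?thesis
    using openin_chart_image[OF assms(1), of "{p \<in> cdom c. cmap c p \<in> W}"] open_cran[OF assms(1)] assms(2) by auto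
qed

lemma riem_chart:
  assumes "c \<in> atlas M"
  shows "riem_chart M c"
  using riem assms open_cran unfolding riemannian_manifold_def riem_chart_def by blast

lemma smooth_transition:
  assumes "c \<in> atlas M" "d \<in> atlas M"
  shows "smooth_on (cmap c ` (cdom c \<inter> cdom d)) (cmap d \<circ> cinv c)"
  using smooth_manifold assms unfolding smooth_manifold_def by blast

lemma open_transition:
  assumes "c \<in> atlas M" "d \<in> atlas M"
  shows "open (cmap c ` (cdom c \<inter> cdom d))"
  using open_chart_image[OF assms(1) openin_cdom[OF assms(2)]] by (simp add: Int_commute)

lemma gmat_transition:
  assumes c: "c \<in> atlas M" and d: "d \<in> atlas M" and p: "p \<in> cdom c" "p \<in> cdom d"
  shows "v \<bullet> (gmat M c (cmap c p) *v v') =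
    frechet_derivative (cmap d \<circ> cinv c) (at (cmap c p)) v \<bullet>
      (gmat M d (cmap d p) *v frechet_derivative (cmap d \<circ> cinv c) (at (cmap c p)) v')"
proof -
  let ?J = "jacobian (cmap d \<circ> cinv c) (at (cmap c p))"
  have "gmat M c (cmap c p) = transpose ?J ** gmat M d (cmap d p) ** ?J"
    using riem c d p unfolding riemannian_manifold_def Let_def by blast
  then have *: "v \<bullet> (gmat M c (cmap c p) *v v') = (?J *v v) \<bullet> (gmat M d (cmap d p) *v (?J *v v'))"
    by (simp only: inner_pullback)
  have "(cmap d \<circ> cinv c) differentiable (at (cmap c p))"
    using smooth_on_has_derivative[OF smooth_transition[OF c d]] p differentiableI by blast
  then have "linear (frechet_derivative (cmap d \<circ> cinv c) (at (cmap c p)))"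
    by (rule linear_frechet_derivative)
  from matrix_apply[OF this] show ?thesis using * by (simp add: jacobian_def)
qed

lemma comp_transition:
  assumes c: "c \<in> atlas M" and d: "d \<in> atlas M" and p: "p \<in> cdom c" "p \<in> cdom d"
    and S: "open S" "cmap c p \<in> S" and f: "smooth_on S (f \<circ> cinv c)"
  shows "frechet_derivative (f \<circ> cinv d) (at (cmap d p)) v =
     frechet_derivative (f \<circ> cinv c) (at (cmap c p)) (frechet_derivative (cmap c \<circ> cinv d) (at (cmap d p)) v)"
proof -
  have "((cmap c \<circ> cinv d) has_derivative frechet_derivative (cmap c \<circ> cinv d) (at (cmap d p))) (at (cmap d p))"
    using smooth_on_has_derivative[OF smooth_transition[OF d c]] p by blast
  moreover have "((f \<circ> cinv c) has_derivative frechet_derivative (f \<circ> cinv c) (at (cmap c p))) (at ((cmap c \<circ> cinv d) (cmap d p)))"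
    using smooth_on_has_derivative[OF f S(2)] p d by (simp add: cinv_cmap)
  ultimately have "((\<lambda>y. (f \<circ> cinv c) ((cmap c \<circ> cinv d) y)) has_derivative
     (\<lambda>v. frechet_derivative (f \<circ> cinv c) (at (cmap c p)) (frechet_derivative (cmap c \<circ> cinv d) (at (cmap d p)) v))) (at (cmap d p))"
    by (rule has_derivative_compose)
  moreover have "((\<lambda>y. (f \<circ> cinv c) ((cmap c \<circ> cinv d) y)) has_derivative D) (at (cmap d p)) \<longleftrightarrow>
      ((f \<circ> cinv d) has_derivative D) (at (cmap d p))" for D
    by (rule has_derivative_cong_open[OF open_transition[OF d c]]) (use p c d in \<open>auto simp: cinv_cmap\<close>)
  ultimately show ?thesis using frechet_derivative_at by metis
qed

section \<open>Flat maps on open sets of the manifold\<close>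

definition flat_map :: "'a set \<Rightarrow> ('a \<Rightarrow> real^'n) \<Rightarrow> bool" where
  "flat_map V \<phi> \<longleftrightarrow> openin X V \<and> (\<forall>c\<in>atlas M. flat_coords M c (cmap c ` (V \<inter> cdom c)) (\<phi> \<circ> cinv c))"

text \<open>Being a local isometry does not depend on the chart, by the transformation laws of the
  metric and of derivatives; so one chart around each point suffices although the definition asks
  for all.\<close>

lemma flat_mapI:
  assumes V: "openin X V"
    and ex: "\<And>p. p \<in> V \<Longrightarrow> \<exists>c\<in>atlas M. p \<in> cdom c \<and> (\<exists>S. open S \<and> cmap c p \<in> S \<and> S \<subseteq> cran c \<and> flat_coords M c S (\<phi> \<circ> cinv c))"
  shows "flat_map V \<phi>"
  unfolding flat_map_def flat_coords_def
proof (intro conjI V ballI allI)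
  fix d assume d: "d \<in> atlas M"
  show "smooth_on (cmap d ` (V \<inter> cdom d)) (\<phi> \<circ> cinv d)"
    unfolding smooth_on_def
  proof (intro allI Ck_on_local)
    fix k y assume "y \<in> cmap d ` (V \<inter> cdom d)"
    then obtain p where p: "p \<in> V" "p \<in> cdom d" "y = cmap d p" by blast
    from ex[OF p(1)] obtain c S where c: "c \<in> atlas M" "p \<in> cdom c" and S: "open S" "cmap c p \<in> S" "S \<subseteq> cran c"
      and fl: "flat_coords M c S (\<phi> \<circ> cinv c)" by blast
    let ?W = "cmap d ` ({q \<in> cdom c. cmap c q \<in> S} \<inter> cdom d)"
    have W: "open ?W" by (rule open_chart_image[OF d openin_chart_vimage[OF c(1) S(1)]])
    have "Ck_on k ?W (cmap c \<circ> cinv d)"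
      by (rule Ck_on_subset[OF smooth_onD[OF smooth_transition[OF d c(1)]]]) auto
    moreover have "Ck_on k S (\<phi> \<circ> cinv c)" using fl by (simp add: flat_coords_def smooth_on_def)
    moreover have "(cmap c \<circ> cinv d) ` ?W \<subseteq> S" using d by (auto simp: cinv_cmap)
    ultimately have "Ck_on k ?W (\<lambda>y. (\<phi> \<circ> cinv c) ((cmap c \<circ> cinv d) y))"
      by (rule Ck_on_compose[OF S(1) W])
    then have "Ck_on k ?W (\<phi> \<circ> cinv d)"
      by (rule Ck_on_eqI[OF W]) (use c d in \<open>auto simp: cinv_cmap\<close>)
    then show "\<exists>T. open T \<and> y \<in> T \<and> Ck_on k T (\<phi> \<circ> cinv d)" using W p c S by blast
  qed
  fix y i j assume "y \<in> cmap d ` (V \<inter> cdom d)"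
  then obtain p where p: "p \<in> V" "p \<in> cdom d" "y = cmap d p" by blast
  from ex[OF p(1)] obtain c S where c: "c \<in> atlas M" "p \<in> cdom c" and S: "open S" "cmap c p \<in> S" "S \<subseteq> cran c"
    and fl: "flat_coords M c S (\<phi> \<circ> cinv c)" by blast
  interpret riem_chart M c using riem_chart[OF c(1)] .
  have sm: "smooth_on S (\<phi> \<circ> cinv c)" using fl by (simp add: flat_coords_def)
  have "gmat M d y $ i $ j = axis i 1 \<bullet> (gmat M d (cmap d p) *v axis j 1)"
    by (simp add: p(3) inner_axis' matrix_vector_mul_component inner_axis)
  also have "\<dots> = frechet_derivative (\<phi> \<circ> cinv d) (at y) (axis i 1) \<bullet> frechet_derivative (\<phi> \<circ> cinv d) (at y) (axis j 1)"
    unfolding gmat_transition[OF d c(1) p(2) c(2)] flat_coords_inner[OF fl S(2)] p(3)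
      comp_transition[OF c(1) d c(2) p(2) S(1,2) sm] ..
  finally show "gmat M d y $ i $ j = frechet_derivative (\<phi> \<circ> cinv d) (at y) (axis i 1) \<bullet> frechet_derivative (\<phi> \<circ> cinv d) (at y) (axis j 1)" .
qed

lemma flat_map_openin: "flat_map V \<phi> \<Longrightarrow> openin X V"
  by (simp add: flat_map_def)

lemma flat_map_coords: "flat_map V \<phi> \<Longrightarrow> c \<in> atlas M \<Longrightarrow> flat_coords M c (cmap c ` (V \<inter> cdom c)) (\<phi> \<circ> cinv c)"
  by (simp add: flat_map_def)

lemma flat_coords_subset: "flat_coords M c S u \<Longrightarrow> T \<subseteq> S \<Longrightarrow> flat_coords M c T u"
  unfolding flat_coords_def using smooth_on_subset by blast

lemma flat_map_subset: "flat_map V \<phi> \<Longrightarrow> openin X V' \<Longrightarrow> V' \<subseteq> V \<Longrightarrow> flat_map V' \<phi>"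
  unfolding flat_map_def
proof (elim conjE, intro conjI ballI)
  fix c assume *: "V' \<subseteq> V" "\<forall>c\<in>atlas M. flat_coords M c (cmap c ` (V \<inter> cdom c)) (\<phi> \<circ> cinv c)" "c \<in> atlas M"
  show "flat_coords M c (cmap c ` (V' \<inter> cdom c)) (\<phi> \<circ> cinv c)"
    by (rule flat_coords_subset[OF bspec[OF *(2,3)]]) (use *(1) in blast)
qed

lemma flat_map_flip:
  assumes "flat_map V \<phi>" "\<epsilon> = 1 \<or> \<epsilon> = -1"
  shows "flat_map V (\<lambda>p. flip k \<epsilon> d (\<phi> p))"
  unfolding flat_map_def
proof (intro conjI ballI)
  fix c assume c: "c \<in> atlas M"
  interpret riem_chart M c using riem_chart[OF c] .
  have "flat_coords M c (cmap c ` (V \<inter> cdom c)) (\<lambda>y. flip k \<epsilon> d ((\<phi> \<circ> cinv c) y))"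
    by (rule flat_coords_flip[OF open_chart_image[OF c flat_map_openin[OF assms(1)]] _ flat_map_coords[OF assms(1) c] assms(2)]) auto
  then show "flat_coords M c (cmap c ` (V \<inter> cdom c)) ((\<lambda>p. flip k \<epsilon> d (\<phi> p)) \<circ> cinv c)"
    by (simp add: o_def)
qed (rule flat_map_openin[OF assms(1)])

lemma chart_ball:
  assumes "openin X V" "p \<in> V" "c \<in> atlas M" "p \<in> cdom c"
  obtains r where "r > 0" "ball (cmap c p) r \<subseteq> cmap c ` (V \<inter> cdom c)" 
    "openin X {q \<in> cdom c. cmap c q \<in> ball (cmap c p) r}" "{q \<in> cdom c. cmap c q \<in> ball (cmap c p) r} \<subseteq> V"
proof -
  have "open (cmap c ` (V \<inter> cdom c))" "cmap c p \<in> cmap c ` (V \<inter> cdom c)"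
    using open_chart_image[OF assms(3,1)] assms by auto
  then obtain r where r: "r > 0" "ball (cmap c p) r \<subseteq> cmap c ` (V \<inter> cdom c)" using openE by blast
  moreover have "{q \<in> cdom c. cmap c q \<in> ball (cmap c p) r} \<subseteq> V"
    using r(2) chart_inj[OF assms(3)] by (auto simp: inj_on_def subset_iff image_iff)
  ultimately show ?thesis using that openin_chart_vimage[OF assms(3) open_ball] by blast
qed

text \<open>Restriction to a coordinate ball inside \<open>V \<inter> V'\<close> reduces this to a
  single chart. The sign and the shift are claimed only near \<open>p\<close>, since the overlap may
  be disconnected.\<close>

lemma flat_map_transition:
  assumes "flat_map V \<phi>" "flat_map V' \<phi>'" "p \<in> V" "p \<in> V'"
    and eq: "\<And>a q. a \<noteq> k \<Longrightarrow> q \<in> V \<inter> V' \<Longrightarrow> \<phi> q $ a = \<phi>' q $ a"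
  obtains \<epsilon> d U where "\<epsilon> = 1 \<or> \<epsilon> = -1" "openin X U" "p \<in> U" "U \<subseteq> V \<inter> V'"
    "\<And>q. q \<in> U \<Longrightarrow> \<phi>' q = flip k \<epsilon> d (\<phi> q)"
proof -
  have op: "openin X (V \<inter> V')" using assms flat_map_openin by (simp add: openin_Int)
  then obtain c where c: "c \<in> atlas M" "p \<in> cdom c" using chart_at assms openin_subset by blast
  obtain r where r: "r > 0" "ball (cmap c p) r \<subseteq> cmap c ` ((V \<inter> V') \<inter> cdom c)"
    "openin X {q \<in> cdom c. cmap c q \<in> ball (cmap c p) r}" "{q \<in> cdom c. cmap c q \<in> ball (cmap c p) r} \<subseteq> V \<inter> V'"
    using chart_ball[OF op _ c] assms by blast
  interpret riem_chart M c using riem_chart[OF c(1)] .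
  let ?B = "ball (cmap c p) r"
  have fl: "flat_coords M c ?B (\<phi> \<circ> cinv c)" "flat_coords M c ?B (\<phi>' \<circ> cinv c)"
    by (rule flat_coords_subset[OF flat_map_coords[OF assms(1) c(1)]], use r(2) in blast,
      rule flat_coords_subset[OF flat_map_coords[OF assms(2) c(1)]], use r(2) in blast)
  have "?B \<subseteq> cran c" using r(2) by auto
  moreover have "(\<phi> \<circ> cinv c) y $ a = (\<phi>' \<circ> cinv c) y $ a" if a: "a \<noteq> k" and y: "y \<in> ?B" for a y
  proof -
    obtain q where "q \<in> V \<inter> V'" "q \<in> cdom c" "y = cmap c q" using y r(2) by blast
    then show ?thesis using eq a c by (simp add: cinv_cmap)
  qed
  ultimately obtain \<epsilon> d where ed: "\<epsilon> = 1 \<or> \<epsilon> = -1" "\<And>y. y \<in> ?B \<Longrightarrow> (\<phi>' \<circ> cinv c) y = flip k \<epsilon> d ((\<phi> \<circ> cinv c) y)"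
    using flat_coords_transition[OF _ r(1) fl] by blast
  show ?thesis
  proof (rule that[OF ed(1) r(3) _ r(4)])
    show "p \<in> {q \<in> cdom c. cmap c q \<in> ?B}" using c r by auto
    fix q assume "q \<in> {q \<in> cdom c. cmap c q \<in> ?B}"
    then show "\<phi>' q = flip k \<epsilon> d (\<phi> q)" using ed(2)[of "cmap c q"] c by (simp add: cinv_cmap)
  qed
qed

definition flat_chart :: "'a set \<Rightarrow> ('a \<Rightarrow> real^'n) \<Rightarrow> bool" where
  "flat_chart V \<phi> \<longleftrightarrow> flat_map V \<phi> \<and> open (\<phi> ` V) \<and>
     homeomorphic_map (subtopology X V) (top_of_set (\<phi> ` V)) \<phi>"

lemma flat_chart_exists:
  assumes "flat_map V \<phi>" "p \<in> V"
  obtains V' where "V' \<subseteq> V" "p \<in> V'" "flat_chart V' \<phi>"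
proof -
  obtain c where c: "c \<in> atlas M" "p \<in> cdom c" using chart_at assms openin_subset flat_map_openin by blast
  interpret riem_chart M c using riem_chart[OF c(1)] .
  let ?S = "cmap c ` (V \<inter> cdom c)" and ?u = "\<phi> \<circ> cinv c"
  have S: "open ?S" "cmap c p \<in> ?S" using open_chart_image[OF c(1) flat_map_openin[OF assms(1)]] c assms by auto
  have fl: "flat_coords M c ?S ?u" by (rule flat_map_coords[OF assms(1) c(1)])
  have sm: "Ck_on m ?S ?u" for m using fl by (simp add: flat_coords_def smooth_on_def)
  have inj: "inj (frechet_derivative ?u (at (cmap c p)))" by (rule flat_coords_inj[OF fl S(2)]) auto
  obtain U W g where U: "open U" "U \<subseteq> ?S" "cmap c p \<in> U" "open W" "homeomorphism U W ?u g"
    by (rule local_inverse_exists[OF S(1) sm S(2) inj]) blast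
  let ?V = "{q \<in> cdom c. cmap c q \<in> U}"
  have V: "openin X ?V" by (rule openin_chart_vimage[OF c(1) U(1)])
  have VV: "?V \<subseteq> V" using U(2) chart_inj[OF c(1)] by (auto simp: inj_on_def subset_iff image_iff)
  have im: "cmap c ` ?V = U" using U(2) by auto
  have \<phi>W: "\<phi> ` ?V = W"
  proof -
    have "\<phi> ` ?V = ?u ` (cmap c ` ?V)" unfolding image_image by (rule image_cong) (use c in \<open>auto simp: cinv_cmap\<close>)
    then show ?thesis using im U(5) by (simp add: homeomorphism_def)
  qed
  have h1: "homeomorphic_map (subtopology X ?V) (top_of_set U) (cmap c)"
  proof -
    have "homeomorphic_map (subtopology (subtopology X (cdom c)) ?V) (subtopology (top_of_set (cran c)) U) (cmap c)"
    proof (rule homeomorphic_map_subtopologies[OF chart_homeo[OF c(1)]])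
      show "cmap c ` (topspace (subtopology X (cdom c)) \<inter> ?V) = topspace (top_of_set (cran c)) \<inter> U"
        using im U(2) topspace_cdom[OF c(1)] by auto
    qed
    moreover have "cdom c \<inter> ?V = ?V" "cran c \<inter> U = U" using U(2) by auto
    ultimately show ?thesis by (simp add: subtopology_subtopology)
  qed
  have "homeomorphic_map (top_of_set U) (top_of_set W) ?u"
    using U(5) unfolding homeomorphic_map_maps homeomorphic_maps_def homeomorphism_def
    by (intro exI[of _ g]) (auto simp: continuous_map_in_subtopology)
  from homeomorphic_map_compose[OF h1 this]
  have "homeomorphic_map (subtopology X ?V) (top_of_set W) (?u \<circ> cmap c)" .
  then have "homeomorphic_map (subtopology X ?V) (top_of_set W) \<phi>"
    by (rule homeomorphic_map_eq) (use c in \<open>auto simp: cinv_cmap\<close>)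
  then have "flat_chart ?V \<phi>"
    unfolding flat_chart_def \<phi>W using U(4) flat_map_subset[OF assms(1) V VV] by blast
  then show ?thesis using that VV c U by blast
qed

text \<open>A single \<open>b\<close> serves all charts around \<open>\<gamma> t\<close>, so that a
  velocity prescribed in any of them can be translated into a direction in flat coordinates.\<close>

lemma flat_map_geodesic:
  assumes \<gamma>: "geodesic M \<gamma>" and fl: "flat_map V \<phi>" and t: "\<gamma> t \<in> V"
  obtains \<delta> b where "\<delta> > 0" "\<And>s. s \<in> ball t \<delta> \<Longrightarrow> \<gamma> s \<in> V \<and> \<phi> (\<gamma> s) = \<phi> (\<gamma> t) + (s - t) *\<^sub>R b"
    "\<And>c. c \<in> atlas M \<Longrightarrow> \<gamma> t \<in> cdom c \<Longrightarrow>
       b = frechet_derivative (\<phi> \<circ> cinv c) (at (cmap c (\<gamma> t))) (vector_derivative (cmap c \<circ> \<gamma>) (at t))"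
proof -
  have aff: "\<exists>\<delta>>0. \<forall>s\<in>ball t \<delta>. \<gamma> s \<in> V \<and> \<phi> (\<gamma> s) = \<phi> (\<gamma> t) + (s - t) *\<^sub>R
      frechet_derivative (\<phi> \<circ> cinv c) (at (cmap c (\<gamma> t))) (vector_derivative (cmap c \<circ> \<gamma>) (at t))"
    if c: "c \<in> atlas M" "\<gamma> t \<in> cdom c" for c
  proof -
    interpret riem_chart M c using riem_chart[OF c(1)] .
    let ?S = "cmap c ` (V \<inter> cdom c)" and ?x = "cmap c \<circ> \<gamma>"
    have "openin X (V \<inter> cdom c)" using openin_Int[OF flat_map_openin[OF fl] openin_cdom[OF c(1)]] .
    moreover have cont: "continuous_map euclideanreal X \<gamma>" using \<gamma> by (simp add: geodesic_def)
    ultimately have "open {s. \<gamma> s \<in> V \<inter> cdom c}"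
      using openin_continuous_map_preimage[OF cont, of "V \<inter> cdom c"] by simp
    then obtain \<delta> where \<delta>: "\<delta> > 0" "ball t \<delta> \<subseteq> {s. \<gamma> s \<in> V \<inter> cdom c}"
      using openE[of "{s. \<gamma> s \<in> V \<inter> cdom c}" t] t c by auto
    have g: "smooth_on {t. \<gamma> t \<in> cdom c} ?x"
      "\<And>s k. \<gamma> s \<in> cdom c \<Longrightarrow> vector_derivative (\<lambda>t. vector_derivative ?x (at t)) (at s) $ k +
        (\<Sum>i\<in>UNIV. \<Sum>j\<in>UNIV. christoffel M c (?x s) k i j * vector_derivative ?x (at s) $ i * vector_derivative ?x (at s) $ j) = 0"
      using \<gamma> c(1) unfolding geodesic_def Let_def by blast+
    have A: "(\<phi> \<circ> cinv c) (?x s) = (\<phi> \<circ> cinv c) (?x t) + (s - t) *\<^sub>R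
        frechet_derivative (\<phi> \<circ> cinv c) (at (?x t)) (vector_derivative ?x (at t))" if s: "s \<in> ball t \<delta>" for s
    proof (rule geodesic_affine_in_flat_coords[OF _ _ flat_map_coords[OF fl c(1)] _ _ \<delta>(1) _ s])
      show "open ?S" by (rule open_chart_image[OF c(1) flat_map_openin[OF fl]])
      show "smooth_on (ball t \<delta>) ?x" by (rule smooth_on_subset[OF g(1)]) (use \<delta>(2) in auto)
      show "?x ` ball t \<delta> \<subseteq> ?S" using \<delta>(2) by auto
      show "vector_derivative (\<lambda>s. vector_derivative ?x (at s)) (at s) $ k +
        (\<Sum>i\<in>UNIV. \<Sum>j\<in>UNIV. christoffel M c (?x s) k i j * vector_derivative ?x (at s) $ i * vector_derivative ?x (at s) $ j) = 0"
        if "s \<in> ball t \<delta>" for s k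
        by (rule g(2)) (use \<delta>(2) that in auto)
    qed auto
    have inV: "\<gamma> s \<in> V" "cinv c (cmap c (\<gamma> s)) = \<gamma> s" if "s \<in> ball t \<delta>" for s
      using \<delta>(2) that c(1) by (auto simp: cinv_cmap subset_iff)
    have tt: "t \<in> ball t \<delta>" using \<delta>(1) by simp
    show ?thesis
    proof (intro exI[of _ \<delta>] conjI ballI \<delta>(1))
      fix s assume s: "s \<in> ball t \<delta>"
      show "\<gamma> s \<in> V" by (rule inV(1)[OF s])
      show "\<phi> (\<gamma> s) = \<phi> (\<gamma> t) + (s - t) *\<^sub>R
        frechet_derivative (\<phi> \<circ> cinv c) (at (cmap c (\<gamma> t))) (vector_derivative (cmap c \<circ> \<gamma>) (at t))"
        using A[OF s] unfolding o_apply inV(2)[OF s] inV(2)[OF tt] .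
    qed
  qed
  obtain c0 where c0: "c0 \<in> atlas M" "\<gamma> t \<in> cdom c0"
    using chart_at t flat_map_openin[OF fl] openin_subset by blast
  let ?b = "\<lambda>c. frechet_derivative (\<phi> \<circ> cinv c) (at (cmap c (\<gamma> t))) (vector_derivative (cmap c \<circ> \<gamma>) (at t))"
  obtain \<delta>0 where \<delta>0: "\<delta>0 > 0" "\<forall>s\<in>ball t \<delta>0. \<gamma> s \<in> V \<and> \<phi> (\<gamma> s) = \<phi> (\<gamma> t) + (s - t) *\<^sub>R ?b c0"
    using aff[OF c0] by blast
  \<comment> \<open>Each chart gives its own affine formula on its own interval; at one common small
    time both compute the same value of \<phi>, which forces equal directions.\<close>
  have "?b c0 = ?b c" if c: "c \<in> atlas M" "\<gamma> t \<in> cdom c" for c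
  proof -
    obtain \<delta> where \<delta>: "\<delta> > 0" "\<forall>s\<in>ball t \<delta>. \<gamma> s \<in> V \<and> \<phi> (\<gamma> s) = \<phi> (\<gamma> t) + (s - t) *\<^sub>R ?b c"
      using aff[OF c] by blast
    let ?h = "min \<delta> \<delta>0 / 2"
    have h: "?h > 0" "t + ?h \<in> ball t \<delta>" "t + ?h \<in> ball t \<delta>0"
      using \<delta>(1) \<delta>0(1) by (auto simp: dist_real_def)
    have "?h *\<^sub>R ?b c0 = ?h *\<^sub>R ?b c"
      using bspec[OF \<delta>(2) h(2)] bspec[OF \<delta>0(2) h(3)] by simp
    then show ?thesis using h(1) by simp
  qed
  then show ?thesis using that[of \<delta>0 "?b c0"] \<delta>0 by blast
qed

end

section \<open>The developing map\<close>

lemma flip_nth: "flip k \<epsilon> d x $ a = (if a = k then \<epsilon> * x $ k + d else x $ a)"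
  by (simp add: flip_def)

lemma flip_affine: "flip k \<epsilon> d (x + s *\<^sub>R b) = flip k \<epsilon> d x + s *\<^sub>R flip k \<epsilon> 0 b"
  by (simp add: vec_eq_iff flip_nth algebra_simps)

lemma flip_inverse:
  assumes "\<epsilon> = 1 \<or> \<epsilon> = -1"
  shows "flip k \<epsilon> (- (\<epsilon> * d)) (flip k \<epsilon> d x) = x" "flip k \<epsilon> d (flip k \<epsilon> (- (\<epsilon> * d)) x) = x"
  using assms by (auto simp: vec_eq_iff flip_nth)

lemma dist_flip:
  assumes "\<epsilon> = 1 \<or> \<epsilon> = -1"
  shows "dist (flip k \<epsilon> d x) (flip k \<epsilon> d y) = dist x y"
proof -
  have "dist (flip k \<epsilon> d x $ a) (flip k \<epsilon> d y $ a) = dist (x $ a) (y $ a)" for a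
    using assms by (auto simp: flip_nth dist_real_def)
  then show ?thesis by (simp add: dist_vec_def)
qed

lemma continuous_on_flip: "continuous_on S (flip (k::'n::finite) \<epsilon> d)"
proof -
  have "continuous_on S (\<lambda>x::real^'n. if a = k then \<epsilon> * x $ k + d else x $ a)" for a
    by (cases "a = k") (auto intro!: continuous_intros)
  then show ?thesis unfolding flip_def by (intro continuous_on_vec_lambda)
qed

text \<open>Comparing the fixed-point equation at \<open>x\<close> and at a nearby point displaced
  along axis \<open>k\<close> gives \<open>\<epsilon> = 1\<close>, and then \<open>d = 0\<close>. It
  trivialises the flip between two local inverses that agree on an open set.\<close>

lemma flip_fix_open:
  fixes U :: "(real^'n) set"
  assumes "open U" "x \<in> U" "\<And>y. y \<in> U \<Longrightarrow> flip k \<epsilon> d y = y"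
  shows "\<epsilon> = 1 \<and> d = 0"
proof -
  obtain e where e: "e > 0" "ball x e \<subseteq> U" using assms openE by blast
  let ?y = "x + (e/2) *\<^sub>R axis k 1"
  have "?y \<in> ball x e" using e(1) by (simp add: dist_norm)
  then have "flip k \<epsilon> d ?y $ k = ?y $ k" "flip k \<epsilon> d x $ k = x $ k"
    using assms(2,3) e(2) by auto
  then have 1: "\<epsilon> * (x $ k + e/2) + d = x $ k + e/2" and 2: "\<epsilon> * x $ k + d = x $ k"
    by (simp_all add: flip_nth axis_def)
  have "\<epsilon> * (e/2) = e/2" using 1 2 unfolding distrib_left by linarith
  then have "\<epsilon> = 1" using e(1) by simp
  then show ?thesis using 2 by simp
qed

text \<open>Continuity induction at the supremum of the times in [0, 1] where \<open>P\<close>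
  holds. The step hypothesis propagates \<open>P\<close> to the right from any time close to
  \<open>T\<close>, earlier or later, so it can be used at the supremum without knowing
  \<open>P\<close> there.\<close>

lemma real_interval_progress:
  fixes P :: "real \<Rightarrow> bool"
  assumes "P 0"
    and step: "\<And>T. T \<ge> 0 \<Longrightarrow> \<exists>\<epsilon>>0. \<forall>T'\<ge>0. \<bar>T' - T\<bar> < \<epsilon> \<longrightarrow> P T' \<longrightarrow> (\<forall>T''. T' \<le> T'' \<and> T'' < T + \<epsilon> \<longrightarrow> P T'')"
  shows "P 1"
proof (rule ccontr)
  assume n: "\<not> P 1"
  define A where "A = {t. 0 \<le> t \<and> t \<le> 1 \<and> P t}"
  have A: "0 \<in> A" "bdd_above A" using assms(1) by (auto simp: A_def bdd_above_def)
  define T where "T = Sup A"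
  have T: "0 \<le> T" unfolding T_def by (rule cSup_upper[OF A])
  have T1: "T \<le> 1" unfolding T_def by (rule cSup_least) (use A(1) in blast, simp add: A_def)
  obtain \<epsilon> where \<epsilon>: "\<epsilon> > 0" "\<And>T' T''. T' \<ge> 0 \<Longrightarrow> \<bar>T' - T\<bar> < \<epsilon> \<Longrightarrow> P T' \<Longrightarrow> T' \<le> T'' \<Longrightarrow> T'' < T + \<epsilon> \<Longrightarrow> P T''"
    using step[OF T] by metis
  have "A \<noteq> {}" using A(1) by blast
  from less_cSup_iff[OF this A(2), of "T - \<epsilon>"] \<epsilon>(1)
  obtain T' where T': "T' \<in> A" "T - \<epsilon> < T'" by (auto simp: T_def)
  have "T' \<le> T" using cSup_upper[OF T'(1) A(2)] by (simp add: T_def)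
  then have P: "P T''" if "T' \<le> T''" "T'' < T + \<epsilon>" for T''
    using \<epsilon>(2)[of T' T''] T' that by (auto simp: A_def)
  let ?T = "min 1 (T + \<epsilon> / 2)"
  have "T' \<le> ?T" "?T < T + \<epsilon>" using \<open>T' \<le> T\<close> T1 \<epsilon>(1) by auto
  then have "P ?T" by (rule P)
  then have "?T \<in> A" using T \<epsilon>(1) by (auto simp: A_def)
  then have "?T \<le> T" using cSup_upper[OF _ A(2)] by (simp add: T_def)
  then have "?T = 1" using \<epsilon>(1) by (auto simp: min_def split: if_splits)
  then show False using \<open>P ?T\<close> n by simp
qed

lemma discrete_real_subgroup:
  fixes L :: "real set"
  assumes diff: "\<And>a b. a \<in> L \<Longrightarrow> b \<in> L \<Longrightarrow> a - b \<in> L"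
    and disc: "\<delta> > 0" "\<And>a. a \<in> L \<Longrightarrow> \<bar>a\<bar> < \<delta> \<Longrightarrow> a = 0"
    and nz: "a \<in> L" "a \<noteq> 0"
  obtains T where "T > 0" "L = range (\<lambda>m::int. of_int m * T)"
proof -
  have z: "0 \<in> L" using diff[OF nz(1) nz(1)] by simp
  have neg: "- b \<in> L" if "b \<in> L" for b using diff[OF z that] by simp
  have add: "b + c \<in> L" if "b \<in> L" "c \<in> L" for b c using diff[OF that(1) neg[OF that(2)]] by simp
  \<comment> \<open>A positive element with least \<open>f\<close> is the least positive element:
    positive elements with equal \<open>f\<close> differ by less than \<delta>, hence by 0.
    Minimising a natural number replaces an infimum argument.\<close>
  define f where "f d = nat \<lfloor>d / \<delta>\<rfloor>" for d
  have "\<exists>d. d \<in> L \<and> d > 0" using nz neg[OF nz(1)] by (metis linorder_neqE_linordered_idom neg_0_less_iff_less)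
  then obtain T where T: "T \<in> L" "T > 0" and min: "\<And>d. d \<in> L \<Longrightarrow> d > 0 \<Longrightarrow> f T \<le> f d"
    using ex_has_least_nat[of "\<lambda>d. d \<in> L \<and> d > 0" _ f] by blast
  have least: "T \<le> d" if d: "d \<in> L" "d > 0" for d
  proof (rule ccontr)
    assume "\<not> T \<le> d"
    then have dT: "d < T" by simp
    have nn: "0 \<le> \<lfloor>d / \<delta>\<rfloor>" "0 \<le> \<lfloor>T / \<delta>\<rfloor>" using d T disc(1) by auto
    have "\<lfloor>d / \<delta>\<rfloor> \<le> \<lfloor>T / \<delta>\<rfloor>" using dT disc(1) by (intro floor_mono divide_right_mono) auto
    moreover have "\<lfloor>T / \<delta>\<rfloor> \<le> \<lfloor>d / \<delta>\<rfloor>" using min[OF d] nn unfolding f_def by linarith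
    ultimately have "\<lfloor>d / \<delta>\<rfloor> = \<lfloor>T / \<delta>\<rfloor>" by simp
    then have "T / \<delta> - d / \<delta> < 1" by linarith
    then have "T - d < \<delta>" using disc(1) by (simp add: field_simps)
    then show False using disc(2)[OF diff[OF T(1) d(1)]] dT by auto
  qed
  have mult_nat: "of_nat m * T \<in> L" for m :: nat
    by (induction m) (auto simp: z algebra_simps intro: add T)
  have mult: "of_int m * T \<in> L" for m :: int
    by (cases m rule: int_cases2) (use mult_nat neg[OF mult_nat] in auto)
  have "b \<in> range (\<lambda>m::int. of_int m * T)" if b: "b \<in> L" for b
  proof -
    let ?m = "\<lfloor>b / T\<rfloor>"
    have "b - of_int ?m * T \<in> L" using diff[OF b mult] .
    moreover have "0 \<le> b - of_int ?m * T" "b - of_int ?m * T < T"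
      using T(2) floor_divide_lower[of T b] floor_divide_upper[of T b] by (auto simp: algebra_simps)
    ultimately have "b - of_int ?m * T = 0" using least[of "b - of_int ?m * T"] by force
    then show ?thesis by (auto intro: image_eqI[of _ _ ?m])
  qed
  then have "L = range (\<lambda>m::int. of_int m * T)" using mult by blast
  then show ?thesis using that T(2) by blast
qed

text \<open>The topological content of a complete flat manifold with \<open>n - 1\<close> global affine coordinates. In
  \<open>F_geo\<close>, \<open>\<gamma>\<close> is the complete geodesic with initial velocity \<open>v\<close>.\<close>

locale flat_structure =
  fixes X :: "'a topology" and F :: "('a set \<times> ('a \<Rightarrow> real^'n::finite)) set" and k :: 'n
  assumes Haus: "Hausdorff_space X"
    and F_open: "(V, \<phi>) \<in> F \<Longrightarrow> openin X V"
    and F_img: "(V, \<phi>) \<in> F \<Longrightarrow> open (\<phi> ` V)"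
    and F_homeo: "(V, \<phi>) \<in> F \<Longrightarrow> homeomorphic_map (subtopology X V) (top_of_set (\<phi> ` V)) \<phi>"
    and F_cover: "p \<in> topspace X \<Longrightarrow> \<exists>V \<phi>. (V, \<phi>) \<in> F \<and> p \<in> V"
    and F_restrict: "(V, \<phi>) \<in> F \<Longrightarrow> openin X V' \<Longrightarrow> V' \<subseteq> V \<Longrightarrow> (V', \<phi>) \<in> F"
    and F_flip: "(V, \<phi>) \<in> F \<Longrightarrow> \<epsilon> = 1 \<or> \<epsilon> = -1 \<Longrightarrow> (V, \<lambda>p. flip k \<epsilon> d (\<phi> p)) \<in> F"
    and F_trans: "(V, \<phi>) \<in> F \<Longrightarrow> (V', \<phi>') \<in> F \<Longrightarrow> p \<in> V \<Longrightarrow> p \<in> V' \<Longrightarrow>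
      \<exists>\<epsilon> d U. (\<epsilon> = 1 \<or> \<epsilon> = -1) \<and> openin X U \<and> p \<in> U \<and> U \<subseteq> V \<inter> V' \<and> (\<forall>q\<in>U. \<phi>' q = flip k \<epsilon> d (\<phi> q))"
    and F_geo: "(V, \<phi>) \<in> F \<Longrightarrow> p \<in> V \<Longrightarrow> \<exists>\<gamma>.
      (\<exists>\<delta>>0. \<forall>s\<in>ball 0 \<delta>. \<gamma> s \<in> V \<and> \<phi> (\<gamma> s) = \<phi> p + s *\<^sub>R v) \<and> range \<gamma> \<subseteq> topspace X \<and>
      (\<forall>V' \<phi>' t. (V', \<phi>') \<in> F \<longrightarrow> \<gamma> t \<in> V' \<longrightarrow>
        (\<exists>\<delta>>0. \<exists>b. \<forall>s\<in>ball t \<delta>. \<gamma> s \<in> V' \<and> \<phi>' (\<gamma> s) = \<phi>' (\<gamma> t) + (s - t) *\<^sub>R b))"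
begin

lemma F_topspace: "(V, \<phi>) \<in> F \<Longrightarrow> topspace (subtopology X V) = V"
  using openin_subset[OF F_open] by (simp add: topspace_subtopology Int_absorb1)

lemma F_inj: "(V, \<phi>) \<in> F \<Longrightarrow> inj_on \<phi> V"
  using homeomorphic_imp_injective_map[OF F_homeo] F_topspace by metis

lemma F_openness: "(V, \<phi>) \<in> F \<Longrightarrow> W \<subseteq> V \<Longrightarrow> open (\<phi> ` W) \<longleftrightarrow> openin X W"
  using homeomorphic_map_openness[OF F_homeo, of V \<phi> W] F_topspace[of V \<phi>] F_open[of V \<phi>] F_img[of V \<phi>]
  by (auto simp: openin_open_subtopology openin_open_eq)

lemma F_open_image: "(V, \<phi>) \<in> F \<Longrightarrow> openin X W \<Longrightarrow> open (\<phi> ` (V \<inter> W))"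
  using F_openness[of V \<phi> "V \<inter> W"] F_open[of V \<phi>] openin_Int by blast

lemma F_open_vimage:
  assumes F: "(V, \<phi>) \<in> F" and "open B"
  shows "openin X {q \<in> V. \<phi> q \<in> B}"
proof -
  have "\<phi> ` {q \<in> V. \<phi> q \<in> B} = \<phi> ` V \<inter> B" by auto
  then show ?thesis
    using F_openness[OF F, of "{q \<in> V. \<phi> q \<in> B}"] F_img[OF F] assms(2) open_Int by auto
qed

lemma F_ball:
  assumes F: "(V, \<phi>) \<in> F" and p: "p \<in> V"
  obtains V' r where "r > 0" "V' \<subseteq> V" "(V', \<phi>) \<in> F" "p \<in> V'" "\<phi> ` V' = ball (\<phi> p) r"
proof -
  obtain r where r: "r > 0" "ball (\<phi> p) r \<subseteq> \<phi> ` V" using F_img[OF F] p openE by blast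
  let ?V = "{q \<in> V. \<phi> q \<in> ball (\<phi> p) r}"
  have "?V \<subseteq> V" by auto
  moreover have "(?V, \<phi>) \<in> F" by (rule F_restrict[OF F F_open_vimage[OF F open_ball]]) auto
  moreover have "\<phi> ` ?V = ball (\<phi> p) r" using r(2) by auto
  ultimately show ?thesis using that[OF r(1), of ?V] p r(1) by auto
qed

section \<open>Local inverses of flat coordinates and their uniqueness\<close>

text \<open>Maps that are locally inverse to members of \<open>F\<close>. Continuity is not part of
  the definition; it follows in \<open>dev_open_vimage\<close> because the coordinates are injective
  and open.\<close>

definition dev :: "(real^'n) set \<Rightarrow> (real^'n \<Rightarrow> 'a) \<Rightarrow> bool" where
  "dev U \<psi> \<longleftrightarrow> open U \<and> (\<forall>x\<in>U. \<exists>V \<phi> O'. (V, \<phi>) \<in> F \<and> open O' \<and> x \<in> O' \<and> O' \<subseteq> U \<and> \<psi> ` O' \<subseteq> V \<and> (\<forall>y\<in>O'. \<phi> (\<psi> y) = y))"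

lemma dev_open: "dev U \<psi> \<Longrightarrow> open U"
  by (simp add: dev_def)

lemma devE:
  assumes "dev U \<psi>" "x \<in> U"
  obtains V \<phi> O' where "(V, \<phi>) \<in> F" "open O'" "x \<in> O'" "O' \<subseteq> U" "\<psi> ` O' \<subseteq> V" "\<And>y. y \<in> O' \<Longrightarrow> \<phi> (\<psi> y) = y"
  using assms unfolding dev_def by metis

lemma devI:
  assumes "open U" "\<And>x. x \<in> U \<Longrightarrow> \<exists>V \<phi> O'. (V, \<phi>) \<in> F \<and> open O' \<and> x \<in> O' \<and> O' \<subseteq> U \<and> \<psi> ` O' \<subseteq> V \<and> (\<forall>y\<in>O'. \<phi> (\<psi> y) = y)"
  shows "dev U \<psi>"
  using assms unfolding dev_def by blast

lemma dev_subset: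
  assumes "dev U \<psi>" "open U'" "U' \<subseteq> U"
  shows "dev U' \<psi>"
proof (rule devI[OF assms(2)])
  fix x assume x: "x \<in> U'"
  then have "x \<in> U" using assms(3) by blast
  from devE[OF assms(1) this] obtain V \<phi> O' where *: "(V, \<phi>) \<in> F" "open O'" "x \<in> O'" "O' \<subseteq> U" "\<psi> ` O' \<subseteq> V" "\<And>y. y \<in> O' \<Longrightarrow> \<phi> (\<psi> y) = y"
    by metis
  show "\<exists>V \<phi> O'. (V, \<phi>) \<in> F \<and> open O' \<and> x \<in> O' \<and> O' \<subseteq> U' \<and> \<psi> ` O' \<subseteq> V \<and> (\<forall>y\<in>O'. \<phi> (\<psi> y) = y)"
    by (intro exI[of _ V] exI[of _ \<phi>] exI[of _ "O' \<inter> U'"]) (use * x assms in auto)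
qed

lemma dev_local:
  assumes "\<And>x. x \<in> U \<Longrightarrow> \<exists>U' \<psi>'. x \<in> U' \<and> U' \<subseteq> U \<and> dev U' \<psi>' \<and> (\<forall>y\<in>U'. \<psi> y = \<psi>' y)"
  shows "dev U \<psi>"
proof (rule devI)
  show "open U" using assms dev_open by (subst open_subopen) metis
  fix x assume "x \<in> U"
  from assms[OF this] obtain U' \<psi>' where U': "x \<in> U'" "U' \<subseteq> U" "dev U' \<psi>'" "\<And>y. y \<in> U' \<Longrightarrow> \<psi> y = \<psi>' y" by metis
  from devE[OF U'(3,1)] obtain V \<phi> O' where *: "(V, \<phi>) \<in> F" "open O'" "x \<in> O'" "O' \<subseteq> U'" "\<psi>' ` O' \<subseteq> V" "\<And>y. y \<in> O' \<Longrightarrow> \<phi> (\<psi>' y) = y"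
    by metis
  have eq: "\<psi> y = \<psi>' y" if "y \<in> O'" for y using U'(4) *(4) that by blast
  show "\<exists>V \<phi> O'. (V, \<phi>) \<in> F \<and> open O' \<and> x \<in> O' \<and> O' \<subseteq> U \<and> \<psi> ` O' \<subseteq> V \<and> (\<forall>y\<in>O'. \<phi> (\<psi> y) = y)"
    by (intro exI[of _ V] exI[of _ \<phi>] exI[of _ O']) (use * U' eq in auto)
qed

lemma dev_inv_into:
  assumes F: "(V, \<phi>) \<in> F"
  shows "dev (\<phi> ` V) (inv_into V \<phi>)"
proof (rule devI[OF F_img[OF F]])
  fix x assume "x \<in> \<phi> ` V"
  then show "\<exists>V' \<phi>' O'. (V', \<phi>') \<in> F \<and> open O' \<and> x \<in> O' \<and> O' \<subseteq> \<phi> ` V \<and> inv_into V \<phi> ` O' \<subseteq> V' \<and> (\<forall>y\<in>O'. \<phi>' (inv_into V \<phi> y) = y)"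
    by (intro exI[of _ V] exI[of _ \<phi>] exI[of _ "\<phi> ` V"])
      (use F F_img[OF F] in \<open>auto simp: inv_into_into f_inv_into_f\<close>)
qed

lemma dev_topspace: "dev U \<psi> \<Longrightarrow> x \<in> U \<Longrightarrow> \<psi> x \<in> topspace X"
  by (erule devE, assumption) (use F_open openin_subset in blast)

lemma dev_open_vimage:
  assumes "dev U \<psi>" "openin X W"
  shows "open {x \<in> U. \<psi> x \<in> W}"
proof (subst open_subopen, intro ballI)
  fix x assume x: "x \<in> {x \<in> U. \<psi> x \<in> W}"
  then have "x \<in> U" by simp
  from devE[OF assms(1) this] obtain V \<phi> O' where *: "(V, \<phi>) \<in> F" "open O'" "x \<in> O'" "O' \<subseteq> U" "\<psi> ` O' \<subseteq> V" "\<And>y. y \<in> O' \<Longrightarrow> \<phi> (\<psi> y) = y"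
    by metis
  let ?N = "O' \<inter> \<phi> ` (V \<inter> W)"
  have "open ?N" using *(2) F_open_image[OF *(1) assms(2)] by (rule open_Int)
  moreover have "x \<in> ?N" using x * by (auto intro!: image_eqI[of _ _ "\<psi> x"])
  moreover have "\<psi> y \<in> W" if y: "y \<in> ?N" for y
  proof -
    obtain q where q: "q \<in> V" "q \<in> W" "y = \<phi> q" using y by blast
    have "\<psi> y \<in> V" "\<phi> (\<psi> y) = \<phi> q" using *(5,6) y q by auto
    then show ?thesis using F_inj[OF *(1)] q by (auto simp: inj_on_def)
  qed
  ultimately show "\<exists>T. open T \<and> x \<in> T \<and> T \<subseteq> {x \<in> U. \<psi> x \<in> W}" using *(4) by (intro exI[of _ ?N]) auto
qed

text \<open>The chart that witnesses \<open>dev\<close> and the given one differ near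
  \<open>\<psi> x\<close> by a flip, which is absorbed into the given chart. Thus the chart in which
  \<psi> is an inverse may be prescribed up to a flip.\<close>

lemma dev_chart:
  assumes \<psi>: "dev U \<psi>" "x \<in> U" and F: "(V, \<phi>) \<in> F" "\<psi> x \<in> V"
  obtains \<epsilon> d O' where "\<epsilon> = 1 \<or> \<epsilon> = -1" "(V, \<lambda>q. flip k \<epsilon> d (\<phi> q)) \<in> F" "open O'" "x \<in> O'" "O' \<subseteq> U" "\<psi> ` O' \<subseteq> V"
    "\<And>y. y \<in> O' \<Longrightarrow> flip k \<epsilon> d (\<phi> (\<psi> y)) = y"
proof -
  from devE[OF \<psi>] obtain V' \<phi>' O' where *: "(V', \<phi>') \<in> F" "open O'" "x \<in> O'" "O' \<subseteq> U" "\<psi> ` O' \<subseteq> V'" "\<And>y. y \<in> O' \<Longrightarrow> \<phi>' (\<psi> y) = y"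
    by metis
  have "\<psi> x \<in> V'" using * by blast
  from F_trans[OF F(1) *(1) F(2) this] obtain \<epsilon> d W where ed: "\<epsilon> = 1 \<or> \<epsilon> = -1" "openin X W" "\<psi> x \<in> W" "W \<subseteq> V \<inter> V'"
    "\<And>q. q \<in> W \<Longrightarrow> \<phi>' q = flip k \<epsilon> d (\<phi> q)" by metis
  let ?O = "O' \<inter> {y \<in> U. \<psi> y \<in> W}"
  show ?thesis
  proof (rule that[OF ed(1) F_flip[OF F(1) ed(1)]])
    show "open ?O" using *(2) dev_open_vimage[OF \<psi>(1) ed(2)] by (rule open_Int)
    fix y assume "y \<in> ?O"
    then show "flip k \<epsilon> d (\<phi> (\<psi> y)) = y" using *(6)[of y] ed(5)[of "\<psi> y"] by simp
  qed (use * ed \<psi> in auto)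
qed

text \<open>An identity theorem: the open set on which the maps agree is also relatively closed.
  Different values are separated by the Hausdorff property; at a point with equal values both maps
  invert the same coordinates up to a flip, and agreement on a nonempty open piece makes the flip
  trivial.\<close>

lemma dev_unique:
  assumes \<psi>: "dev U \<psi>" and \<psi>': "dev U \<psi>'" and U: "connected U"
    and N: "open N" "N \<subseteq> U" "N \<noteq> {}" "\<And>y. y \<in> N \<Longrightarrow> \<psi> y = \<psi>' y" and x: "x \<in> U"
  shows "\<psi> x = \<psi>' x"
proof -
  \<comment> \<open>The interior of the agreement set, not the set itself: agreement at a single
    point says little, since a reflection may fix it.\<close>
  define E where "E = \<Union>{O'. open O' \<and> O' \<subseteq> U \<and> (\<forall>y\<in>O'. \<psi> y = \<psi>' y)}"
  have E: "open E" "E \<subseteq> U" unfolding E_def by (rule open_Union) auto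
  have agree: "\<psi> y = \<psi>' y" if "y \<in> E" for y using that unfolding E_def by blast
  have sub_E: "O' \<subseteq> E" if "open O'" "O' \<subseteq> U" "\<And>y. y \<in> O' \<Longrightarrow> \<psi> y = \<psi>' y" for O'
    using that unfolding E_def by blast
  have "open (U - E)"
  proof (subst open_subopen, intro ballI)
    fix y assume y: "y \<in> U - E"
    then have yU: "y \<in> U" by simp
    show "\<exists>T. open T \<and> y \<in> T \<and> T \<subseteq> U - E"
    proof (cases "\<psi> y = \<psi>' y")
      case False
      then obtain W W' where W: "openin X W" "openin X W'" "\<psi> y \<in> W" "\<psi>' y \<in> W'" "disjnt W W'"
        using Haus dev_topspace[OF \<psi> yU] dev_topspace[OF \<psi>' yU] unfolding Hausdorff_space_def by metis
      let ?T = "{z \<in> U. \<psi> z \<in> W} \<inter> {z \<in> U. \<psi>' z \<in> W'}"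
      have "open ?T" using dev_open_vimage[OF \<psi> W(1)] dev_open_vimage[OF \<psi>' W(2)] by (rule open_Int)
      moreover have "?T \<subseteq> U - E" using W(5) agree by (force simp: disjnt_iff)
      ultimately show ?thesis using W(3,4) yU by (intro exI[of _ ?T]) auto
    next
      case True
      from devE[OF \<psi> yU] obtain V \<phi> O1 where *: "(V, \<phi>) \<in> F" "open O1" "y \<in> O1" "O1 \<subseteq> U" "\<psi> ` O1 \<subseteq> V" "\<And>z. z \<in> O1 \<Longrightarrow> \<phi> (\<psi> z) = z"
        by metis
      have "\<psi>' y \<in> V" using * True by auto
      from dev_chart[OF \<psi>' yU *(1) this] obtain \<epsilon> d O2 where ed: "\<epsilon> = 1 \<or> \<epsilon> = -1" "open O2" "y \<in> O2" "O2 \<subseteq> U" "\<psi>' ` O2 \<subseteq> V"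
        "\<And>z. z \<in> O2 \<Longrightarrow> flip k \<epsilon> d (\<phi> (\<psi>' z)) = z" by metis
      have op: "open (O1 \<inter> O2)" using *(2) ed(2) by (rule open_Int)
      have "O1 \<inter> O2 \<inter> E = {}"
      proof (rule ccontr)
        assume "O1 \<inter> O2 \<inter> E \<noteq> {}"
        then obtain z where z: "z \<in> O1 \<inter> O2 \<inter> E" by blast
        have "\<epsilon> = 1 \<and> d = 0"
        proof (rule flip_fix_open[OF open_Int[OF op E(1)] z])
          fix w assume w: "w \<in> O1 \<inter> O2 \<inter> E"
          then have "\<phi> (\<psi>' w) = w" using *(6)[of w] agree[of w] by simp
          then show "flip k \<epsilon> d w = w" using ed(6)[of w] w by simp
        qed
        moreover have "flip k 1 0 z = z" for z :: "real^'n" by (simp add: vec_eq_iff flip_nth)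
        ultimately have "\<phi> (\<psi>' w) = w" if "w \<in> O2" for w using ed(6)[OF that] by simp
        then have "\<psi> w = \<psi>' w" if "w \<in> O1 \<inter> O2" for w
          using F_inj[OF *(1)] that *(5,6) ed(5) unfolding inj_on_def
          by (metis IntD1 IntD2 image_subset_iff)
        then have "O1 \<inter> O2 \<subseteq> E" using sub_E[OF op] *(4) by blast
        then show False using y *(3) ed(3) by blast
      qed
      then show ?thesis using op *(3,4) ed(3) by (intro exI[of _ "O1 \<inter> O2"]) auto
    qed
  qed
  moreover have "N \<subseteq> E" using sub_E[OF N(1,2,4)] .
  ultimately have "(U - E) \<inter> U = {}"
    using connectedD[OF U E(1), of "U - E"] E(2) N(3) by blast
  then show ?thesis using x agree by blast
qed

section \<open>Continuation along rays\<close>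

text \<open>Convexity makes the intersection of two such domains connected, so that any two
  continuations of the same germ at \<open>x0\<close> agree there. The germ is that of the inverse
  of \<open>\<phi>0\<close>.\<close>

definition good :: "'a set \<Rightarrow> ('a \<Rightarrow> real^'n) \<Rightarrow> real^'n \<Rightarrow> (real^'n) set \<Rightarrow> (real^'n \<Rightarrow> 'a) \<Rightarrow> bool" where
  "good V0 \<phi>0 x0 U \<psi> \<longleftrightarrow> dev U \<psi> \<and> convex U \<and> x0 \<in> U \<and>
     (\<exists>O'. open O' \<and> x0 \<in> O' \<and> O' \<subseteq> U \<and> \<psi> ` O' \<subseteq> V0 \<and> (\<forall>y\<in>O'. \<phi>0 (\<psi> y) = y))"

lemma good_unique:
  assumes F: "(V0, \<phi>0) \<in> F" and "good V0 \<phi>0 x0 U \<psi>" "good V0 \<phi>0 x0 U' \<psi>'" "x \<in> U" "x \<in> U'"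
  shows "\<psi> x = \<psi>' x"
proof -
  obtain O1 where O1: "open O1" "x0 \<in> O1" "O1 \<subseteq> U" "\<psi> ` O1 \<subseteq> V0" "\<And>y. y \<in> O1 \<Longrightarrow> \<phi>0 (\<psi> y) = y"
    and U: "dev U \<psi>" "convex U" using assms(2) unfolding good_def by metis
  obtain O2 where O2: "open O2" "x0 \<in> O2" "O2 \<subseteq> U'" "\<psi>' ` O2 \<subseteq> V0" "\<And>y. y \<in> O2 \<Longrightarrow> \<phi>0 (\<psi>' y) = y"
    and U': "dev U' \<psi>'" "convex U'" using assms(3) unfolding good_def by metis
  have op: "open (U \<inter> U')" using dev_open[OF U(1)] dev_open[OF U'(1)] by (rule open_Int)
  show ?thesis
  proof (rule dev_unique[of "U \<inter> U'" _ _ "O1 \<inter> O2"])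
    show "dev (U \<inter> U') \<psi>" "dev (U \<inter> U') \<psi>'"
      using dev_subset[OF U(1) op] dev_subset[OF U'(1) op] by auto
    show "connected (U \<inter> U')" using convex_Int[OF U(2) U'(2)] convex_connected by blast
    fix y assume "y \<in> O1 \<inter> O2"
    then show "\<psi> y = \<psi>' y"
      using F_inj[OF F] O1(4,5) O2(4,5) unfolding inj_on_def by (metis IntD1 IntD2 image_subset_iff)
  qed (use O1 O2 assms in auto)
qed

text \<open>This is where completeness acts: the geodesic \<gamma> with initial direction
  \<open>v\<close> exists for all times, and continuity induction shows that the inverse of
  \<open>\<phi>0\<close> can be continued along the ray up to time 1 while following
  \<gamma>.\<close>

lemma good_exists:
  assumes F: "(V0, \<phi>0) \<in> F" "p0 \<in> V0" and x0: "x0 = \<phi>0 p0"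
  shows "\<exists>U \<psi>. good V0 \<phi>0 x0 U \<psi> \<and> x0 + v \<in> U"
proof -
  have base: "good V0 \<phi>0 x0 (\<phi>0 ` V) (inv_into V \<phi>0)"
    if "V \<subseteq> V0" "(V, \<phi>0) \<in> F" "\<phi>0 ` V = ball x0 r" "r > 0" for V r
    unfolding good_def
    by (intro conjI exI[of _ "\<phi>0 ` V"] dev_inv_into that F_img)
      (use that in \<open>auto simp: inv_into_into f_inv_into_f subset_iff\<close>)
  show ?thesis
  proof (cases "v = 0")
    case True
    obtain V r where V: "r > 0" "V \<subseteq> V0" "(V, \<phi>0) \<in> F" "\<phi>0 ` V = ball x0 r"
      using F_ball[OF F] x0 by metis
    then show ?thesis using base[OF V(2,3,4,1)] True by (intro exI[of _ "\<phi>0 ` V"] exI[of _ "inv_into V \<phi>0"]) auto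
  next
    case False
    then have nv: "norm v > 0" by simp
    obtain \<gamma> \<delta>0 where \<delta>0: "\<delta>0 > 0" "\<And>s. s \<in> ball 0 \<delta>0 \<Longrightarrow> \<gamma> s \<in> V0 \<and> \<phi>0 (\<gamma> s) = x0 + s *\<^sub>R v"
      and \<gamma>_top: "range \<gamma> \<subseteq> topspace X"
      and \<gamma>: "\<And>V' \<phi>' t. (V', \<phi>') \<in> F \<Longrightarrow> \<gamma> t \<in> V' \<Longrightarrow>
        (\<exists>\<delta>>0. \<exists>b. \<forall>s\<in>ball t \<delta>. \<gamma> s \<in> V' \<and> \<phi>' (\<gamma> s) = \<phi>' (\<gamma> t) + (s - t) *\<^sub>R b)"
      using F_geo[OF F, of v] unfolding x0 by metis
    \<comment> \<open>The last conjunct ties the continuation to \<gamma> on the line; through it a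
      chart at \<open>\<gamma> T\<close> also contains values of \<psi> at slightly earlier
      times.\<close>
    define P where "P t \<longleftrightarrow> (\<exists>U \<psi>. good V0 \<phi>0 x0 U \<psi> \<and> x0 + t *\<^sub>R v \<in> U \<and> (\<forall>s. x0 + s *\<^sub>R v \<in> U \<longrightarrow> \<psi> (x0 + s *\<^sub>R v) = \<gamma> s))" for t
    have "P 0"
    proof -
      obtain r0 where r0: "r0 > 0" "ball x0 r0 \<subseteq> \<phi>0 ` V0" using F_img[OF F(1)] F(2) x0 openE by blast
      \<comment> \<open>The second bound keeps the points of the line in the ball within the times
        for which \<gamma> is known to be straight in \<open>\<phi>0\<close>.\<close>
      define r where "r = min r0 (\<delta>0 * norm v)"
      have r: "r > 0" using r0 \<delta>0 nv by (simp add: r_def)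
      let ?V = "{q \<in> V0. \<phi>0 q \<in> ball x0 r}"
      have V: "?V \<subseteq> V0" by auto
      have FV: "(?V, \<phi>0) \<in> F" by (rule F_restrict[OF F(1) F_open_vimage[OF F(1) open_ball] V])
      have V_img: "\<phi>0 ` ?V = ball x0 r" using r0(2) by (auto simp: r_def)
      have "inv_into ?V \<phi>0 (x0 + s *\<^sub>R v) = \<gamma> s" if s: "x0 + s *\<^sub>R v \<in> \<phi>0 ` ?V" for s
      proof -
        have "\<bar>s\<bar> * norm v < \<delta>0 * norm v" using s unfolding V_img by (simp add: dist_norm r_def)
        then have "s \<in> ball 0 \<delta>0" using nv by (simp add: dist_real_def)
        then have "\<gamma> s \<in> V0" "\<phi>0 (\<gamma> s) = x0 + s *\<^sub>R v" using \<delta>0(2) by auto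
        moreover from this have "\<gamma> s \<in> ?V" using s unfolding V_img by auto
        then have "inv_into ?V \<phi>0 (\<phi>0 (\<gamma> s)) = \<gamma> s" by (rule inv_into_f_f[OF F_inj[OF FV]])
        ultimately show ?thesis by simp
      qed
      then show ?thesis unfolding P_def using base[OF V FV V_img r] r V_img
        by (intro exI[of _ "\<phi>0 ` ?V"] exI[of _ "inv_into ?V \<phi>0"]) auto
    qed
    moreover have "\<exists>\<epsilon>>0. \<forall>T'\<ge>0. \<bar>T' - T\<bar> < \<epsilon> \<longrightarrow> P T' \<longrightarrow> (\<forall>T''. T' \<le> T'' \<and> T'' < T + \<epsilon> \<longrightarrow> P T'')" for T
    proof -
      have "\<gamma> T \<in> topspace X" using \<gamma>_top by blast
      then obtain V \<phi> where V: "(V, \<phi>) \<in> F" "\<gamma> T \<in> V" using F_cover by blast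
      obtain \<delta> b where \<delta>: "\<delta> > 0" "\<And>s. s \<in> ball T \<delta> \<Longrightarrow> \<gamma> s \<in> V \<and> \<phi> (\<gamma> s) = \<phi> (\<gamma> T) + (s - T) *\<^sub>R b"
        using \<gamma>[OF V] by metis
      obtain \<rho>0 where \<rho>0: "\<rho>0 > 0" "ball (\<phi> (\<gamma> T)) \<rho>0 \<subseteq> \<phi> ` V" using F_img[OF V(1)] V(2) openE by blast
      define \<rho> where "\<rho> = min \<rho>0 (\<delta> * norm v)"
      have \<rho>: "\<rho> > 0" unfolding \<rho>_def min_less_iff_conj using \<rho>0(1) mult_pos_pos[OF \<delta>(1) nv] by (rule conjI)
      \<comment> \<open>The ball of radius \<rho> around \<open>x0 + T *\<^sub>R v\<close> meets the
        line exactly in the times within \<epsilon> of \<open>T\<close>; the second bound in \<rho>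
        gives \<open>\<epsilon> \<le> \<delta>\<close>.\<close>
      define \<epsilon> where "\<epsilon> = \<rho> / norm v"
      have \<epsilon>: "\<epsilon> > 0" "\<epsilon> \<le> \<delta>" using \<rho> nv by (auto simp: \<epsilon>_def \<rho>_def field_simps min_def)
      have in_B: "x0 + s *\<^sub>R v \<in> ball (x0 + T *\<^sub>R v) \<rho> \<longleftrightarrow> \<bar>s - T\<bar> < \<epsilon>" for s
      proof -
        have "dist (x0 + T *\<^sub>R v) (x0 + s *\<^sub>R v) = \<bar>s - T\<bar> * norm v"
          by (simp add: dist_norm scaleR_diff_left[symmetric] abs_minus_commute)
        then show ?thesis using nv by (simp add: \<epsilon>_def field_simps)
      qed
      have "P T''" if T': "T' \<ge> 0" "\<bar>T' - T\<bar> < \<epsilon>" "P T'" and T'': "T' \<le> T''" "T'' < T + \<epsilon>" for T' T''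
      proof -
        obtain U \<psi> where good: "good V0 \<phi>0 x0 U \<psi>" and xU: "x0 + T' *\<^sub>R v \<in> U"
          and \<psi>\<gamma>: "\<And>s. x0 + s *\<^sub>R v \<in> U \<Longrightarrow> \<psi> (x0 + s *\<^sub>R v) = \<gamma> s"
          using T'(3) unfolding P_def by metis
        obtain O0 where O0: "open O0" "x0 \<in> O0" "O0 \<subseteq> U" "\<psi> ` O0 \<subseteq> V0" "\<And>y. y \<in> O0 \<Longrightarrow> \<phi>0 (\<psi> y) = y"
          and U: "dev U \<psi>" "convex U" "x0 \<in> U" using good unfolding good_def by metis
        have T'\<delta>: "T' \<in> ball T \<delta>" using T'(2) \<epsilon>(2) by (simp add: dist_real_def abs_minus_commute)
        have "\<psi> (x0 + T' *\<^sub>R v) \<in> V" using \<delta>(2)[OF T'\<delta>] \<psi>\<gamma>[OF xU] by simp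
        from dev_chart[OF U(1) xU V(1) this] obtain e d O1 where e: "e = 1 \<or> e = -1"
          and F': "(V, \<lambda>q. flip k e d (\<phi> q)) \<in> F" and O1: "open O1" "x0 + T' *\<^sub>R v \<in> O1" "O1 \<subseteq> U" "\<psi> ` O1 \<subseteq> V"
          "\<And>y. y \<in> O1 \<Longrightarrow> flip k e d (\<phi> (\<psi> y)) = y" by metis
        \<comment> \<open>The chart at \<open>\<gamma> T\<close>, flipped so that it inverts \<psi>
          near the known time \<open>T'\<close>.\<close>
        define \<phi>' where "\<phi>' q = flip k e d (\<phi> q)" for q
        have F\<phi>': "(V, \<phi>') \<in> F" using F' unfolding \<phi>'_def[abs_def] .
        define b' where "b' = flip k e 0 b"
        have \<gamma>': "\<gamma> s \<in> V" "\<phi>' (\<gamma> s) = \<phi>' (\<gamma> T) + (s - T) *\<^sub>R b'" if "s \<in> ball T \<delta>" for s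
          using \<delta>(2)[OF that] by (auto simp: \<phi>'_def b'_def flip_affine)
        have "open ((\<lambda>s. x0 + s *\<^sub>R v) -` O1 \<inter> ball T \<delta>)"
          by (intro open_Int open_vimage O1(1) open_ball continuous_intros)
        then obtain \<eta> where \<eta>: "\<eta> > 0" "ball T' \<eta> \<subseteq> (\<lambda>s. x0 + s *\<^sub>R v) -` O1 \<inter> ball T \<delta>"
          using openE[of "(\<lambda>s. x0 + s *\<^sub>R v) -` O1 \<inter> ball T \<delta>" T'] O1(2) T'\<delta> by auto
        have line: "\<phi>' (\<gamma> T) + (s - T) *\<^sub>R b' = x0 + s *\<^sub>R v" if s: "s \<in> ball T' \<eta>" for s
        proof -
          have s1: "x0 + s *\<^sub>R v \<in> O1" "s \<in> ball T \<delta>" using \<eta>(2) s by auto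
          then have "\<phi>' (\<gamma> s) = x0 + s *\<^sub>R v" using O1(5)[OF s1(1)] \<psi>\<gamma>[of s] O1(3) by (auto simp: \<phi>'_def)
          then show ?thesis using \<gamma>'(2)[OF s1(2)] by simp
        qed
        \<comment> \<open>The coordinates of \<gamma> are affine on the whole interval around
          \<open>T\<close> and equal to \<open>x0 + s *\<^sub>R v\<close> near \<open>T'\<close>.
          Affine paths that agree on an interval coincide, so the formula holds beyond
          \<open>T'\<close>.\<close>
        have "(\<eta>/2) *\<^sub>R b' = (\<eta>/2) *\<^sub>R v"
        proof -
          have "\<phi>' (\<gamma> T) + ((T' + \<eta>/2) - T) *\<^sub>R b' - (\<phi>' (\<gamma> T) + (T' - T) *\<^sub>R b') = (x0 + (T' + \<eta>/2) *\<^sub>R v) - (x0 + T' *\<^sub>R v)"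
            using line[of T'] line[of "T' + \<eta>/2"] \<eta>(1) by (simp add: dist_real_def)
          then show ?thesis by (simp add: scaleR_add_left[symmetric] scaleR_diff_left[symmetric])
        qed
        then have b': "b' = v" using \<eta>(1) by simp
        have "\<phi>' (\<gamma> T) = x0 + T *\<^sub>R v"
          using line[of T'] \<eta>(1) unfolding b' by (simp add: algebra_simps)
        then have \<gamma>_line: "\<phi>' (\<gamma> s) = x0 + s *\<^sub>R v" if "s \<in> ball T \<delta>" for s
          using \<gamma>'(2)[OF that] unfolding b' by (simp add: algebra_simps)
        let ?B = "ball (x0 + T *\<^sub>R v) \<rho>"
        have B_img: "?B \<subseteq> \<phi>' ` V"
        proof
          fix y assume y: "y \<in> ?B"
          let ?z = "flip k e (- (e * d)) y"
          have "dist (\<phi> (\<gamma> T)) ?z = dist (flip k e d (\<phi> (\<gamma> T))) (flip k e d ?z)" by (rule dist_flip[OF e, symmetric])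
          also have "\<dots> = dist (x0 + T *\<^sub>R v) y" using \<open>\<phi>' (\<gamma> T) = x0 + T *\<^sub>R v\<close> by (simp add: \<phi>'_def flip_inverse(2)[OF e])
          finally have "?z \<in> \<phi> ` V" using y \<rho>0(2) by (auto simp: \<rho>_def)
          then obtain q where "q \<in> V" "\<phi> q = ?z" by force
          then show "y \<in> \<phi>' ` V" by (intro image_eqI[of _ _ q]) (auto simp: \<phi>'_def flip_inverse(2)[OF e])
        qed
        define \<sigma> where "\<sigma> = inv_into V \<phi>'"
        have \<sigma>: "\<sigma> (\<phi>' q) = q" if "q \<in> V" for q unfolding \<sigma>_def using inv_into_f_f[OF F_inj[OF F\<phi>'] that] .
        have dev\<sigma>: "dev ?B \<sigma>" unfolding \<sigma>_def by (rule dev_subset[OF dev_inv_into[OF F\<phi>'] open_ball B_img])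
        have UB: "open (U \<inter> ?B)" by (intro open_Int dev_open[OF U(1)] open_ball)
        have agree: "\<psi> y = \<sigma> y" if y: "y \<in> U" "y \<in> ?B" for y
        proof (rule dev_unique[of "U \<inter> ?B" _ _ "O1 \<inter> ?B"])
          show "dev (U \<inter> ?B) \<psi>" by (rule dev_subset[OF U(1) UB]) auto
          show "dev (U \<inter> ?B) \<sigma>" by (rule dev_subset[OF dev\<sigma> UB]) auto
          show "connected (U \<inter> ?B)" by (intro convex_connected convex_Int U(2) convex_ball)
          show "O1 \<inter> ?B \<noteq> {}" using O1(2) in_B[of T'] T'(2) by auto
          fix z assume z: "z \<in> O1 \<inter> ?B"
          then have "\<psi> z \<in> V" "\<phi>' (\<psi> z) = z" using O1(4,5) by (auto simp: \<phi>'_def)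
          then show "\<psi> z = \<sigma> z" using \<sigma>[of "\<psi> z"] by simp
        qed (use O1 y in auto)
        \<comment> \<open>Glueing of \<psi> with the inverse of the flipped chart; the two agree on
          the intersection of their convex domains by the identity theorem.\<close>
        define \<theta> where "\<theta> y = (if y \<in> U then \<psi> y else \<sigma> y)" for y
        have \<theta>B: "\<theta> y = \<sigma> y" if "y \<in> ?B" for y using agree that by (auto simp: \<theta>_def)
        have dev\<theta>: "dev (U \<union> ?B) \<theta>"
        proof (rule dev_local)
          fix x assume "x \<in> U \<union> ?B"
          then consider "x \<in> U" | "x \<in> ?B" by blast
          then show "\<exists>U' \<psi>'. x \<in> U' \<and> U' \<subseteq> U \<union> ?B \<and> dev U' \<psi>' \<and> (\<forall>y\<in>U'. \<theta> y = \<psi>' y)"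
          proof cases
            case 1
            then show ?thesis using U(1) by (intro exI[of _ U] exI[of _ \<psi>]) (auto simp: \<theta>_def)
          next
            case 2
            then show ?thesis using dev\<sigma> \<theta>B by (intro exI[of _ ?B] exI[of _ \<sigma>]) auto
          qed
        qed
        \<comment> \<open>The union of \<open>U\<close> and \<open>?B\<close> need not be convex. A
          convex neighbourhood of the segment inside it is the Minkowski sum of the segment with a
          small ball, whose radius comes from compactness.\<close>
        let ?K = "closed_segment x0 (x0 + T'' *\<^sub>R v)"
        have "?K \<subseteq> U \<union> ?B"
        proof
          fix y assume "y \<in> ?K"
          then obtain u where u: "0 \<le> u" "u \<le> 1" "y = (1 - u) *\<^sub>R x0 + u *\<^sub>R (x0 + T'' *\<^sub>R v)"
            by (auto simp: closed_segment_def)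
          have ys: "y = x0 + (u * T'') *\<^sub>R v" by (simp add: u(3) algebra_simps)
          have T''0: "T'' \<ge> 0" using T'(1) T''(1) by simp
          show "y \<in> U \<union> ?B"
          proof (cases "u * T'' \<le> T'")
            case True
            show ?thesis
            proof (cases "T' = 0")
              case True
              then show ?thesis using \<open>u * T'' \<le> T'\<close> u(1) T''0 ys U(3) by (metis UnI1 add.right_neutral antisym mult_nonneg_nonneg scaleR_zero_left)
            next
              case False
              then have "T' > 0" using T'(1) by simp
              have "(1 - u * T'' / T') *\<^sub>R x0 + (u * T'' / T') *\<^sub>R (x0 + T' *\<^sub>R v) \<in> U"
                by (rule convexD[OF U(2,3) xU]) (use True u T''0 \<open>T' > 0\<close> in \<open>auto simp: field_simps\<close>)
              then show ?thesis using \<open>T' > 0\<close> by (simp add: ys algebra_simps)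
            qed
          next
            case False
            have "u * T'' \<le> T''" using u T''0 by (simp add: mult_left_le_one_le)
            then have "\<bar>u * T'' - T\<bar> < \<epsilon>" using False T'(2) T''(2) by linarith
            then show ?thesis using in_B ys by blast
          qed
        qed
        moreover have "compact ?K" by simp
        moreover have "open (U \<union> ?B)" using dev_open[OF U(1)] by (intro open_Un open_ball)
        ultimately obtain r where r: "r > 0" "(\<Union>x\<in>?K. cball x r) \<subseteq> U \<union> ?B"
          using compact_subset_open_imp_cball_epsilon_subset by metis
        define N where "N = (\<Union>x\<in>?K. \<Union>y\<in>ball 0 r. {x + y})"
        have N_conv: "convex N" unfolding N_def by (intro convex_sums convex_closed_segment convex_ball)
        have N_balls: "N = (\<Union>x\<in>?K. ball x r)"
        proof -
          have "(\<Union>y\<in>ball 0 r. {x + y}) = ball x r" for x :: "real^'n"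
          proof -
            have "z \<in> (\<Union>y\<in>ball 0 r. {x + y})" if "z \<in> ball x r" for z
              using that by (intro UN_I[of "z - x"]) (auto simp: dist_norm norm_minus_commute)
            then show ?thesis by (auto simp: dist_norm)
          qed
          then show ?thesis by (simp add: N_def)
        qed
        have N: "open N" "N \<subseteq> U \<union> ?B" "x0 \<in> N" "x0 + T'' *\<^sub>R v \<in> N"
        proof -
          show "open N" unfolding N_balls by (intro open_UN ballI open_ball)
          show "N \<subseteq> U \<union> ?B" unfolding N_balls
            by (rule order_trans[OF UN_mono[OF order_refl ball_subset_cball] r(2)])
          show "x0 \<in> N" unfolding N_balls using r(1) by (intro UN_I[of x0]) auto
          show "x0 + T'' *\<^sub>R v \<in> N" unfolding N_balls using r(1) by (intro UN_I[of "x0 + T'' *\<^sub>R v"]) auto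
        qed
        have "good V0 \<phi>0 x0 N \<theta>"
          unfolding good_def
        proof (intro conjI N_conv N exI[of _ "O0 \<inter> N"])
          show "dev N \<theta>" by (rule dev_subset[OF dev\<theta> N(1,2)])
          show "open (O0 \<inter> N)" by (intro open_Int O0(1) N(1))
        qed (use O0 N in \<open>auto simp: \<theta>_def subset_iff\<close>)
        moreover have "\<theta> (x0 + s *\<^sub>R v) = \<gamma> s" if s: "x0 + s *\<^sub>R v \<in> N" for s
        proof (cases "x0 + s *\<^sub>R v \<in> U")
          case True
          then show ?thesis using \<psi>\<gamma> by (simp add: \<theta>_def)
        next
          case False
          then have "x0 + s *\<^sub>R v \<in> ?B" using s N(2) by blast
          then have "\<bar>s - T\<bar> < \<epsilon>" unfolding in_B .
          then have "s \<in> ball T \<delta>" using \<epsilon>(2) by (simp add: dist_real_def abs_minus_commute)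
          then have "\<gamma> s \<in> V" "\<phi>' (\<gamma> s) = x0 + s *\<^sub>R v" using \<gamma>'(1) \<gamma>_line by auto
          then show ?thesis using False \<sigma>[of "\<gamma> s"] by (simp add: \<theta>_def)
        qed
        ultimately show "P T''" unfolding P_def using N(4) by blast
      qed
      then show ?thesis using \<epsilon>(1) by blast
    qed
    ultimately have "P 1" by (rule real_interval_progress)
    then show ?thesis unfolding P_def by auto
  qed
qed

text \<open>Every point lies on a ray from the initial point, and \<open>good_unique\<close> makes
  the choice of continuation immaterial, so the continuations along all rays fit together.\<close>

lemma developing_map_exists:
  assumes "topspace X \<noteq> {}"
  obtains \<Phi> where "dev UNIV \<Phi>"
proof -
  obtain p0 V0 \<phi>0 where F: "(V0, \<phi>0) \<in> F" "p0 \<in> V0" using assms F_cover by blast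
  let ?good = "good V0 \<phi>0 (\<phi>0 p0)"
  have ex: "\<exists>U \<psi>. ?good U \<psi> \<and> x \<in> U" for x
    using good_exists[OF F refl, of "x - \<phi>0 p0"] by simp
  define \<Phi> where "\<Phi> x = (SOME q. \<exists>U \<psi>. ?good U \<psi> \<and> x \<in> U \<and> q = \<psi> x)" for x
  have \<Phi>: "\<Phi> x = \<psi> x" if good: "?good U \<psi>" "x \<in> U" for U \<psi> x
  proof -
    have "\<exists>U' \<psi>'. ?good U' \<psi>' \<and> x \<in> U' \<and> \<Phi> x = \<psi>' x"
      unfolding \<Phi>_def by (rule someI_ex) (use good in blast)
    then obtain U' \<psi>' where "?good U' \<psi>'" "x \<in> U'" "\<Phi> x = \<psi>' x" by metis
    then show ?thesis using good_unique[OF F(1) good(1) _ good(2)] by simp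
  qed
  have "dev UNIV \<Phi>"
  proof (rule dev_local)
    fix x :: "real^'n"
    obtain U \<psi> where "?good U \<psi>" "x \<in> U" using ex by metis
    then show "\<exists>U' \<psi>'. x \<in> U' \<and> U' \<subseteq> UNIV \<and> dev U' \<psi>' \<and> (\<forall>y\<in>U'. \<Phi> y = \<psi>' y)"
      using \<Phi> by (intro exI[of _ U] exI[of _ \<psi>]) (auto simp: good_def)
  qed
  then show ?thesis using that by blast
qed

section \<open>Surjectivity and fibres of the developing map\<close>

text \<open>Near a point mapped into \<open>V\<close>, \<Phi> coincides with the inverse of the
  suitably flipped chart; by the identity theorem it does so on the whole connected image of the
  chart.\<close>

lemma dev_extend:
  assumes \<Phi>: "dev UNIV \<Phi>" and F: "(V, \<phi>) \<in> F" and conn: "connected (\<phi> ` V)" and x: "\<Phi> x \<in> V"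
  shows "V \<subseteq> range \<Phi>"
proof -
  from dev_chart[OF \<Phi> UNIV_I F x] obtain \<epsilon> d O1 where e: "\<epsilon> = 1 \<or> \<epsilon> = -1"
    and F'0: "(V, \<lambda>q. flip k \<epsilon> d (\<phi> q)) \<in> F" and O1: "open O1" "x \<in> O1" "\<Phi> ` O1 \<subseteq> V"
    "\<And>y. y \<in> O1 \<Longrightarrow> flip k \<epsilon> d (\<phi> (\<Phi> y)) = y" by metis
  define \<phi>' where "\<phi>' q = flip k \<epsilon> d (\<phi> q)" for q
  have F': "(V, \<phi>') \<in> F" using F'0 unfolding \<phi>'_def[abs_def] .
  let ?U = "\<phi>' ` V" and ?\<sigma> = "inv_into V \<phi>'"
  have "?U = flip k \<epsilon> d ` (\<phi> ` V)" by (auto simp: \<phi>'_def)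
  then have U: "connected ?U" using connected_continuous_image[OF continuous_on_flip conn] by simp
  have O_img: "O1 \<subseteq> ?U"
  proof
    fix y assume "y \<in> O1"
    then show "y \<in> ?U" using O1(3,4) by (intro image_eqI[of _ _ "\<Phi> y"]) (auto simp: \<phi>'_def)
  qed
  show ?thesis
  proof
    fix q assume q: "q \<in> V"
    have "\<Phi> (\<phi>' q) = ?\<sigma> (\<phi>' q)"
    proof (rule dev_unique[of ?U _ _ O1])
      show "dev ?U \<Phi>" by (rule dev_subset[OF \<Phi> F_img[OF F']]) simp
      show "dev ?U ?\<sigma>" by (rule dev_inv_into[OF F'])
      fix y assume y: "y \<in> O1"
      then have V: "\<Phi> y \<in> V" and eq: "\<phi>' (\<Phi> y) = y" using O1 by (auto simp: \<phi>'_def)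
      from inv_into_f_f[OF F_inj[OF F'] V] show "\<Phi> y = ?\<sigma> y" by (simp add: eq)
    qed (use U O1 O_img q in auto)
    then have "\<Phi> (\<phi>' q) = q" using inv_into_f_f[OF F_inj[OF F'] q] by simp
    then show "q \<in> range \<Phi>" by (metis rangeI)
  qed
qed

text \<open>By \<open>dev_extend\<close> a chart with a ball as image is either contained in the
  range or disjoint from it, so membership in the range is locally constant.\<close>

lemma dev_surj:
  assumes \<Phi>: "dev UNIV \<Phi>" and conn: "connected_space X"
  shows "range \<Phi> = topspace X"
proof -
  have sub: "range \<Phi> \<subseteq> topspace X" using dev_topspace[OF \<Phi>] by auto
  have nbhd: "\<exists>V. openin X V \<and> p \<in> V \<and> (V \<subseteq> range \<Phi> \<or> V \<inter> range \<Phi> = {})" if p: "p \<in> topspace X" for p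
  proof -
    obtain V \<phi> where V: "(V, \<phi>) \<in> F" "p \<in> V" using F_cover[OF p] by blast
    obtain V' r where V': "(V', \<phi>) \<in> F" "p \<in> V'" "\<phi> ` V' = ball (\<phi> p) r"
      using F_ball[OF V] by metis
    have "connected (\<phi> ` V')" unfolding V'(3) by (intro convex_connected convex_ball)
    then have "V' \<subseteq> range \<Phi> \<or> V' \<inter> range \<Phi> = {}" using dev_extend[OF \<Phi> V'(1)] by blast
    then show ?thesis using F_open[OF V'(1)] V'(2) by blast
  qed
  have "\<exists>U. openin X U \<and> p \<in> U \<and> (\<forall>q\<in>U. (q \<in> range \<Phi>) = (p \<in> range \<Phi>))" if "p \<in> topspace X" for p
    using nbhd[OF that] by (elim exE conjE) (rule exI, blast)
  note const = locally_constant_on_connected_space[OF conn this]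
  have "q \<in> range \<Phi>" if "q \<in> topspace X" for q
    using const[of "\<Phi> 0" q] that dev_topspace[OF \<Phi>, of 0] by simp
  then show ?thesis using sub by blast
qed

text \<open>Precomposition with a flip is compensated by postcomposing the charts with the inverse
  flip.\<close>

lemma dev_flip:
  assumes \<Phi>: "dev UNIV \<Phi>" and e: "\<epsilon> = 1 \<or> \<epsilon> = -1"
  shows "dev UNIV (\<lambda>x. \<Phi> (flip k \<epsilon> d x))"
proof (rule devI)
  fix x :: "real^'n"
  from devE[OF \<Phi> UNIV_I, of "flip k \<epsilon> d x"] obtain V \<phi> O' where
    *: "(V, \<phi>) \<in> F" "open O'" "flip k \<epsilon> d x \<in> O'" "\<Phi> ` O' \<subseteq> V" "\<And>y. y \<in> O' \<Longrightarrow> \<phi> (\<Phi> y) = y" by metis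
  have "open (flip k \<epsilon> d -` O')"
    by (rule open_vimage[OF *(2) continuous_on_flip])
  moreover have "(V, \<lambda>p. flip k \<epsilon> (- (\<epsilon> * d)) (\<phi> p)) \<in> F" by (rule F_flip[OF *(1) e])
  ultimately show "\<exists>V \<phi> O'. (V, \<phi>) \<in> F \<and> open O' \<and> x \<in> O' \<and> O' \<subseteq> UNIV \<and> (\<lambda>x. \<Phi> (flip k \<epsilon> d x)) ` O' \<subseteq> V \<and>
      (\<forall>y\<in>O'. \<phi> (\<Phi> (flip k \<epsilon> d y)) = y)"
    using * flip_inverse(1)[OF e]
    by (intro exI[of _ V] exI[of _ "\<lambda>p. flip k \<epsilon> (- (\<epsilon> * d)) (\<phi> p)"] exI[of _ "flip k \<epsilon> d -` O'"]) auto
qed simp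

lemma dev_locally_inj:
  assumes "dev UNIV \<Phi>"
  obtains O' where "open O'" "x \<in> O'" "inj_on \<Phi> O'"
proof -
  from devE[OF assms UNIV_I, of x] obtain V \<phi> O' where
    *: "(V, \<phi>) \<in> F" "open O'" "x \<in> O'" "\<Phi> ` O' \<subseteq> V" "\<And>y. y \<in> O' \<Longrightarrow> \<phi> (\<Phi> y) = y" by metis
  have "inj_on \<Phi> O'" by (rule inj_on_inverseI[of _ \<phi>]) (use *(5) in auto)
  then show ?thesis using that * by blast
qed

text \<open>The deck transformation relating \<open>x\<close> and \<open>y\<close> cannot be a reflection, since \<open>\<Phi>\<close> is locally
  injective at the fixed points of a reflection.\<close>

lemma dev_fibre:
  assumes \<Phi>: "dev UNIV \<Phi>" and eq: "\<Phi> x = \<Phi> y"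
  obtains d where "y = flip k 1 d x" "\<And>z. \<Phi> (flip k 1 d z) = \<Phi> z"
proof -
  from devE[OF \<Phi> UNIV_I, of x] obtain V \<phi> O1 where
    *: "(V, \<phi>) \<in> F" "open O1" "x \<in> O1" "\<Phi> ` O1 \<subseteq> V" "\<And>z. z \<in> O1 \<Longrightarrow> \<phi> (\<Phi> z) = z" by metis
  have "\<Phi> y \<in> V" using * eq by auto
  from dev_chart[OF \<Phi> UNIV_I *(1) this] obtain \<epsilon> d O2 where e: "\<epsilon> = 1 \<or> \<epsilon> = -1"
    and O2: "open O2" "y \<in> O2" "\<Phi> ` O2 \<subseteq> V" "\<And>z. z \<in> O2 \<Longrightarrow> flip k \<epsilon> d (\<phi> (\<Phi> z)) = z" by metis
  let ?A = "flip k \<epsilon> d"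
  have y: "?A x = y" using O2(4)[OF O2(2)] *(5)[OF *(3)] eq by simp
  have op: "open (?A -` S)" if "open S" for S
    by (rule open_vimage[OF that continuous_on_flip])
  \<comment> \<open>Near \<open>x\<close> both sides lie in \<open>V\<close> and have the same
    coordinates; the identity theorem extends the equality to all of R^n, so the local transition is
    a deck transformation.\<close>
  have inv: "\<Phi> (?A z) = \<Phi> z" for z
  proof (rule dev_unique[of UNIV _ _ "O1 \<inter> ?A -` O2"])
    show "dev UNIV (\<lambda>z. \<Phi> (?A z))" by (rule dev_flip[OF \<Phi> e])
    show "open (O1 \<inter> ?A -` O2)" using *(2) op[OF O2(1)] by (rule open_Int)
    show "O1 \<inter> ?A -` O2 \<noteq> {}" using *(3) O2(2) y by auto
    fix w assume w: "w \<in> O1 \<inter> ?A -` O2"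
    then have "?A (\<phi> (\<Phi> (?A w))) = ?A w" using O2(4) by auto
    then have "\<phi> (\<Phi> (?A w)) = w" using flip_inverse(1)[OF e] by metis
    moreover have "\<Phi> (?A w) \<in> V" "\<Phi> w \<in> V" "\<phi> (\<Phi> w) = w" using w O2(3) *(4,5) by auto
    ultimately show "\<Phi> (?A w) = \<Phi> w" using inj_onD[OF F_inj[OF *(1)], of "\<Phi> (?A w)" "\<Phi> w"] by simp
  qed (use \<Phi> in auto)
  have "\<epsilon> \<noteq> -1"
  proof
    assume e1: "\<epsilon> = -1"
    \<comment> \<open>A point of the fixed hyperplane: the reflection sends coordinate
      \<open>k\<close> to \<open>d\<close> minus itself and therefore fixes
      \<open>d / 2\<close>.\<close>
    define z0 where "z0 = (\<chi> a. if a = k then d / 2 else x $ a)"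
    have z0: "?A z0 = z0" using e1 by (auto simp: vec_eq_iff flip_nth z0_def)
    obtain O' where O': "open O'" "z0 \<in> O'" "inj_on \<Phi> O'" by (rule dev_locally_inj[OF \<Phi>])
    have "\<epsilon> = 1 \<and> d = 0"
    proof (rule flip_fix_open[OF open_Int[OF O'(1) op[OF O'(1)]]])
      show "z0 \<in> O' \<inter> ?A -` O'" using O' z0 by auto
      fix w assume "w \<in> O' \<inter> ?A -` O'"
      then show "?A w = w" using inj_onD[OF O'(3) inv[of w]] by auto
    qed
    then show False using e1 by simp
  qed
  then have "\<epsilon> = 1" using e by blast
  then show ?thesis using that[of d] y inv by auto
qed

theorem developing_map:
  assumes ne: "topspace X \<noteq> {}" and conn: "connected_space X"
  obtains \<Phi> where "dev UNIV \<Phi>" "range \<Phi> = topspace X" "inj \<Phi>"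
  | \<Phi> T where "dev UNIV \<Phi>" "range \<Phi> = topspace X" "T > 0"
    "\<And>x y. \<Phi> x = \<Phi> y \<longleftrightarrow> (\<exists>m::int. y = flip k 1 (of_int m * T) x)"
proof -
  obtain \<Phi> where \<Phi>: "dev UNIV \<Phi>" by (rule developing_map_exists[OF ne])
  \<comment> \<open>The group of deck translations, identified with a subgroup of the real line
    through the shift of coordinate \<open>k\<close>.\<close>
  define L where "L = {d. \<forall>z. \<Phi> (flip k 1 d z) = \<Phi> z}"
  have flip_add: "flip k 1 a (flip k 1 b z) = flip k 1 (a + b) z" for a b :: real and z :: "real^'n"
    by (simp add: vec_eq_iff flip_nth)
  have fib: "\<Phi> x = \<Phi> y \<longleftrightarrow> (\<exists>d\<in>L. y = flip k 1 d x)" for x y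
  proof
    assume "\<Phi> x = \<Phi> y"
    then obtain d where "y = flip k 1 d x" "\<And>z. \<Phi> (flip k 1 d z) = \<Phi> z" by (rule dev_fibre[OF \<Phi>]) blast
    then show "\<exists>d\<in>L. y = flip k 1 d x" by (auto simp: L_def)
  qed (auto simp: L_def)
  show ?thesis
  proof (cases "L \<subseteq> {0}")
    case True
    have "inj \<Phi>"
    proof (rule injI)
      fix x y assume "\<Phi> x = \<Phi> y"
      then obtain d where "d \<in> L" "y = flip k 1 d x" using fib by blast
      then show "x = y" using True by (auto simp: vec_eq_iff flip_nth)
    qed
    then show ?thesis using that(1)[OF \<Phi> dev_surj[OF \<Phi> conn]] by blast
  next
    case False
    then obtain a where a: "a \<in> L" "a \<noteq> 0" by blast
    have diff: "b - c \<in> L" if "b \<in> L" "c \<in> L" for b c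
    proof -
      have "\<Phi> (flip k 1 (b - c) z) = \<Phi> z" for z
      proof -
        have "\<Phi> z = \<Phi> (flip k 1 b z)" using that(1) by (simp add: L_def)
        also have "flip k 1 b z = flip k 1 c (flip k 1 (b - c) z)" by (simp add: flip_add)
        also have "\<Phi> \<dots> = \<Phi> (flip k 1 (b - c) z)" using that(2) by (simp add: L_def)
        finally show ?thesis by simp
      qed
      then show ?thesis by (simp add: L_def)
    qed
    obtain O' where O': "open O'" "0 \<in> O'" "inj_on \<Phi> O'" by (rule dev_locally_inj[OF \<Phi>])
    obtain \<delta> where \<delta>: "\<delta> > 0" "ball 0 \<delta> \<subseteq> O'" using O' openE by blast
    \<comment> \<open>A shift of the origin by less than \<delta> stays in the ball on which \<Phi>
      is injective, so the group is discrete.\<close>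
    have disc: "d = 0" if d: "d \<in> L" "\<bar>d\<bar> < \<delta>" for d
    proof -
      let ?a = "d *\<^sub>R axis k 1 :: real^'n"
      have "flip k 1 d 0 = ?a" by (simp add: vec_eq_iff flip_nth axis_def)
      then have "\<Phi> ?a = \<Phi> 0" using d(1) unfolding L_def by (metis (mono_tags, lifting) mem_Collect_eq)
      moreover have "norm ?a < \<delta>" using d(2) by simp
      then have "?a \<in> O'" using \<delta>(2) by (auto simp: subset_iff)
      ultimately have "?a = 0" using inj_onD[OF O'(3)] O'(2) by blast
      then show ?thesis by (simp add: axis_eq_0_iff)
    qed
    obtain T where T: "T > 0" "L = range (\<lambda>m::int. of_int m * T)"
      by (rule discrete_real_subgroup[OF diff \<delta>(1) disc a])
    show ?thesis
      by (rule that(2)[OF \<Phi> dev_surj[OF \<Phi> conn] T(1)]) (auto simp: fib T(2))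
  qed
qed

end

section \<open>Functions with vanishing Hessian\<close>

lemma cgrad_linear_comb:
  assumes "f differentiable (at y)" "g differentiable (at y)"
  shows "cgrad (\<lambda>x. a * f x + b * g x) y = a *\<^sub>R cgrad f y + b *\<^sub>R cgrad g y"
proof -
  have "((\<lambda>x. a * f x + b * g x) has_derivative
      (\<lambda>v. a * frechet_derivative f (at y) v + b * frechet_derivative g (at y) v)) (at y)"
    using assms unfolding frechet_derivative_works by (auto intro!: derivative_eq_intros)
  from frechet_derivative_at[OF this, symmetric] show ?thesis
    by (simp add: cgrad_def partial_def vec_eq_iff)
qed

lemma parallel_form_linear_comb:
  assumes "open S" "parallel_form M c S \<alpha>" "parallel_form M c S \<beta>"
  shows "parallel_form M c S (\<lambda>y. a *\<^sub>R \<alpha> y + b *\<^sub>R \<beta> y)"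
  unfolding parallel_form_def
proof (intro conjI ballI allI)
  show "smooth_on S (\<lambda>y. a *\<^sub>R \<alpha> y + b *\<^sub>R \<beta> y)"
    unfolding smooth_on_def
    by (intro allI Ck_on_add Ck_on_scaleR Ck_on_const assms(1))
      (use assms(2,3) in \<open>auto simp: parallel_form_def smooth_on_def\<close>)
  fix y l assume y: "y \<in> S"
  have "(\<alpha> has_derivative frechet_derivative \<alpha> (at y)) (at y)" "(\<beta> has_derivative frechet_derivative \<beta> (at y)) (at y)"
    using assms y smooth_on_has_derivative unfolding parallel_form_def by blast+
  then have "((\<lambda>y. a *\<^sub>R \<alpha> y + b *\<^sub>R \<beta> y) has_derivative
      (\<lambda>v. a *\<^sub>R frechet_derivative \<alpha> (at y) v + b *\<^sub>R frechet_derivative \<beta> (at y) v)) (at y)"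
    by (auto intro!: derivative_eq_intros)
  from frechet_derivative_at[OF this, symmetric]
  show "frechet_derivative (\<lambda>y. a *\<^sub>R \<alpha> y + b *\<^sub>R \<beta> y) (at y) (axis l 1) = conn M c y l *v (a *\<^sub>R \<alpha> y + b *\<^sub>R \<beta> y)"
    using assms(2,3) y by (simp add: parallel_form_def matrix_vector_right_distrib matrix_vector_mult_scaleR)
qed

lemma parallel_form_cong:
  assumes S: "open S" and eq: "\<And>y. y \<in> S \<Longrightarrow> \<alpha> y = \<beta> y" and \<beta>: "parallel_form M c S \<beta>"
  shows "parallel_form M c S \<alpha>"
  unfolding parallel_form_def
proof (intro conjI ballI allI)
  show "smooth_on S \<alpha>" unfolding smooth_on_def
    by (intro allI Ck_on_eqI[OF S _ eq]) (use \<beta> in \<open>simp add: parallel_form_def smooth_on_def\<close>)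
  fix y l assume y: "y \<in> S"
  then show "frechet_derivative \<alpha> (at y) (axis l 1) = conn M c y l *v \<alpha> y"
    using frechet_derivative_cong_open[OF S y eq] \<beta> by (simp add: parallel_form_def eq)
qed

lemma parallel_form_subset: "parallel_form M c S \<alpha> \<Longrightarrow> T \<subseteq> S \<Longrightarrow> parallel_form M c T \<alpha>"
  unfolding parallel_form_def using smooth_on_subset by blast

lemma flat_coords_cong:
  assumes S: "open S" and eq: "\<And>y. y \<in> S \<Longrightarrow> u y = u' y" and u': "flat_coords M c S u'"
  shows "flat_coords M c S u"
  unfolding flat_coords_def
proof (intro conjI ballI allI)
  show "smooth_on S u" unfolding smooth_on_def
    by (intro allI Ck_on_eqI[OF S _ eq]) (use u' in \<open>simp add: flat_coords_def smooth_on_def\<close>)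
  fix y i j assume y: "y \<in> S"
  then show "gmat M c y $ i $ j = frechet_derivative u (at y) (axis i 1) \<bullet> frechet_derivative u (at y) (axis j 1)"
    using frechet_derivative_cong_open[OF S y eq] u' by (simp add: flat_coords_def)
qed

context riemannian
begin

text \<open>The equations of \<open>W_e\<close> without the condition off the manifold, so that
  ordinary constants qualify and local descriptions are enough.\<close>

definition affine_fn :: "('a \<Rightarrow> real) \<Rightarrow> bool" where
  "affine_fn w \<longleftrightarrow> (\<forall>c\<in>atlas M. smooth_on (cran c) (w \<circ> cinv c) \<and> parallel_form M c (cran c) (cgrad (w \<circ> cinv c)))"

lemma W_e_iff: "w \<in> W_e M \<longleftrightarrow> (\<forall>p. p \<notin> topspace X \<longrightarrow> w p = 0) \<and> affine_fn w"
proof -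
  define Z where "Z c \<longleftrightarrow> (\<forall>y\<in>cran c. \<forall>i j. hessian M c w y i j = 0)" for c
  have "Z c \<longleftrightarrow> parallel_form M c (cran c) (cgrad (w \<circ> cinv c))"
    if c: "c \<in> atlas M" and sm: "smooth_on (cran c) (w \<circ> cinv c)" for c
  proof -
    interpret riem_chart M c using riem_chart[OF c] .
    show ?thesis
      unfolding Z_def parallel_form_iff[OF open_cran smooth_on_cgrad[OF open_cran sm]]
      by (simp add: hessian_def cov_deriv_form_def differential_form_def cgrad_def)
  qed
  moreover have "w \<in> W_e M \<longleftrightarrow> (\<forall>p. p \<notin> topspace X \<longrightarrow> w p = 0) \<and>
      (\<forall>c\<in>atlas M. smooth_on (cran c) (w \<circ> cinv c)) \<and> (\<forall>c\<in>atlas M. Z c)"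
    by (simp add: W_e_def Z_def)
  ultimately show ?thesis unfolding affine_fn_def by blast
qed

lemma affine_fn_linear_comb:
  assumes "affine_fn u" "affine_fn w"
  shows "affine_fn (\<lambda>p. a * u p + b * w p)"
  unfolding affine_fn_def
proof (intro ballI conjI)
  fix c assume c: "c \<in> atlas M"
  have o: "open (cran c)" by (rule open_cran[OF c])
  have sm: "smooth_on (cran c) (u \<circ> cinv c)" "smooth_on (cran c) (w \<circ> cinv c)"
    and par: "parallel_form M c (cran c) (cgrad (u \<circ> cinv c))" "parallel_form M c (cran c) (cgrad (w \<circ> cinv c))"
    using assms c unfolding affine_fn_def by blast+
  have eq: "(\<lambda>p. a * u p + b * w p) \<circ> cinv c = (\<lambda>y. a * (u \<circ> cinv c) y + b * (w \<circ> cinv c) y)" by auto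
  show "smooth_on (cran c) ((\<lambda>p. a * u p + b * w p) \<circ> cinv c)"
    unfolding eq smooth_on_def
    by (intro allI Ck_on_add Ck_on_mult Ck_on_const o smooth_onD[OF sm(1)] smooth_onD[OF sm(2)])
  have cg: "cgrad (\<lambda>y. a * (u \<circ> cinv c) y + b * (w \<circ> cinv c) y) y =
      a *\<^sub>R cgrad (u \<circ> cinv c) y + b *\<^sub>R cgrad (w \<circ> cinv c) y" if "y \<in> cran c" for y
    by (rule cgrad_linear_comb) (use smooth_on_has_derivative[OF sm(1) that] smooth_on_has_derivative[OF sm(2) that] differentiableI in blast)+
  show "parallel_form M c (cran c) (cgrad ((\<lambda>p. a * u p + b * w p) \<circ> cinv c))"
    unfolding eq by (rule parallel_form_cong[OF o cg parallel_form_linear_comb[OF o par]])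
qed

lemma affine_fn_cong:
  assumes eq: "\<And>p. p \<in> topspace X \<Longrightarrow> w p = w' p" and "affine_fn w'"
  shows "affine_fn w"
  unfolding affine_fn_def
proof (intro ballI conjI)
  fix c assume c: "c \<in> atlas M"
  have o: "open (cran c)" by (rule open_cran[OF c])
  have eq': "(w \<circ> cinv c) y = (w' \<circ> cinv c) y" if "y \<in> cran c" for y
    using that eq cdom_subset[OF c] by (auto simp: cinv_cmap[OF c])
  have w': "smooth_on (cran c) (w' \<circ> cinv c)" "parallel_form M c (cran c) (cgrad (w' \<circ> cinv c))"
    using assms(2) c unfolding affine_fn_def by blast+
  show "smooth_on (cran c) (w \<circ> cinv c)"
    unfolding smooth_on_def by (intro allI Ck_on_eqI[OF o smooth_onD[OF w'(1)] eq'])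
  have "cgrad (w \<circ> cinv c) y = cgrad (w' \<circ> cinv c) y" if "y \<in> cran c" for y
  proof -
    have "frechet_derivative (w \<circ> cinv c) (at y) = frechet_derivative (w' \<circ> cinv c) (at y)"
      by (rule frechet_derivative_cong_open[OF o that eq'])
    then show ?thesis by (simp add: cgrad_def partial_def)
  qed
  then show "parallel_form M c (cran c) (cgrad (w \<circ> cinv c))"
    by (rule parallel_form_cong[OF o _ w'(2)])
qed

text \<open>The constant function 1 in the encoding of \<open>W_e\<close>, where functions vanish
  off the manifold.\<close>

definition one_fn :: "'a \<Rightarrow> real" where
  "one_fn p = (if p \<in> topspace X then 1 else 0)"

lemma affine_fn_const: "affine_fn (\<lambda>p. a)"
  unfolding affine_fn_def
proof (intro ballI conjI)
  fix c assume c: "c \<in> atlas M"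
  have 1: "(\<lambda>p. a) \<circ> cinv c = (\<lambda>y. a)" by auto
  have 2: "cgrad (\<lambda>y. a) = (\<lambda>y. 0)" by (auto simp: cgrad_def partial_def vec_eq_iff frechet_derivative_const)
  show "smooth_on (cran c) ((\<lambda>p. a) \<circ> cinv c)" "parallel_form M c (cran c) (cgrad ((\<lambda>p. a) \<circ> cinv c))"
    unfolding 1 2 by (simp_all add: smooth_on_def Ck_on_const parallel_form_def frechet_derivative_const)
qed

lemma one_fn_W_e: "one_fn \<in> W_e M"
  unfolding W_e_iff using affine_fn_cong[of one_fn "\<lambda>p. 1"] affine_fn_const by (auto simp: one_fn_def)

lemma W_e_linear_comb: "u \<in> W_e M \<Longrightarrow> w \<in> W_e M \<Longrightarrow> (\<lambda>p. a * u p + b * w p) \<in> W_e M"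
  unfolding W_e_iff using affine_fn_linear_comb by auto

lemma affine_fn_differentiable:
  assumes "affine_fn w" "c \<in> atlas M" "y \<in> cran c"
  shows "(w \<circ> cinv c) differentiable (at y)"
proof -
  have "smooth_on (cran c) (w \<circ> cinv c)" using assms(1,2) by (simp add: affine_fn_def)
  from smooth_on_has_derivative[OF this assms(3)] show ?thesis by (rule differentiableI)
qed

section \<open>The inner product of differentials\<close>

definition cpair :: "('a, 'n) chart \<Rightarrow> ('a \<Rightarrow> real) \<Rightarrow> ('a \<Rightarrow> real) \<Rightarrow> 'a \<Rightarrow> real" where
  "cpair c u w p = pairing M c (cgrad (u \<circ> cinv c)) (cgrad (w \<circ> cinv c)) (cmap c p)"

text \<open>The metric comes with a pullback law for vectors, so the raised covector
  \<open>?x\<close> of \<open>w\<close> in the chart \<open>d\<close> is pushed to \<open>c\<close>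
  by the transition derivative \<open>?L\<close> and compared with the raised covector there. The
  residual \<open>?r\<close> is orthogonal to every \<open>?L v\<close>, and \<open>?L\<close> is
  onto, so \<open>?r\<close> is orthogonal to itself.\<close>

lemma cpair_chart_independent:
  assumes u: "affine_fn u" and w: "affine_fn w" and c: "c \<in> atlas M" and d: "d \<in> atlas M"
    and p: "p \<in> cdom c" "p \<in> cdom d"
  shows "cpair d u w p = cpair c u w p"
proof -
  interpret C: riem_chart M c using riem_chart[OF c] .
  interpret D: riem_chart M d using riem_chart[OF d] .
  let ?y = "cmap c p" and ?z = "cmap d p"
  have y: "?y \<in> cran c" and z: "?z \<in> cran d" using p by auto
  let ?L = "frechet_derivative (cmap c \<circ> cinv d) (at ?z)"
  have "(cmap c \<circ> cinv d) differentiable (at ?z)"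
    using smooth_on_has_derivative[OF smooth_transition[OF d c]] p differentiableI by blast
  then have L: "linear ?L" by (rule linear_frechet_derivative)
  have g: "v \<bullet> (gmat M d ?z *v v') = ?L v \<bullet> (gmat M c ?y *v ?L v')" for v v'
    by (rule gmat_transition[OF d c p(2,1)])
  have cg: "cgrad (f \<circ> cinv d) ?z \<bullet> v = cgrad (f \<circ> cinv c) ?y \<bullet> ?L v" if f: "affine_fn f" for f v
  proof -
    have sm: "smooth_on (cran c) (f \<circ> cinv c)" using f c by (simp add: affine_fn_def)
    show ?thesis
      unfolding frechet_eq_cgrad[OF affine_fn_differentiable[OF f d z], symmetric]
        frechet_eq_cgrad[OF affine_fn_differentiable[OF f c y], symmetric]
      by (rule comp_transition[OF c d p open_cran[OF c] y sm])
  qed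
  have "inj ?L"
  proof (rule linear_injective_0[OF L, THEN iffD2], intro allI impI)
    fix v assume "?L v = 0"
    then have "v \<bullet> (gmat M d ?z *v v) = 0" using g[of v v] by simp
    then show "v = 0" using D.pos_gmat[OF z, of v] by force
  qed
  then have surj: "surj ?L" using linear_injective_imp_surjective[OF L] by blast
  let ?x = "matrix_inv (gmat M d ?z) *v cgrad (w \<circ> cinv d) ?z"
  have "gmat M c ?y *v ?L ?x - cgrad (w \<circ> cinv c) ?y = 0" (is "?r = 0")
  proof -
    obtain v where v: "?L v = ?r" using surj by (metis surjD)
    have "?L v \<bullet> (gmat M c ?y *v ?L ?x) = v \<bullet> cgrad (w \<circ> cinv d) ?z"
      using g[of v ?x] D.G_H[OF z] by simp
    also have "\<dots> = ?L v \<bullet> cgrad (w \<circ> cinv c) ?y" using cg[OF w, of v] by (simp add: inner_commute)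
    finally have "?L v \<bullet> ?r = 0" by (simp add: inner_diff_right)
    then show ?thesis unfolding v by (simp only: inner_eq_zero_iff)
  qed
  then have "?L ?x = matrix_inv (gmat M c ?y) *v cgrad (w \<circ> cinv c) ?y"
    using C.H_G[OF y, of "?L ?x"] by simp
  then show ?thesis unfolding cpair_def pairing_def using cg[OF u, of ?x] by simp
qed

text \<open>The chart is chosen arbitrarily; \<open>cpair_chart_independent\<close> makes the value
  canonical on affine functions.\<close>

definition mpair :: "('a \<Rightarrow> real) \<Rightarrow> ('a \<Rightarrow> real) \<Rightarrow> 'a \<Rightarrow> real" where
  "mpair u w p = cpair (SOME c. c \<in> atlas M \<and> p \<in> cdom c) u w p"

lemma mpair_eq:
  assumes "affine_fn u" "affine_fn w" "c \<in> atlas M" "p \<in> cdom c"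
  shows "mpair u w p = cpair c u w p"
proof -
  let ?d = "SOME c. c \<in> atlas M \<and> p \<in> cdom c"
  have d: "?d \<in> atlas M \<and> p \<in> cdom ?d" by (rule someI[of _ c]) (use assms in blast)
  then show ?thesis unfolding mpair_def using cpair_chart_independent[OF assms(1,2,3) _ assms(4)] by blast
qed

lemma mpair_sym:
  assumes "affine_fn u" "affine_fn w" "p \<in> topspace X"
  shows "mpair u w p = mpair w u p"
proof -
  obtain c where c: "c \<in> atlas M" "p \<in> cdom c" by (rule chart_at[OF assms(3)])
  interpret riem_chart M c using riem_chart[OF c(1)] .
  show ?thesis
    unfolding mpair_eq[OF assms(1,2) c] mpair_eq[OF assms(2,1) c] cpair_def
    by (rule pairing_sym) (use c in auto)
qed

lemma mpair_linear_comb: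
  assumes "affine_fn u" "affine_fn v" "affine_fn w" "p \<in> topspace X"
  shows "mpair (\<lambda>q. a * u q + b * v q) w p = a * mpair u w p + b * mpair v w p"
proof -
  obtain c where c: "c \<in> atlas M" "p \<in> cdom c" by (rule chart_at[OF assms(4)])
  have y: "cmap c p \<in> cran c" using c by auto
  have "cgrad ((\<lambda>q. a * u q + b * v q) \<circ> cinv c) (cmap c p) =
      a *\<^sub>R cgrad (u \<circ> cinv c) (cmap c p) + b *\<^sub>R cgrad (v \<circ> cinv c) (cmap c p)"
    using cgrad_linear_comb[OF affine_fn_differentiable[OF assms(1) c(1) y] affine_fn_differentiable[OF assms(2) c(1) y], of a b]
    by (simp add: o_def)
  then show ?thesis
    unfolding mpair_eq[OF affine_fn_linear_comb[OF assms(1,2)] assms(3) c] mpair_eq[OF assms(1,3) c] mpair_eq[OF assms(2,3) c]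
    by (simp add: cpair_def pairing_def inner_add_left)
qed

lemma mpair_constant:
  assumes conn: "connected_space X" and u: "affine_fn u" and w: "affine_fn w"
    and p: "p \<in> topspace X" and q: "q \<in> topspace X"
  shows "mpair u w p = mpair u w q"
proof (rule locally_constant_on_connected_space[OF conn _ p q])
  fix p assume "p \<in> topspace X"
  then obtain c where c: "c \<in> atlas M" "p \<in> cdom c" by (rule chart_at)
  interpret riem_chart M c using riem_chart[OF c(1)] .
  obtain r where r: "r > 0" "ball (cmap c p) r \<subseteq> cmap c ` (cdom c \<inter> cdom c)"
      "openin X {q \<in> cdom c. cmap c q \<in> ball (cmap c p) r}"
    by (rule chart_ball[OF openin_cdom[OF c(1)] c(2) c]) blast
  let ?U = "{q \<in> cdom c. cmap c q \<in> ball (cmap c p) r}"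
  have B: "ball (cmap c p) r \<subseteq> cran c" using r(2) by auto
  have par: "parallel_form M c (ball (cmap c p) r) (cgrad (f \<circ> cinv c))" if "affine_fn f" for f
    by (rule parallel_form_subset[OF _ B]) (use that c in \<open>simp add: affine_fn_def\<close>)
  have "mpair u w q = mpair u w p" if q: "q \<in> ?U" for q
  proof -
    have qc: "q \<in> cdom c" using q by blast
    show ?thesis
      unfolding mpair_eq[OF u w c(1) qc] mpair_eq[OF u w c] cpair_def
      by (rule pairing_constant_on_ball[OF B par[OF u] par[OF w]]) (use q r(1) in auto)
  qed
  moreover have "p \<in> ?U" using c(2) r(1) by simp
  ultimately show "\<exists>U. openin X U \<and> p \<in> U \<and> (\<forall>q\<in>U. mpair u w q = mpair u w p)"
    by (intro exI[of _ ?U] conjI r(3) ballI)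
qed

text \<open>The norm of the differential is constant on the connected manifold, so vanishing at one
  point makes the differential vanish everywhere. Thus the pairing at one point is an inner product
  on affine functions modulo constants.\<close>

lemma mpair_zero_imp_constant:
  assumes conn: "connected_space X" and w: "affine_fn w" and p0: "p0 \<in> topspace X" "mpair w w p0 = 0"
    and p: "p \<in> topspace X" and q: "q \<in> topspace X"
  shows "w p = w q"
proof (rule locally_constant_on_connected_space[OF conn _ p q])
  fix p assume "p \<in> topspace X"
  then obtain c where c: "c \<in> atlas M" "p \<in> cdom c" by (rule chart_at)
  interpret riem_chart M c using riem_chart[OF c(1)] .
  obtain r where r: "r > 0" "ball (cmap c p) r \<subseteq> cmap c ` (cdom c \<inter> cdom c)"
      "openin X {q \<in> cdom c. cmap c q \<in> ball (cmap c p) r}"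
    by (rule chart_ball[OF openin_cdom[OF c(1)] c(2) c]) blast
  let ?U = "{q \<in> cdom c. cmap c q \<in> ball (cmap c p) r}" and ?f = "w \<circ> cinv c" and ?B = "ball (cmap c p) r"
  have der: "(?f has_derivative (\<lambda>h. 0)) (at y within ?B)" if y: "y \<in> ?B" for y
  proof -
    obtain q where q: "q \<in> cdom c" "y = cmap c q" using y r(2) by blast
    have yc: "y \<in> cran c" using q by auto
    have "mpair w w q = 0"
      using mpair_constant[OF conn w w p0(1), of q] p0(2) cdom_subset[OF c(1)] q(1) by auto
    then have "cgrad ?f y \<bullet> (H y *v cgrad ?f y) = 0"
      using mpair_eq[OF w w c(1) q(1)] by (simp add: cpair_def pairing_def q(2))
    then have "cgrad ?f y = 0" using pos_H[OF yc, of "cgrad ?f y"] by force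
    then have "frechet_derivative ?f (at y) = (\<lambda>h. 0)"
      using frechet_eq_cgrad[OF affine_fn_differentiable[OF w c(1) yc]] by auto
    then have "(?f has_derivative (\<lambda>h. 0)) (at y)"
      using affine_fn_differentiable[OF w c(1) yc] unfolding frechet_derivative_works by simp
    then show ?thesis by (rule has_derivative_at_withinI)
  qed
  have "w q = w p" if q: "q \<in> ?U" for q
  proof -
    have "?f (cmap c q) = ?f (cmap c p)"
      by (rule has_derivative_zero_unique[OF convex_ball der]) (use q r(1) in auto)
    then show ?thesis using q c by (simp add: cinv_cmap)
  qed
  moreover have "p \<in> ?U" using c(2) r(1) by simp
  ultimately show "\<exists>U. openin X U \<and> p \<in> U \<and> (\<forall>q\<in>U. w q = w p)"
    by (intro exI[of _ ?U] conjI r(3) ballI)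
qed

section \<open>Orthonormal differentials from the dimension bound\<close>

text \<open>The components along \<open>B\<close> are subtracted one at a time. The subtracted part
  \<open>s\<close> stays in the span of \<open>B\<close>, so that if \<open>w\<close> lies outside a
  span containing \<open>B\<close>, then so does \<open>w'\<close>.\<close>

lemma orthogonal_projection:
  assumes B: "finite B" "B \<subseteq> W_e M" and w: "w \<in> W_e M" and p: "p \<in> topspace X"
    and on: "\<And>u v. u \<in> B \<Longrightarrow> v \<in> B \<Longrightarrow> mpair u v p = (if u = v then 1 else 0)"
  obtains w' s where "w' \<in> W_e M" "s \<in> real_fun.span B" "w = w' + s" "\<And>u. u \<in> B \<Longrightarrow> mpair w' u p = 0"
  using B w on
proof (induction B arbitrary: thesis rule: finite_induct)
  case empty
  show ?case by (rule empty.prems(1)[of w 0]) (use empty.prems in \<open>auto simp: real_fun.span_zero\<close>)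
next
  case (insert b B)
  have aff: "affine_fn f" if "f \<in> W_e M" for f using that W_e_iff by blast
  obtain w' s where IH: "w' \<in> W_e M" "s \<in> real_fun.span B" "w = w' + s" "\<And>u. u \<in> B \<Longrightarrow> mpair w' u p = 0"
    by (rule insert.IH[OF _ _ insert.prems(3)]) (use insert.prems(2,4) in blast)+
  let ?a = "mpair w' b p"
  let ?w = "\<lambda>q. 1 * w' q + (- ?a) * b q"
  have b: "b \<in> W_e M" using insert.prems(2) by blast
  show ?case
  proof (rule insert.prems(1))
    show "?w \<in> W_e M" by (rule W_e_linear_comb[OF IH(1) b])
    have "(\<lambda>q. ?a * b q) \<in> real_fun.span (insert b B)"
      by (rule real_fun.span_scale[OF real_fun.span_base]) simp
    moreover have "s \<in> real_fun.span (insert b B)" using IH(2) real_fun.span_mono[of B "insert b B"] by blast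
    ultimately show "s + (\<lambda>q. ?a * b q) \<in> real_fun.span (insert b B)" by (rule real_fun.span_add[rotated])
    show "w = ?w + (s + (\<lambda>q. ?a * b q))" unfolding IH(3) by (auto simp: fun_eq_iff plus_fun_def)
    fix u assume u: "u \<in> insert b B"
    have uW: "u \<in> W_e M" using u insert.prems(2) by blast
    have "mpair ?w u p = mpair w' u p - ?a * mpair b u p"
      unfolding mpair_linear_comb[OF aff[OF IH(1)] aff[OF b] aff[OF uW] p] by simp
    then show "mpair ?w u p = 0"
      using insert.prems(4)[of b u] u insert.hyps(2) IH(4) by (cases "u = b") auto
  qed
qed

text \<open>Gram-Schmidt modulo constants: \<open>one_fn\<close> is adjoined to the span because the
  pairing vanishes on constants. Together with \<open>one_fn\<close>, a set of \<open>m\<close>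
  functions spans at most \<open>Suc m\<close> dimensions, fewer than \<open>CARD('n)\<close>, which
  leaves a function whose remainder after projection is not constant and so has positive
  norm.\<close>

lemma orthonormal_subset:
  assumes conn: "connected_space X" and dim: "real_fun.dim (W_e M) \<ge> CARD('n)" and p: "p \<in> topspace X"
    and "m < CARD('n)"
  shows "\<exists>B. finite B \<and> card B = m \<and> B \<subseteq> W_e M \<and> (\<forall>u\<in>B. \<forall>v\<in>B. mpair u v p = (if u = v then 1 else 0))"
  using assms(4)
proof (induction m)
  case 0
  then show ?case by (intro exI[of _ "{}"]) auto
next
  case (Suc m)
  have aff: "affine_fn f" if "f \<in> W_e M" for f using that W_e_iff by blast
  obtain B where B: "finite B" "card B = m" "B \<subseteq> W_e M"
    and on: "\<And>u v. u \<in> B \<Longrightarrow> v \<in> B \<Longrightarrow> mpair u v p = (if u = v then 1 else 0)"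
    using Suc by (metis Suc_lessD)
  have "\<not> W_e M \<subseteq> real_fun.span (insert one_fn B)"
  proof
    assume "W_e M \<subseteq> real_fun.span (insert one_fn B)"
    then have "real_fun.dim (W_e M) \<le> card (insert one_fn B)"
      by (rule real_fun.dim_le_card) (use B in auto)
    also have "\<dots> \<le> Suc m" using B by (simp add: card_insert_if)
    finally show False using dim Suc.prems by simp
  qed
  then obtain w where w: "w \<in> W_e M" "w \<notin> real_fun.span (insert one_fn B)" by blast
  obtain w' s where w': "w' \<in> W_e M" "s \<in> real_fun.span B" "w = w' + s" "\<And>u. u \<in> B \<Longrightarrow> mpair w' u p = 0"
    by (rule orthogonal_projection[OF B(1,3) w(1) p on]) blast+
  have nn: "mpair w' w' p > 0"
  proof -
    obtain c where c: "c \<in> atlas M" "p \<in> cdom c" by (rule chart_at[OF p])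
    interpret riem_chart M c using riem_chart[OF c(1)] .
    have y: "cmap c p \<in> cran c" using c by auto
    have "mpair w' w' p \<noteq> 0"
    proof
      assume z: "mpair w' w' p = 0"
      have "w' q = w' p * one_fn q" for q
        using mpair_zero_imp_constant[OF conn aff[OF w'(1)] p z _ p, of q] w'(1)
        by (cases "q \<in> topspace X") (auto simp: one_fn_def W_e_iff)
      then have "w' = (\<lambda>q. w' p * one_fn q)" by blast
      moreover have "(\<lambda>q. w' p * one_fn q) \<in> real_fun.span (insert one_fn B)"
        by (rule real_fun.span_scale[OF real_fun.span_base]) simp
      ultimately have "w' \<in> real_fun.span (insert one_fn B)" by simp
      moreover have "s \<in> real_fun.span (insert one_fn B)" using w'(2) real_fun.span_mono[of B "insert one_fn B"] by blast
      ultimately have "w \<in> real_fun.span (insert one_fn B)" unfolding w'(3) by (rule real_fun.span_add)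
      then show False using w(2) by blast
    qed
    then show ?thesis
      using pos_H[OF y, of "cgrad (w' \<circ> cinv c) (cmap c p)"]
      unfolding mpair_eq[OF aff[OF w'(1)] aff[OF w'(1)] c] cpair_def pairing_def by force
  qed
  let ?a = "1 / sqrt (mpair w' w' p)"
  \<comment> \<open>The normalised function, written with a zero second term to have the shape of
    the linear combinations in \<open>W_e_linear_comb\<close> and
    \<open>mpair_linear_comb\<close>.\<close>
  let ?e = "\<lambda>q. ?a * w' q + 0 * w' q"
  have eW: "?e \<in> W_e M" by (rule W_e_linear_comb[OF w'(1) w'(1)])
  have me: "mpair ?e u p = ?a * mpair w' u p" if "u \<in> W_e M" for u
    using mpair_linear_comb[OF aff[OF w'(1)] aff[OF w'(1)] aff[OF that] p, of ?a 0] by simp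
  have eB: "mpair ?e u p = 0" if "u \<in> B" for u using me[of u] w'(4)[OF that] that B(3) by auto
  have Be: "mpair u ?e p = 0" if u: "u \<in> B" for u
    using eB[OF u] mpair_sym[OF aff aff p, of ?e u] eW u B(3) by auto
  have ee: "mpair ?e ?e p = 1"
  proof -
    have "mpair ?e ?e p = ?a * mpair w' ?e p" by (rule me[OF eW])
    also have "mpair w' ?e p = mpair ?e w' p" by (rule mpair_sym[OF aff[OF w'(1)] aff[OF eW] p])
    also have "\<dots> = ?a * mpair w' w' p" by (rule me[OF w'(1)])
    finally show ?thesis using nn by (simp add: field_simps)
  qed
  have "?e \<notin> B" using eB ee on by force
  then show ?case
    using B eW on eB Be ee by (intro exI[of _ "insert ?e B"]) auto
qed

lemma orthonormal_affine_fns: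
  assumes conn: "connected_space X" and dim: "real_fun.dim (W_e M) \<ge> CARD('n)" and ne: "topspace X \<noteq> {}"
  obtains w :: "'n \<Rightarrow> 'a \<Rightarrow> real" where "\<And>a. a \<noteq> k \<Longrightarrow> affine_fn (w a)"
    "\<And>a b p. a \<noteq> k \<Longrightarrow> b \<noteq> k \<Longrightarrow> p \<in> topspace X \<Longrightarrow> mpair (w a) (w b) p = (if a = b then 1 else 0)"
proof -
  obtain p where p: "p \<in> topspace X" using ne by blast
  have "card (UNIV - {k}) < CARD('n)" by (rule psubset_card_mono) auto
  from orthonormal_subset[OF conn dim p this] obtain B where B: "finite B" "card B = card (UNIV - {k})" "B \<subseteq> W_e M"
    and on: "\<And>u v. u \<in> B \<Longrightarrow> v \<in> B \<Longrightarrow> mpair u v p = (if u = v then 1 else 0)" by metis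
  obtain w where w: "bij_betw w (UNIV - {k}) B"
    using finite_same_card_bij[of "UNIV - {k}" B] B by auto
  have wB: "w a \<in> B" if "a \<noteq> k" for a using w that by (auto simp: bij_betw_def)
  have aff: "affine_fn (w a)" if "a \<noteq> k" for a using wB[OF that] B(3) W_e_iff by blast
  show ?thesis
  proof (rule that[OF aff])
    fix a b q assume ab: "a \<noteq> k" "b \<noteq> k" and q: "q \<in> topspace X"
    have "w a = w b \<longleftrightarrow> a = b" using w ab by (auto simp: bij_betw_def inj_on_def)
    then show "mpair (w a) (w b) q = (if a = b then 1 else 0)"
      using on[OF wB[OF ab(1)] wB[OF ab(2)]] mpair_constant[OF conn aff[OF ab(1)] aff[OF ab(2)] p q] by simp
  qed
qed

section \<open>From affine functions to a developing map\<close>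

lemma flat_map_exists:
  assumes w: "\<And>a. a \<noteq> k \<Longrightarrow> affine_fn (w a)"
    and on: "\<And>a b p. a \<noteq> k \<Longrightarrow> b \<noteq> k \<Longrightarrow> p \<in> topspace X \<Longrightarrow> mpair (w a) (w b) p = (if a = b then 1 else 0)"
    and p: "p \<in> topspace X"
  obtains V \<phi> where "p \<in> V" "flat_map V \<phi>" "\<And>a q. a \<noteq> k \<Longrightarrow> q \<in> V \<Longrightarrow> \<phi> q $ a = w a q"
proof -
  obtain c where c: "c \<in> atlas M" "p \<in> cdom c" by (rule chart_at[OF p])
  interpret riem_chart M c using riem_chart[OF c(1)] .
  have y: "cmap c p \<in> cran c" using c by auto
  have o: "open (cran c)" by (rule open_cran)
  obtain r u where r: "r > 0" "ball (cmap c p) r \<subseteq> cran c" and u: "flat_coords M c (ball (cmap c p) r) u"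
    "\<And>a y. a \<noteq> k \<Longrightarrow> u y $ a = (w a \<circ> cinv c) y"
  proof (rule flat_coords_exist[OF o order_refl y, of k "\<lambda>a. w a \<circ> cinv c"])
    show "smooth_on (cran c) (w a \<circ> cinv c)" "parallel_form M c (cran c) (cgrad (w a \<circ> cinv c))" if "a \<noteq> k" for a
      using w[OF that] c by (auto simp: affine_fn_def)
    show "pairing M c (cgrad (w a \<circ> cinv c)) (cgrad (w b \<circ> cinv c)) y = (if a = b then 1 else 0)"
      if ab: "a \<noteq> k" "b \<noteq> k" and y: "y \<in> cran c" for a b y
    proof -
      obtain q where q: "q \<in> cdom c" "y = cmap c q" using y by blast
      have "mpair (w a) (w b) q = (if a = b then 1 else 0)" using on[OF ab] q cdom_subset[OF c(1)] by blast
      then show ?thesis unfolding mpair_eq[OF w[OF ab(1)] w[OF ab(2)] c(1) q(1)] cpair_def q(2) .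
    qed
  qed blast
  let ?V = "{q \<in> cdom c. cmap c q \<in> ball (cmap c p) r}" and ?\<phi> = "\<lambda>q. u (cmap c q)"
  have eq: "(?\<phi> \<circ> cinv c) y = u y" if y: "y \<in> ball (cmap c p) r" for y
  proof -
    obtain q where "q \<in> cdom c" "y = cmap c q" using y r(2) by blast
    then show ?thesis using cinv_cmap[OF c(1)] by simp
  qed
  have fl: "flat_coords M c (ball (cmap c p) r) (?\<phi> \<circ> cinv c)"
    by (rule flat_coords_cong[OF open_ball eq u(1)])
  have "flat_map ?V ?\<phi>"
  proof (rule flat_mapI[OF openin_chart_vimage[OF c(1) open_ball]])
    fix q assume q: "q \<in> ?V"
    show "\<exists>c\<in>atlas M. q \<in> cdom c \<and> (\<exists>S. open S \<and> cmap c q \<in> S \<and> S \<subseteq> cran c \<and> flat_coords M c S (?\<phi> \<circ> cinv c))"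
      by (rule bexI[OF _ c(1)], intro conjI exI[of _ "ball (cmap c p) r"] fl r(2)) (use q in auto)
  qed
  then show ?thesis
    by (rule that[rotated]) (use c r(1) u(2) in \<open>auto simp: cinv_cmap[OF c(1)]\<close>)
qed

lemma flat_map_open_image:
  assumes fl: "flat_map V \<phi>" and W: "openin X W" "W \<subseteq> V"
  shows "open (\<phi> ` W)"
proof (subst open_subopen, intro ballI)
  fix y assume "y \<in> \<phi> ` W"
  then obtain p where p: "p \<in> W" "y = \<phi> p" by blast
  obtain V' where V': "V' \<subseteq> W" "p \<in> V'" "flat_chart V' \<phi>"
    by (rule flat_chart_exists[OF flat_map_subset[OF fl W] p(1)])
  then show "\<exists>T. open T \<and> y \<in> T \<and> T \<subseteq> \<phi> ` W"
    using p by (intro exI[of _ "\<phi> ` V'"]) (auto simp: flat_chart_def)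
qed

lemma flat_map_open_vimage:
  assumes fl: "flat_map V \<phi>" and S: "open S"
  shows "openin X {p \<in> V. \<phi> p \<in> S}"
proof (subst openin_subopen, intro ballI)
  fix p assume p: "p \<in> {p \<in> V. \<phi> p \<in> S}"
  then have "p \<in> V" by simp
  then obtain V' where V': "V' \<subseteq> V" "p \<in> V'" "flat_chart V' \<phi>" by (rule flat_chart_exists[OF fl])
  have o: "openin X V'" using V'(3) flat_map_openin unfolding flat_chart_def by blast
  have "continuous_map (subtopology X V') (top_of_set (\<phi> ` V')) \<phi>"
    using V'(3) homeomorphic_imp_continuous_map unfolding flat_chart_def by blast
  then have "openin (subtopology X V') {q \<in> topspace (subtopology X V'). \<phi> q \<in> \<phi> ` V' \<inter> S}"
    by (rule openin_continuous_map_preimage) (use S in \<open>simp add: openin_open_Int\<close>)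
  moreover have "{q \<in> topspace (subtopology X V'). \<phi> q \<in> \<phi> ` V' \<inter> S} = {q \<in> V'. \<phi> q \<in> S}"
    using openin_subset[OF o] by auto
  ultimately have "openin X {q \<in> V'. \<phi> q \<in> S}" using openin_open_subtopology[OF o] by auto
  then show "\<exists>T. openin X T \<and> p \<in> T \<and> T \<subseteq> {p \<in> V. \<phi> p \<in> S}"
    using V' p by (intro exI[of _ "{q \<in> V'. \<phi> q \<in> S}"]) auto
qed

text \<open>Flat maps are local homeomorphisms, hence continuous and open; injectivity makes them
  homeomorphisms onto their images.\<close>

lemma flat_map_inj_homeo:
  assumes fl: "flat_map V \<phi>" and inj: "inj_on \<phi> V"
  shows "homeomorphic_map (subtopology X V) (top_of_set (\<phi> ` V)) \<phi>"
proof -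
  have o: "openin X V" by (rule flat_map_openin[OF fl])
  have top: "topspace (subtopology X V) = V" using openin_subset[OF o] by auto
  show ?thesis
  proof (rule bijective_open_imp_homeomorphic_map)
    have "continuous_map (subtopology X V) euclidean \<phi>"
      unfolding continuous_map_def top openin_open_subtopology[OF o]
      using flat_map_open_vimage[OF fl] by auto
    then show "continuous_map (subtopology X V) (top_of_set (\<phi> ` V)) \<phi>"
      by (simp add: continuous_map_in_subtopology top)
    show "open_map (subtopology X V) (top_of_set (\<phi> ` V)) \<phi>"
      unfolding open_map_def
    proof (intro allI impI)
      fix W assume "openin (subtopology X V) W"
      then have W: "openin X W" "W \<subseteq> V" using openin_open_subtopology[OF o] by auto
      then show "openin (top_of_set (\<phi> ` V)) (\<phi> ` W)"
        using flat_map_open_image[OF fl W] flat_map_open_image[OF fl o order_refl] by (simp add: openin_open_eq image_mono)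
    qed
  qed (use inj top in auto)
qed

text \<open>The notion \<open>dev\<close> freed from the chosen affine functions and from
  \<open>k\<close>, so that it also covers the maps obtained from an isometry with a model
  space.\<close>

definition developing :: "(real^'n \<Rightarrow> 'a) \<Rightarrow> bool" where
  "developing \<Phi> \<longleftrightarrow> (\<forall>x. \<exists>V \<phi> O'. flat_map V \<phi> \<and> inj_on \<phi> V \<and> open O' \<and> x \<in> O' \<and> \<Phi> ` O' \<subseteq> V \<and> (\<forall>y\<in>O'. \<phi> (\<Phi> y) = y))"

theorem developing_map:
  assumes conn: "connected_space X" and compl: "complete_riem M" and dim: "real_fun.dim (W_e M) \<ge> CARD('n)"
  obtains \<Phi> where "developing \<Phi>" "range \<Phi> = topspace X" "inj \<Phi>"
  | \<Phi> T where "developing \<Phi>" "range \<Phi> = topspace X" "T > 0"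
    "\<And>x y. \<Phi> x = \<Phi> y \<longleftrightarrow> (\<exists>m::int. y = flip k 1 (of_int m * T) x)"
proof -
  \<comment> \<open>\<open>connected_space\<close> admits the empty space; there the solution space
    is trivial, while \<open>CARD('n)\<close> is positive.\<close>
  have ne: "topspace X \<noteq> {}"
  proof
    assume "topspace X = {}"
    then have "W_e M \<subseteq> real_fun.span {}" by (auto simp: W_e_iff real_fun.span_empty fun_eq_iff)
    then have "real_fun.dim (W_e M) \<le> card ({} :: ('a \<Rightarrow> real) set)" by (rule real_fun.dim_le_card) simp
    then show False using dim by simp
  qed
  obtain w :: "'n \<Rightarrow> 'a \<Rightarrow> real" where w: "\<And>a. a \<noteq> k \<Longrightarrow> affine_fn (w a)"
    "\<And>a b p. a \<noteq> k \<Longrightarrow> b \<noteq> k \<Longrightarrow> p \<in> topspace X \<Longrightarrow> mpair (w a) (w b) p = (if a = b then 1 else 0)"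
    by (rule orthonormal_affine_fns[OF conn dim ne, of k]) blast
  \<comment> \<open>Requiring the coordinates other than \<open>k\<close> to be the global functions
    \<open>w a\<close> is what restricts the transition maps to flips.\<close>
  define F where "F = {(V, \<phi>). flat_map V \<phi> \<and> inj_on \<phi> V \<and> (\<forall>a q. a \<noteq> k \<longrightarrow> q \<in> V \<longrightarrow> \<phi> q $ a = w a q)}"
  have F: "(V, \<phi>) \<in> F \<longleftrightarrow> flat_map V \<phi> \<and> inj_on \<phi> V \<and> (\<forall>a q. a \<noteq> k \<longrightarrow> q \<in> V \<longrightarrow> \<phi> q $ a = w a q)" for V \<phi>
    by (simp add: F_def)
  interpret flat_structure X F k
  proof
    show "Hausdorff_space X" by (rule Hausdorff)
    fix V :: "'a set" and \<phi> :: "'a \<Rightarrow> real^'n" assume VF: "(V, \<phi>) \<in> F"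
    have fl: "flat_map V \<phi>" and inj: "inj_on \<phi> V" using VF F by blast+
    show o: "openin X V" by (rule flat_map_openin[OF fl])
    show "open (\<phi> ` V)" by (rule flat_map_open_image[OF fl o order_refl])
    show "homeomorphic_map (subtopology X V) (top_of_set (\<phi> ` V)) \<phi>" by (rule flat_map_inj_homeo[OF fl inj])
  next
    fix p assume p: "p \<in> topspace X"
    obtain V \<phi> where V: "p \<in> V" "flat_map V \<phi>" "\<And>a q. a \<noteq> k \<Longrightarrow> q \<in> V \<Longrightarrow> \<phi> q $ a = w a q"
      by (rule flat_map_exists[of k w p]) (use w p in blast)+
    obtain V' where V': "V' \<subseteq> V" "p \<in> V'" "flat_chart V' \<phi>" by (rule flat_chart_exists[OF V(2,1)])
    have fl: "flat_map V' \<phi>" using V'(3) by (simp add: flat_chart_def)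
    have "topspace (subtopology X V') = V'" using openin_subset[OF flat_map_openin[OF fl]] by auto
    then have "inj_on \<phi> V'" using V'(3) homeomorphic_imp_injective_map unfolding flat_chart_def by metis
    then show "\<exists>V \<phi>. (V, \<phi>) \<in> F \<and> p \<in> V" using fl V' V(3) unfolding F by blast
  next
    fix V \<phi> V' assume "(V, \<phi>) \<in> F" "openin X V'" "V' \<subseteq> V"
    then show "(V', \<phi>) \<in> F" unfolding F using flat_map_subset inj_on_subset by blast
  next
    fix V \<phi> and \<epsilon> d :: real assume VF: "(V, \<phi>) \<in> F" and e: "\<epsilon> = 1 \<or> \<epsilon> = -1"
    have "inj_on (\<lambda>p. flip k \<epsilon> d (\<phi> p)) V"
    proof (rule inj_onI)
      fix p q assume pq: "p \<in> V" "q \<in> V" "flip k \<epsilon> d (\<phi> p) = flip k \<epsilon> d (\<phi> q)"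
      then have "\<phi> p = \<phi> q" using flip_inverse(1)[OF e, of k d] by metis
      then show "p = q" using VF pq unfolding F inj_on_def by blast
    qed
    then show "(V, \<lambda>p. flip k \<epsilon> d (\<phi> p)) \<in> F"
      using VF flat_map_flip[OF _ e] unfolding F by (auto simp: flip_nth)
  next
    fix V \<phi> V' \<phi>' p assume VF: "(V, \<phi>) \<in> F" "(V', \<phi>') \<in> F" and p: "p \<in> V" "p \<in> V'"
    have fl: "flat_map V \<phi>" "flat_map V' \<phi>'" and eq: "\<And>a q. a \<noteq> k \<Longrightarrow> q \<in> V \<inter> V' \<Longrightarrow> \<phi> q $ a = \<phi>' q $ a"
      using VF unfolding F by auto
    show "\<exists>\<epsilon> d U. (\<epsilon> = 1 \<or> \<epsilon> = -1) \<and> openin X U \<and> p \<in> U \<and> U \<subseteq> V \<inter> V' \<and> (\<forall>q\<in>U. \<phi>' q = flip k \<epsilon> d (\<phi> q))"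
      by (rule flat_map_transition[OF fl p eq]) blast+
  next
    fix V \<phi> p and v :: "real^'n" assume VF: "(V, \<phi>) \<in> F" and p: "p \<in> V"
    have fl: "flat_map V \<phi>" using VF F by blast
    obtain c where c: "c \<in> atlas M" "p \<in> cdom c"
      using chart_at[of p] openin_subset[OF flat_map_openin[OF fl]] p by blast
    interpret riem_chart M c using riem_chart[OF c(1)] .
    let ?L = "frechet_derivative (\<phi> \<circ> cinv c) (at (cmap c p))"
    have fc: "flat_coords M c (cmap c ` (V \<inter> cdom c)) (\<phi> \<circ> cinv c)" by (rule flat_map_coords[OF fl c(1)])
    have y: "cmap c p \<in> cmap c ` (V \<inter> cdom c)" using p c by blast
    have "inj ?L" by (rule flat_coords_inj[OF fc y]) auto
    moreover have "linear ?L"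
      using fc smooth_on_has_derivative[OF _ y] has_derivative_linear unfolding flat_coords_def by blast
    ultimately have "surj ?L" using linear_injective_imp_surjective by blast
    \<comment> \<open>Completeness prescribes the velocity in a chart of the atlas, whereas
      \<open>F_geo\<close> asks for it in flat coordinates; the derivative of the flat map, a linear
      isomorphism, translates between them.\<close>
    then obtain v' where v': "?L v' = v" by (metis surjD)
    obtain \<gamma> where \<gamma>: "geodesic M \<gamma>" "\<gamma> 0 = p" "vector_derivative (cmap c \<circ> \<gamma>) (at 0) = v'"
      using compl c unfolding complete_riem_def by blast
    have "\<gamma> 0 \<in> V" using \<gamma>(2) p by simp
    from flat_map_geodesic[OF \<gamma>(1) fl this] obtain \<delta> b where \<delta>: "\<delta> > 0"
      "\<And>s. s \<in> ball 0 \<delta> \<Longrightarrow> \<gamma> s \<in> V \<and> \<phi> (\<gamma> s) = \<phi> (\<gamma> 0) + (s - 0) *\<^sub>R b"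
      "\<And>c. c \<in> atlas M \<Longrightarrow> \<gamma> 0 \<in> cdom c \<Longrightarrow>
       b = frechet_derivative (\<phi> \<circ> cinv c) (at (cmap c (\<gamma> 0))) (vector_derivative (cmap c \<circ> \<gamma>) (at 0))"
      by metis
    have b: "b = v" using \<delta>(3)[OF c(1)] c(2) \<gamma>(2,3) v' by simp
    show "\<exists>\<gamma>. (\<exists>\<delta>>0. \<forall>s\<in>ball 0 \<delta>. \<gamma> s \<in> V \<and> \<phi> (\<gamma> s) = \<phi> p + s *\<^sub>R v) \<and> range \<gamma> \<subseteq> topspace X \<and>
      (\<forall>V' \<phi>' t. (V', \<phi>') \<in> F \<longrightarrow> \<gamma> t \<in> V' \<longrightarrow>
        (\<exists>\<delta>>0. \<exists>b. \<forall>s\<in>ball t \<delta>. \<gamma> s \<in> V' \<and> \<phi>' (\<gamma> s) = \<phi>' (\<gamma> t) + (s - t) *\<^sub>R b))"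
    proof (intro exI[of _ \<gamma>] conjI allI impI)
      show "\<exists>\<delta>>0. \<forall>s\<in>ball 0 \<delta>. \<gamma> s \<in> V \<and> \<phi> (\<gamma> s) = \<phi> p + s *\<^sub>R v"
        using \<delta>(1,2) \<gamma>(2) b by (intro exI[of _ \<delta>]) auto
      have "continuous_map euclideanreal X \<gamma>" using \<gamma>(1) by (simp add: geodesic_def)
      then show "range \<gamma> \<subseteq> topspace X" by (auto simp: continuous_map_def)
      fix V' \<phi>' t assume "(V', \<phi>') \<in> F" and t: "\<gamma> t \<in> V'"
      then have fl': "flat_map V' \<phi>'" using F by blast
      show "\<exists>\<delta>>0. \<exists>b. \<forall>s\<in>ball t \<delta>. \<gamma> s \<in> V' \<and> \<phi>' (\<gamma> s) = \<phi>' (\<gamma> t) + (s - t) *\<^sub>R b"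
        by (rule flat_map_geodesic[OF \<gamma>(1) fl' t]) blast
    qed
  qed
  have dev: "developing \<Phi>" if "dev UNIV \<Phi>" for \<Phi>
    unfolding developing_def
  proof
    fix x
    from devE[OF that UNIV_I, of x] obtain V \<phi> O' where
      "(V, \<phi>) \<in> F" "open O'" "x \<in> O'" "\<Phi> ` O' \<subseteq> V" "\<And>y. y \<in> O' \<Longrightarrow> \<phi> (\<Phi> y) = y" by metis
    then show "\<exists>V \<phi> O'. flat_map V \<phi> \<and> inj_on \<phi> V \<and> open O' \<and> x \<in> O' \<and> \<Phi> ` O' \<subseteq> V \<and> (\<forall>y\<in>O'. \<phi> (\<Phi> y) = y)"
      unfolding F by blast
  qed
  show ?thesis
    by (rule developing_map[OF ne conn]) (use dev that in blast)+
qed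

end

section \<open>Submanifolds covered by Euclidean space\<close>

lemma mtop_submanifold: "mtop (submanifold S) = top_of_set S"
  and gmat_submanifold: "gmat (submanifold S) d y $ i $ j =
    frechet_derivative (cinv d) (at y) (axis i 1) \<bullet> frechet_derivative (cinv d) (at y) (axis j 1)"
  by (simp_all add: submanifold_def)

lemma atlas_submanifold: "d \<in> atlas (submanifold S) \<longleftrightarrow> openin (top_of_set S) (cdom d) \<and> open (cran d) \<and>
    homeomorphic_map (top_of_set (cdom d)) (top_of_set (cran d)) (cmap d) \<and>
    smooth_on (cran d) (cinv d) \<and> (\<forall>y\<in>cran d. inj (frechet_derivative (cinv d) (at y)))"
  by (simp add: submanifold_def)

lemma submanifold_chart:
  assumes "d \<in> atlas (submanifold S)"
  shows "inj_on (cmap d) (cdom d)" "cdom d \<subseteq> S" "continuous_on (cdom d) (cmap d)"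
    "\<And>q. q \<in> cdom d \<Longrightarrow> cinv d (cmap d q) = q" "\<And>y. y \<in> cran d \<Longrightarrow> cinv d y \<in> cdom d \<and> cmap d (cinv d y) = y"
proof -
  have h: "homeomorphic_map (top_of_set (cdom d)) (top_of_set (cran d)) (cmap d)"
    using assms by (simp add: atlas_submanifold)
  show inj: "inj_on (cmap d) (cdom d)" using homeomorphic_imp_injective_map[OF h] by simp
  show "cdom d \<subseteq> S" using assms openin_imp_subset by (auto simp: atlas_submanifold)
  show "continuous_on (cdom d) (cmap d)" using homeomorphic_imp_continuous_map[OF h] by (simp add: continuous_map_in_subtopology)
  show "\<And>q. q \<in> cdom d \<Longrightarrow> cinv d (cmap d q) = q" using inj by (simp add: inv_into_f_f)
  show "\<And>y. y \<in> cran d \<Longrightarrow> cinv d y \<in> cdom d \<and> cmap d (cinv d y) = y" by (simp add: inv_into_into f_inv_into_f)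
qed

lemma gmat_submanifold_inner:
  assumes "d \<in> atlas (submanifold S)" "y \<in> cran d"
  shows "v \<bullet> (gmat (submanifold S) d y *v v') = frechet_derivative (cinv d) (at y) v \<bullet> frechet_derivative (cinv d) (at y) v'"
proof -
  have sm: "smooth_on (cran d) (cinv d)" using assms(1) by (simp add: atlas_submanifold)
  have lin: "linear (frechet_derivative (cinv d) (at y))"
    using smooth_on_has_derivative[OF sm assms(2)] has_derivative_linear by blast
  show ?thesis
    by (subst linear_eq_axis[OF lin, of v], subst linear_eq_axis[OF lin, of v'],
      simp add: inner_vec_def[of v] matrix_vector_mult_def gmat_submanifold inner_sum_left inner_sum_right
        sum_distrib_left mult_ac, rule sum.swap)
qed

lemma matrix_entry: "(A :: real^'n^'n) $ i $ j = axis i 1 \<bullet> (A *v axis j 1)"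
  by (simp add: inner_axis' matrix_vector_mul_component inner_axis)

text \<open>A surjective local isometry from R^n onto the submanifold, in the form common to the
  identity map and to the rolling of R^n onto a cylinder.\<close>

locale model =
  fixes S :: "'b::euclidean_space set" and Q :: "real^'n::finite \<Rightarrow> 'b"
  assumes Q_smooth: "smooth_on UNIV Q"
    and Q_isometric: "frechet_derivative Q (at x) v \<bullet> frechet_derivative Q (at x) v' = v \<bullet> v'"
    and Q_range: "range Q = S"
    and Q_open: "open W \<Longrightarrow> openin (top_of_set S) (Q ` W)"
    and Q_locally_inj: "\<exists>U. open U \<and> x \<in> U \<and> inj_on Q U"
begin

lemma Q_has_derivative: "(Q has_derivative frechet_derivative Q (at x)) (at x)"
  using smooth_on_has_derivative[OF Q_smooth] by blast

lemma Q_immersion: "inj (frechet_derivative Q (at x))"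
proof -
  have "v = 0" if "frechet_derivative Q (at x) v = 0" for v
    using Q_isometric[of x v v] that by simp
  then show ?thesis using linear_injective_0[OF has_derivative_linear[OF Q_has_derivative]] by blast
qed

lemma continuous_on_Q_inverse:
  assumes "open U" "inj_on Q U"
  shows "continuous_on (Q ` U) (inv_into U Q)"
  unfolding continuous_on_open_invariant
proof (intro allI impI)
  fix B :: "(real^'n) set" assume B: "open B"
  have "openin (top_of_set S) (Q ` (U \<inter> B))" using Q_open[OF open_Int[OF assms(1) B]] .
  then obtain A where A: "open A" "Q ` (U \<inter> B) = S \<inter> A" by (auto simp: openin_open)
  have "A \<inter> Q ` U = inv_into U Q -` B \<inter> Q ` U"
  proof (intro set_eqI iffI)
    fix s assume s: "s \<in> A \<inter> Q ` U"
    then have "s \<in> Q ` (U \<inter> B)" using A(2) Q_range by auto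
    then show "s \<in> inv_into U Q -` B \<inter> Q ` U" using assms(2) by (auto simp: inv_into_f_f)
  next
    fix s assume s: "s \<in> inv_into U Q -` B \<inter> Q ` U"
    then obtain y where "y \<in> U" "s = Q y" by blast
    then have "s \<in> Q ` (U \<inter> B)" using s assms(2) by (auto simp: inv_into_f_f)
    then show "s \<in> A \<inter> Q ` U" using A(2) by auto
  qed
  then show "\<exists>A. open A \<and> A \<inter> Q ` U = inv_into U Q -` B \<inter> Q ` U" using A(1) by blast
qed

text \<open>Local inverses of \<open>Q\<close> belong to the atlas because \<open>cinv d\<close> is
  \<open>Q\<close> itself on \<open>U\<close>. In such a chart the induced metric is the Euclidean
  one, by \<open>Q_isometric\<close>.\<close>

lemma Q_chart:
  assumes U: "open U" "inj_on Q U"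
  defines "d \<equiv> (Q ` U, inv_into U Q)"
  shows "d \<in> atlas (submanifold S)" "\<And>y. y \<in> U \<Longrightarrow> cinv d y = Q y" "cran d = U"
proof -
  have dQ: "inv_into U Q (Q y) = y" if "y \<in> U" for y using U(2) that by (rule inv_into_f_f)
  show ran: "cran d = U" unfolding d_def using dQ by force
  have inj: "inj_on (cmap d) (cdom d)" unfolding d_def by (auto simp: inj_on_def dQ)
  show ci: "cinv d y = Q y" if y: "y \<in> U" for y
  proof -
    have "cinv d (cmap d (Q y)) = Q y" by (rule inv_into_f_f[OF inj]) (use y in \<open>auto simp: d_def\<close>)
    then show ?thesis using dQ[OF y] by (simp add: d_def)
  qed
  have "smooth_on (cran d) (cinv d)"
    unfolding ran smooth_on_def
    by (intro allI Ck_on_eqI[OF U(1) _ ci] Ck_on_subset[OF smooth_onD[OF Q_smooth]]) auto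
  moreover have "inj (frechet_derivative (cinv d) (at y))" if "y \<in> cran d" for y
  proof -
    have "frechet_derivative (cinv d) (at y) = frechet_derivative Q (at y)"
      by (rule frechet_derivative_cong_open[OF U(1) _ ci]) (use that ran in auto)
    then show ?thesis using Q_immersion by simp
  qed
  moreover have "homeomorphic_map (top_of_set (cdom d)) (top_of_set (cran d)) (cmap d)"
    unfolding homeomorphic_map_maps homeomorphic_maps_def ran
  proof (intro exI[of _ Q] conjI)
    show "continuous_map (top_of_set (cdom d)) (top_of_set U) (cmap d)"
      using continuous_on_Q_inverse[OF U] dQ by (auto simp: continuous_map_in_subtopology d_def)
    have "continuous_on U Q" using smooth_onD[OF Q_smooth, of 0] continuous_on_subset by auto
    then show "continuous_map (top_of_set U) (top_of_set (cdom d)) Q"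
      by (auto simp: continuous_map_in_subtopology d_def)
  qed (auto simp: d_def dQ)
  moreover have "openin (top_of_set S) (cdom d)" using Q_open[OF U(1)] by (simp add: d_def)
  ultimately show "d \<in> atlas (submanifold S)" using U(1) ran by (simp add: atlas_submanifold)
qed

end

context riemannian
begin

section \<open>Developing maps and isometries with a model\<close>

text \<open>The domain in \<open>developing\<close> is shrunk to the points whose coordinates lie in
  \<open>O'\<close>, which turns the one-sided inverse into a two-sided one.\<close>

lemma developing_local:
  assumes "developing \<Phi>"
  obtains V \<phi> where "flat_map V \<phi>" "inj_on \<phi> V" "\<Phi> x \<in> V" "\<And>q. q \<in> V \<Longrightarrow> \<Phi> (\<phi> q) = q" "\<phi> (\<Phi> x) = x"
    "\<And>y. y \<in> \<phi> ` V \<Longrightarrow> \<Phi> y \<in> V \<and> \<phi> (\<Phi> y) = y"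
proof -
  obtain V \<phi> O' where *: "flat_map V \<phi>" "inj_on \<phi> V" "open O'" "x \<in> O'" "\<Phi> ` O' \<subseteq> V" "\<And>y. y \<in> O' \<Longrightarrow> \<phi> (\<Phi> y) = y"
    using assms unfolding developing_def by metis
  let ?V = "{q \<in> V. \<phi> q \<in> O'}"
  have inv: "\<Phi> (\<phi> q) = q" if q: "q \<in> ?V" for q
  proof -
    have "\<Phi> (\<phi> q) \<in> V" "\<phi> (\<Phi> (\<phi> q)) = \<phi> q" using q *(5,6) by auto
    then show ?thesis using inj_onD[OF *(2), of "\<Phi> (\<phi> q)" q] q by simp
  qed
  show ?thesis
  proof (rule that[of ?V \<phi>])
    show "flat_map ?V \<phi>" by (rule flat_map_subset[OF *(1) flat_map_open_vimage[OF *(1,3)]]) auto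
    show "inj_on \<phi> ?V" by (rule inj_on_subset[OF *(2)]) auto
    show "\<Phi> x \<in> ?V" "\<phi> (\<Phi> x) = x" using *(4,5,6) by auto
    show "\<Phi> y \<in> ?V \<and> \<phi> (\<Phi> y) = y" if "y \<in> \<phi> ` ?V" for y using that inv by auto
  qed (rule inv)
qed

lemma developing_open_vimage:
  assumes \<Phi>: "developing \<Phi>" and W: "openin X W"
  shows "open {x. \<Phi> x \<in> W}"
proof (subst open_subopen, intro ballI)
  fix x assume x: "x \<in> {x. \<Phi> x \<in> W}"
  obtain V \<phi> where V: "flat_map V \<phi>" "inj_on \<phi> V" "\<Phi> x \<in> V" "\<And>q. q \<in> V \<Longrightarrow> \<Phi> (\<phi> q) = q" "\<phi> (\<Phi> x) = x"
    by (rule developing_local[OF \<Phi>, of x]) blast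
  have "open (\<phi> ` (V \<inter> W))"
    by (rule flat_map_open_image[OF V(1)]) (use openin_Int[OF flat_map_openin[OF V(1)] W] in auto)
  moreover have "x \<in> \<phi> ` (V \<inter> W)" using x V(3,5) by (intro image_eqI[of _ _ "\<Phi> x"]) auto
  ultimately show "\<exists>T. open T \<and> x \<in> T \<and> T \<subseteq> {x. \<Phi> x \<in> W}"
    using V(4) by (intro exI[of _ "\<phi> ` (V \<inter> W)"]) auto
qed

text \<open>In coordinates \<Phi> is a continuous right inverse of the immersion
  \<open>\<phi> \<circ> cinv c\<close>, so \<open>smooth_on_factor\<close> applies with the identity
  as composite.\<close>

lemma developing_smooth:
  assumes \<Phi>: "developing \<Phi>" and c: "c \<in> atlas M"
  shows "smooth_on {x. \<Phi> x \<in> cdom c} (cmap c \<circ> \<Phi>)"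
  unfolding smooth_on_def
proof (intro allI Ck_on_local)
  fix m x assume x: "x \<in> {x. \<Phi> x \<in> cdom c}"
  interpret riem_chart M c using riem_chart[OF c] .
  obtain V \<phi> where V: "flat_map V \<phi>" "inj_on \<phi> V" "\<Phi> x \<in> V" "\<And>q. q \<in> V \<Longrightarrow> \<Phi> (\<phi> q) = q" "\<phi> (\<Phi> x) = x"
    "\<And>y. y \<in> \<phi> ` V \<Longrightarrow> \<Phi> y \<in> V \<and> \<phi> (\<Phi> y) = y"
    by (rule developing_local[OF \<Phi>, of x]) blast
  let ?T = "\<phi> ` (V \<inter> cdom c)" and ?U = "cmap c ` (V \<inter> cdom c)"
  have Vc: "openin X (V \<inter> cdom c)" by (rule openin_Int[OF flat_map_openin[OF V(1)] openin_cdom[OF c]])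
  have T: "open ?T" by (rule flat_map_open_image[OF V(1) Vc]) auto
  have U: "open ?U" by (rule open_chart_image[OF c flat_map_openin[OF V(1)]])
  have T_V: "\<Phi> y \<in> V" "\<Phi> y \<in> cdom c" "\<phi> (\<Phi> y) = y" if "y \<in> ?T" for y
    using that V(4) by auto
  have fl: "flat_coords M c ?U (\<phi> \<circ> cinv c)" by (rule flat_map_coords[OF V(1) c])
  have "smooth_on ?T (cmap c \<circ> \<Phi>)"
  proof (rule smooth_on_factor[OF U T])
    show "smooth_on ?U (\<phi> \<circ> cinv c)" using fl by (simp add: flat_coords_def)
    show "inj (frechet_derivative (\<phi> \<circ> cinv c) (at y))" if "y \<in> ?U" for y
      by (rule flat_coords_inj[OF fl that]) auto
    show "(cmap c \<circ> \<Phi>) ` ?T \<subseteq> ?U" using T_V by auto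
    have "continuous_on ?T (cmap c \<circ> \<Phi>)"
      unfolding continuous_on_open_vimage[OF T]
    proof (intro allI impI)
      fix B :: "(real^'n) set" assume "open B"
      from developing_open_vimage[OF \<Phi> openin_chart_vimage[OF c this]] T
      have "open ({y. \<Phi> y \<in> {q \<in> cdom c. cmap c q \<in> B}} \<inter> ?T)" by (rule open_Int)
      moreover have "(cmap c \<circ> \<Phi>) -` B \<inter> ?T = {y. \<Phi> y \<in> {q \<in> cdom c. cmap c q \<in> B}} \<inter> ?T"
        using T_V(2) by auto
      ultimately show "open ((cmap c \<circ> \<Phi>) -` B \<inter> ?T)" by simp
    qed
    then show "continuous_on ?T (cmap c \<circ> \<Phi>)" .
    have eq: "(\<phi> \<circ> cinv c) ((cmap c \<circ> \<Phi>) y) = y" if "y \<in> ?T" for y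
      using T_V[OF that] cinv_cmap[OF c] by simp
    show "smooth_on ?T (\<lambda>y. (\<phi> \<circ> cinv c) ((cmap c \<circ> \<Phi>) y))"
      unfolding smooth_on_def
      by (intro allI Ck_on_eqI[OF T _ eq] Ck_on_bounded_linear[OF bounded_linear_ident T])
  qed
  then have "Ck_on m ?T (cmap c \<circ> \<Phi>)" by (rule smooth_onD)
  moreover have "x \<in> ?T" using V(3,5) x by (intro image_eqI[of _ _ "\<Phi> x"]) auto
  ultimately show "\<exists>T. open T \<and> x \<in> T \<and> Ck_on m T (cmap c \<circ> \<Phi>)" using T by blast
qed

text \<open>Surjections with the same fibres factor through each other:
  \<open>f \<circ> \<Phi> = Q\<close> and \<open>h \<circ> Q = \<Phi>\<close>. Locally
  \<open>f\<close> is \<open>Q\<close> after flat coordinates, hence smooth and metric-preserving as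
  a map into the ambient Euclidean space; the charts of the submanifold are brought in
  afterwards.\<close>

theorem isometric_model:
  assumes "model S Q" and \<Phi>: "developing \<Phi>" and range: "range \<Phi> = topspace X"
    and fib: "\<And>x y. \<Phi> x = \<Phi> y \<longleftrightarrow> Q x = Q y"
  shows "isometric M (submanifold S :: (_, 'n) riem)"
proof -
  interpret model S Q by fact
  let ?N = "submanifold S :: (_, 'n) riem"
  define f where "f p = Q (SOME x. \<Phi> x = p)" for p
  define h where "h s = \<Phi> (SOME x. Q x = s)" for s
  have f: "f (\<Phi> x) = Q x" for x
  proof -
    have "\<Phi> (SOME y. \<Phi> y = \<Phi> x) = \<Phi> x" by (rule someI[of _ x]) simp
    then show ?thesis unfolding f_def using fib by blast
  qed
  have h: "h (Q x) = \<Phi> x" for x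
  proof -
    have "Q (SOME y. Q y = Q x) = Q x" by (rule someI[of _ x]) simp
    then show ?thesis unfolding h_def using fib by blast
  qed
  have hf: "h (f p) = p" if "p \<in> topspace X" for p
    using that f h unfolding range[symmetric] by auto
  have fh: "f (h s) = s" if "s \<in> S" for s
    using that f h unfolding Q_range[symmetric] by auto
  have f_local: "\<exists>V \<phi>. flat_map V \<phi> \<and> p \<in> V \<and> (\<forall>q\<in>V. f q = Q (\<phi> q))" if p: "p \<in> topspace X" for p
  proof -
    obtain x where x: "p = \<Phi> x" using p range by blast
    obtain V \<phi> where V: "flat_map V \<phi>" "\<Phi> x \<in> V" "\<And>q. q \<in> V \<Longrightarrow> \<Phi> (\<phi> q) = q"
      by (rule developing_local[OF \<Phi>, of x]) blast
    have "f q = Q (\<phi> q)" if "q \<in> V" for q using f[of "\<phi> q"] V(3)[OF that] by simp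
    then show ?thesis using V(1,2) x by blast
  qed
  have f_S: "f p \<in> S" for p unfolding f_def using Q_range by blast
  have Q_vimage: "open {x. Q x \<in> B}" if "openin (top_of_set S) B" for B
  proof -
    obtain A where A: "open A" "B = S \<inter> A" using \<open>openin (top_of_set S) B\<close> by (auto simp: openin_open)
    have "open (Q -` A)" using open_vimage[OF A(1)] smooth_onD[OF Q_smooth, of 0] by simp
    moreover have "{x. Q x \<in> B} = Q -` A" using A(2) Q_range by auto
    ultimately show ?thesis by simp
  qed
  have f_open: "openin X {p \<in> topspace X. f p \<in> B}" if B: "openin (top_of_set S) B" for B
  proof (subst openin_subopen, intro ballI)
    fix p assume p: "p \<in> {p \<in> topspace X. f p \<in> B}"
    then obtain V \<phi> where V: "flat_map V \<phi>" "p \<in> V" "\<And>q. q \<in> V \<Longrightarrow> f q = Q (\<phi> q)" using f_local by blast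
    let ?W = "{q \<in> V. \<phi> q \<in> {x. Q x \<in> B}}"
    have "openin X ?W" by (rule flat_map_open_vimage[OF V(1) Q_vimage[OF B]])
    moreover have "?W \<subseteq> {p \<in> topspace X. f p \<in> B}" using V(3) openin_subset[OF flat_map_openin[OF V(1)]] by auto
    ultimately show "\<exists>T. openin X T \<and> p \<in> T \<and> T \<subseteq> {p \<in> topspace X. f p \<in> B}" using p V by (intro exI[of _ ?W]) auto
  qed
  have f_smooth: "smooth_on (cran c) (f \<circ> cinv c)"
    and f_isom: "\<And>p i j. p \<in> cdom c \<Longrightarrow> gmat M c (cmap c p) $ i $ j =
      frechet_derivative (f \<circ> cinv c) (at (cmap c p)) (axis i 1) \<bullet> frechet_derivative (f \<circ> cinv c) (at (cmap c p)) (axis j 1)"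
    if c: "c \<in> atlas M" for c
  proof -
    have local: "\<exists>T. open T \<and> cmap c p \<in> T \<and> (\<forall>m. Ck_on m T (f \<circ> cinv c)) \<and> (\<forall>i j. gmat M c (cmap c p) $ i $ j =
      frechet_derivative (f \<circ> cinv c) (at (cmap c p)) (axis i 1) \<bullet> frechet_derivative (f \<circ> cinv c) (at (cmap c p)) (axis j 1))"
      if p: "p \<in> cdom c" for p
    proof -
      have "p \<in> topspace X" using cdom_subset[OF c] p by blast
      from f_local[OF this] obtain V \<phi> where V: "flat_map V \<phi>" "p \<in> V" "\<And>q. q \<in> V \<Longrightarrow> f q = Q (\<phi> q)" by blast
      let ?T = "cmap c ` (V \<inter> cdom c)"
      have T: "open ?T" by (rule open_chart_image[OF c flat_map_openin[OF V(1)]])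
      have fl: "flat_coords M c ?T (\<phi> \<circ> cinv c)" by (rule flat_map_coords[OF V(1) c])
      then have sm: "smooth_on ?T (\<phi> \<circ> cinv c)" by (simp add: flat_coords_def)
      have eq: "(f \<circ> cinv c) y = Q ((\<phi> \<circ> cinv c) y)" if "y \<in> ?T" for y
        using that V(3) cinv_cmap[OF c] by auto
      have y: "cmap c p \<in> ?T" using V(2) p by blast
      have "Ck_on m ?T (f \<circ> cinv c)" for m
        by (rule Ck_on_eqI[OF T Ck_on_compose[OF open_UNIV T smooth_onD[OF sm] smooth_onD[OF Q_smooth]] eq]) auto
      moreover have "frechet_derivative (f \<circ> cinv c) (at (cmap c p)) =
          (\<lambda>v. frechet_derivative Q (at ((\<phi> \<circ> cinv c) (cmap c p))) (frechet_derivative (\<phi> \<circ> cinv c) (at (cmap c p)) v))"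
      proof -
        have iff: "((f \<circ> cinv c) has_derivative D) (at (cmap c p)) \<longleftrightarrow>
            ((\<lambda>y. Q ((\<phi> \<circ> cinv c) y)) has_derivative D) (at (cmap c p))" for D
          by (rule has_derivative_cong_open[OF T y]) (rule eq)
        have "((\<lambda>y. Q ((\<phi> \<circ> cinv c) y)) has_derivative
            (\<lambda>v. frechet_derivative Q (at ((\<phi> \<circ> cinv c) (cmap c p))) (frechet_derivative (\<phi> \<circ> cinv c) (at (cmap c p)) v))) (at (cmap c p))"
          by (rule has_derivative_compose[OF smooth_on_has_derivative[OF sm y] Q_has_derivative])
        then have "((f \<circ> cinv c) has_derivative
            (\<lambda>v. frechet_derivative Q (at ((\<phi> \<circ> cinv c) (cmap c p))) (frechet_derivative (\<phi> \<circ> cinv c) (at (cmap c p)) v))) (at (cmap c p))"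
          unfolding iff .
        from frechet_derivative_at[OF this] show ?thesis by simp
      qed
      ultimately show ?thesis
        using T y fl by (intro exI[of _ ?T]) (auto simp: Q_isometric flat_coords_def)
    qed
    show "smooth_on (cran c) (f \<circ> cinv c)"
      unfolding smooth_on_def by (intro allI Ck_on_local) (use local in blast)
    show "gmat M c (cmap c p) $ i $ j =
      frechet_derivative (f \<circ> cinv c) (at (cmap c p)) (axis i 1) \<bullet> frechet_derivative (f \<circ> cinv c) (at (cmap c p)) (axis j 1)"
      if "p \<in> cdom c" for p i j using local[OF that] by blast
  qed
  \<comment> \<open>\<open>cmap d\<close> is meaningful only on the submanifold and has no
    derivative in the ambient space; smoothness is obtained by factoring
    \<open>f \<circ> cinv c\<close> through the immersion \<open>cinv d\<close>.\<close>
  have smf: "smooth_on (cmap c ` {p \<in> cdom c. f p \<in> cdom d}) (cmap d \<circ> f \<circ> cinv c)"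
    and open_f: "open (cmap c ` {p \<in> cdom c. f p \<in> cdom d})"
    if c: "c \<in> atlas M" and d: "d \<in> atlas ?N" for c d
  proof -
    let ?T = "cmap c ` {p \<in> cdom c. f p \<in> cdom d}"
    note ds = submanifold_chart[OF d]
    have "openin (top_of_set S) (cdom d)" using d by (simp add: atlas_submanifold)
    from open_chart_image[OF c f_open[OF this]] show T: "open ?T"
      using cdom_subset[OF c] by (simp add: Int_def conj_ac subset_iff cong: conj_cong)
    have T_f: "(f \<circ> cinv c) y \<in> cdom d" if "y \<in> ?T" for y using that cinv_cmap[OF c] by auto
    have smT: "smooth_on ?T (f \<circ> cinv c)" by (rule smooth_on_subset[OF f_smooth[OF c]]) auto
    show "smooth_on ?T (cmap d \<circ> f \<circ> cinv c)"
    proof (rule smooth_on_factor[of "cran d" _ "cinv d"])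
      show "open (cran d)" "smooth_on (cran d) (cinv d)" using d by (simp_all add: atlas_submanifold)
      show "inj (frechet_derivative (cinv d) (at y))" if "y \<in> cran d" for y using d that unfolding atlas_submanifold by blast
      show "open ?T" by (rule T)
      show "continuous_on ?T (cmap d \<circ> f \<circ> cinv c)"
        unfolding comp_assoc
        by (rule continuous_on_compose[OF _ continuous_on_subset[OF ds(3)]])
          (use smooth_onD[OF smT, of 0] T_f in auto)
      show "(cmap d \<circ> f \<circ> cinv c) ` ?T \<subseteq> cran d" using T_f by auto
      have eq: "cinv d ((cmap d \<circ> f \<circ> cinv c) y) = (f \<circ> cinv c) y" if "y \<in> ?T" for y
        using ds(4)[OF T_f[OF that]] by simp
      show "smooth_on ?T (\<lambda>y. cinv d ((cmap d \<circ> f \<circ> cinv c) y))"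
        unfolding smooth_on_def by (intro allI Ck_on_eqI[OF T smooth_onD[OF smT] eq])
    qed
  qed
  have map_f: "smooth_map M ?N f"
    unfolding smooth_map_def mtop_submanifold
  proof (intro conjI ballI smf)
    show "continuous_map X (top_of_set S) f"
      unfolding continuous_map_def using f_S f_open by auto
  qed
  have map_h: "smooth_map ?N M h"
    unfolding smooth_map_def mtop_submanifold
  proof (intro conjI ballI)
    show "continuous_map (top_of_set S) X h"
      unfolding continuous_map_def
    proof (intro conjI allI impI)
      have "h s \<in> topspace X" for s unfolding h_def using range by blast
      then show "h \<in> topspace (top_of_set S) \<rightarrow> topspace X" by blast
      fix W assume W: "openin X W"
      have "{s \<in> topspace (top_of_set S). h s \<in> W} = Q ` {x. \<Phi> x \<in> W}"
        using h Q_range by auto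
      then show "openin (top_of_set S) {s \<in> topspace (top_of_set S). h s \<in> W}"
        using Q_open[OF developing_open_vimage[OF \<Phi> W]] by simp
    qed
    fix d c assume d: "d \<in> atlas ?N" and c: "c \<in> atlas M"
    note ds = submanifold_chart[OF d]
    let ?T = "cmap d ` {s \<in> cdom d. h s \<in> cdom c}"
    show "smooth_on ?T (cmap c \<circ> h \<circ> cinv d)"
      unfolding smooth_on_def
    proof (intro allI Ck_on_local)
      fix m y assume "y \<in> ?T"
      then obtain s where s: "s \<in> cdom d" "h s \<in> cdom c" "y = cmap d s" by blast
      obtain x where x: "s = Q x" using s(1) ds(2) Q_range by blast
      obtain U0 where U0: "open U0" "x \<in> U0" "inj_on Q U0" using Q_locally_inj by blast
      \<comment> \<open>Near \<open>s\<close> the map \<open>h\<close> is \<Phi> after a local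
        inverse of \<open>Q\<close>; on \<open>?U\<close> that inverse exists and \<Phi> stays in
        the chart \<open>c\<close>.\<close>
      let ?U = "U0 \<inter> {x. \<Phi> x \<in> cdom c}"
      have U: "open ?U" by (intro open_Int U0(1) developing_open_vimage[OF \<Phi> openin_cdom[OF c]])
      have injU: "inj_on Q ?U" by (rule inj_on_subset[OF U0(3)]) auto
      have xU: "x \<in> ?U" using U0(2) s(2) h x by auto
      let ?R = "inv_into ?U Q"
      have "openin (top_of_set S) (Q ` ?U)" by (rule Q_open[OF U])
      then obtain A where A: "open A" "Q ` ?U = S \<inter> A" by (auto simp: openin_open)
      have smd: "smooth_on (cran d) (cinv d)" and od: "open (cran d)" using d by (simp_all add: atlas_submanifold)
      let ?T' = "cinv d -` A \<inter> cran d"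
      have T': "open ?T'" using smooth_onD[OF smd, of 0] A(1) continuous_on_open_vimage[OF od, of "cinv d"] by simp
      have T'_Q: "cinv d z \<in> Q ` ?U" if "z \<in> ?T'" for z using that A(2) ds(2,5) by auto
      have R: "?R (cinv d z) \<in> ?U" "Q (?R (cinv d z)) = cinv d z" if "z \<in> ?T'" for z
        using T'_Q[OF that] inv_into_into f_inv_into_f by metis+
      have "smooth_on ?T' (\<lambda>z. ?R (cinv d z))"
      proof (rule smooth_on_factor[OF U T'])
        show "smooth_on ?U Q" by (rule smooth_on_subset[OF Q_smooth]) auto
        show "inj (frechet_derivative Q (at y))" for y by (rule Q_immersion)
        show "continuous_on ?T' (\<lambda>z. ?R (cinv d z))"
          by (rule continuous_on_compose2[OF continuous_on_Q_inverse[OF U injU]])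
            (use smooth_onD[OF smd, of 0] T'_Q in \<open>auto intro: continuous_on_subset\<close>)
        show "(\<lambda>z. ?R (cinv d z)) ` ?T' \<subseteq> ?U" using R(1) by blast
        show "smooth_on ?T' (\<lambda>z. Q (?R (cinv d z)))"
          unfolding smooth_on_def
          by (intro allI Ck_on_eqI[OF T' _ R(2)] Ck_on_subset[OF smooth_onD[OF smd]]) auto
      qed
      from smooth_onD[OF this] have "Ck_on m ?T' (\<lambda>z. (cmap c \<circ> \<Phi>) (?R (cinv d z)))"
        by (rule Ck_on_compose[OF U T' _ Ck_on_subset[OF smooth_onD[OF developing_smooth[OF \<Phi> c]]]]) (use R(1) in auto)
      moreover have "(cmap c \<circ> h \<circ> cinv d) z = (cmap c \<circ> \<Phi>) (?R (cinv d z))" if "z \<in> ?T'" for z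
        using R(2)[OF that] h[of "?R (cinv d z)"] by simp
      ultimately have "Ck_on m ?T' (cmap c \<circ> h \<circ> cinv d)" by (rule Ck_on_eqI[OF T'])
      moreover have "y \<in> ?T'"
      proof -
        have "s \<in> S \<inter> A" using xU x unfolding A(2)[symmetric] by blast
        then show ?thesis using s(1,3) ds(4)[OF s(1)] by simp
      qed
      ultimately show "\<exists>T. open T \<and> y \<in> T \<and> Ck_on m T (cmap c \<circ> h \<circ> cinv d)" using T' by blast
    qed
  qed
  have "isometry M ?N f"
    unfolding isometry_def
  proof (intro conjI map_f exI[of _ h] map_h ballI impI)
    show "h (f p) = p" if "p \<in> topspace X" for p by (rule hf[OF that])
    show "f (h s) = s" if "s \<in> topspace (mtop ?N)" for s using fh that by (simp add: mtop_submanifold)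
    fix c d p assume c: "c \<in> atlas M" and d: "d \<in> atlas ?N" and p: "p \<in> cdom c" "f p \<in> cdom d"
    note ds = submanifold_chart[OF d]
    let ?g = "cmap d \<circ> f \<circ> cinv c" and ?y = "cmap c p"
    let ?T = "cmap c ` {p \<in> cdom c. f p \<in> cdom d}"
    let ?J = "jacobian ?g (at ?y)"
    have yT: "?y \<in> ?T" using p by blast
    have dg: "(?g has_derivative frechet_derivative ?g (at ?y)) (at ?y)"
      by (rule smooth_on_has_derivative[OF smf[OF c d] yT])
    have J: "?J *v v = frechet_derivative ?g (at ?y) v" for v
      unfolding jacobian_def by (rule matrix_apply[OF has_derivative_linear[OF dg]])
    have gy: "?g ?y = cmap d (f p)" using cinv_cmap[OF c p(1)] by simp
    have fpd: "cmap d (f p) \<in> cran d" using p by blast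
    have dd: "(cinv d has_derivative frechet_derivative (cinv d) (at (?g ?y))) (at (?g ?y))"
      by (rule smooth_on_has_derivative[of "cran d"]) (use d fpd gy in \<open>simp_all add: atlas_submanifold\<close>)
    have eq: "cinv d (?g y) = (f \<circ> cinv c) y" if y: "y \<in> ?T" for y
    proof -
      have "f (cinv c y) \<in> cdom d" using y cinv_cmap[OF c] by auto
      then show ?thesis using ds(4) by simp
    qed
    have iff: "((\<lambda>y. cinv d (?g y)) has_derivative D) (at ?y) \<longleftrightarrow> ((f \<circ> cinv c) has_derivative D) (at ?y)" for D
      by (rule has_derivative_cong_open[OF open_f[OF c d] yT]) (rule eq)
    have "((f \<circ> cinv c) has_derivative (\<lambda>v. frechet_derivative (cinv d) (at (?g ?y)) (frechet_derivative ?g (at ?y) v))) (at ?y)"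
      using has_derivative_compose[OF dg dd] unfolding iff .
    from frechet_derivative_at[OF this]
    have chain: "frechet_derivative (f \<circ> cinv c) (at ?y) v = frechet_derivative (cinv d) (at (cmap d (f p))) (?J *v v)" for v
      unfolding J gy[symmetric] by metis
    have "gmat M c ?y $ i $ j = (transpose ?J ** gmat ?N d (cmap d (f p)) ** ?J) $ i $ j" for i j
      unfolding f_isom[OF c p(1)] chain gmat_submanifold_inner[OF d fpd, symmetric] inner_pullback[symmetric]
      by (rule matrix_entry[symmetric])
    then show "let J = ?J in gmat M c ?y = transpose J ** gmat ?N d (cmap d (f p)) ** J"
      by (simp add: vec_eq_iff Let_def)
  qed
  then show ?thesis unfolding isometric_def by blast
qed

text \<open>\<Phi> is \<open>Q\<close> followed by the inverse isometry \<open>h\<close>. Its flat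
  coordinates are \<open>cmap d \<circ> f\<close> for a chart \<open>d\<close> that inverts
  \<open>Q\<close>, since the model metric is Euclidean in such a chart. The fibres agree because
  \<open>h\<close> is injective on \<open>S\<close>.\<close>

theorem isometric_model_developing:
  assumes "model S Q" and iso: "isometric M (submanifold S :: (_, 'n) riem)"
  obtains \<Phi> where "developing \<Phi>" "range \<Phi> = topspace X" "\<And>x y. \<Phi> x = \<Phi> y \<longleftrightarrow> Q x = Q y"
proof -
  interpret model S Q by fact
  let ?N = "submanifold S :: (_, 'n) riem"
  obtain f where I: "isometry M ?N f" using iso unfolding isometric_def by blast
  have f: "smooth_map M ?N f" using I unfolding isometry_def by blast
  obtain h where h: "smooth_map ?N M h" and inv: "\<forall>p\<in>topspace X. h (f p) = p" "\<forall>s\<in>topspace (mtop ?N). f (h s) = s"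
    using I unfolding isometry_def by blast
  have hf: "h (f p) = p" if "p \<in> topspace X" for p using inv(1) that by blast
  have fh: "f (h s) = s" if "s \<in> S" for s using inv(2) that by (simp add: mtop_submanifold)
  have met: "gmat M c (cmap c p) = transpose (jacobian (cmap d \<circ> f \<circ> cinv c) (at (cmap c p))) ** gmat ?N d (cmap d (f p)) **
      jacobian (cmap d \<circ> f \<circ> cinv c) (at (cmap c p))"
    if "c \<in> atlas M" "d \<in> atlas ?N" "p \<in> cdom c" "f p \<in> cdom d" for c d p
    using I that unfolding isometry_def Let_def by blast
  have cont_f: "continuous_map X (top_of_set S) f" and cont_h: "continuous_map (top_of_set S) X h"
    using f h unfolding smooth_map_def mtop_submanifold by blast+
  have f_S: "f p \<in> S" if "p \<in> topspace X" for p
    using cont_f that by (auto simp: continuous_map_def)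
  have h_X: "h s \<in> topspace X" if "s \<in> S" for s
    using cont_h that by (auto simp: continuous_map_def)
  define \<Phi> where "\<Phi> x = h (Q x)" for x
  have "developing \<Phi>"
    unfolding developing_def
  proof
    fix x
    obtain U where U: "open U" "x \<in> U" "inj_on Q U" using Q_locally_inj by blast
    define d where "d = (Q ` U, inv_into U Q)"
    have d: "d \<in> atlas ?N" "\<And>y. y \<in> U \<Longrightarrow> cinv d y = Q y" "cran d = U" and dd: "cdom d = Q ` U" "cmap d = inv_into U Q"
      unfolding d_def using Q_chart[OF U(1,3)] by auto
    let ?V = "{p \<in> topspace X. f p \<in> cdom d}" and ?\<phi> = "\<lambda>p. cmap d (f p)"
    have "openin (top_of_set S) (cdom d)" using d(1) by (simp add: atlas_submanifold)
    then have V: "openin X ?V" by (rule openin_continuous_map_preimage[OF cont_f])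
    have "flat_map ?V ?\<phi>"
    proof (rule flat_mapI[OF V])
      fix p assume p: "p \<in> ?V"
      then obtain c where c: "c \<in> atlas M" "p \<in> cdom c" using chart_at by blast
      let ?T = "cmap c ` {p \<in> cdom c. f p \<in> cdom d}"
      have "{p \<in> cdom c. f p \<in> cdom d} = ?V \<inter> cdom c" using cdom_subset[OF c(1)] by auto
      then have T: "open ?T" using open_chart_image[OF c(1) V] by simp
      have sm: "smooth_on ?T (cmap d \<circ> f \<circ> cinv c)" using f c(1) d(1) unfolding smooth_map_def by blast
      have eq: "?\<phi> \<circ> cinv c = cmap d \<circ> f \<circ> cinv c" by auto
      have "flat_coords M c ?T (?\<phi> \<circ> cinv c)"
        unfolding flat_coords_def eq
      proof (intro conjI sm ballI allI)
        fix y i j assume "y \<in> ?T"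
        then obtain q where q: "q \<in> cdom c" "f q \<in> cdom d" "y = cmap c q" by blast
        let ?g = "cmap d \<circ> f \<circ> cinv c"
        have dg: "linear (frechet_derivative ?g (at y))"
          using smooth_on_has_derivative[OF sm, of y] q has_derivative_linear by blast
        have z: "cmap d (f q) \<in> cran d" using q by blast
        have "frechet_derivative (cinv d) (at (cmap d (f q))) = frechet_derivative Q (at (cmap d (f q)))"
          by (rule frechet_derivative_cong_open[OF U(1) _ d(2)]) (use z d(3) in auto)
        then have g: "v \<bullet> (gmat ?N d (cmap d (f q)) *v v') = v \<bullet> v'" for v v'
          unfolding gmat_submanifold_inner[OF d(1) z] using Q_isometric by simp
        have "gmat M c y $ i $ j = axis i 1 \<bullet> (gmat M c (cmap c q) *v axis j 1)"
          unfolding q(3) by (rule matrix_entry)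
        also have "\<dots> = (jacobian ?g (at y) *v axis i 1) \<bullet> (gmat ?N d (cmap d (f q)) *v (jacobian ?g (at y) *v axis j 1))"
          unfolding met[OF c(1) d(1) q(1,2)] q(3) by (rule inner_pullback)
        also have "\<dots> = (jacobian ?g (at y) *v axis i 1) \<bullet> (jacobian ?g (at y) *v axis j 1)" by (rule g)
        finally show "gmat M c y $ i $ j = frechet_derivative ?g (at y) (axis i 1) \<bullet> frechet_derivative ?g (at y) (axis j 1)"
          unfolding jacobian_def matrix_apply[OF dg] .
      qed
      then show "\<exists>c\<in>atlas M. p \<in> cdom c \<and> (\<exists>S. open S \<and> cmap c p \<in> S \<and> S \<subseteq> cran c \<and> flat_coords M c S (?\<phi> \<circ> cinv c))"
        by (intro bexI[OF _ c(1)] conjI c(2) exI[of _ ?T] T) (use c p in auto)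
    qed
    moreover have "inj_on ?\<phi> ?V"
    proof (rule inj_onI)
      fix p q assume pq: "p \<in> ?V" "q \<in> ?V" "?\<phi> p = ?\<phi> q"
      then have "f p = f q" using inj_onD[OF submanifold_chart(1)[OF d(1)]] by blast
      then show "p = q" using hf pq by (metis (mono_tags, lifting) mem_Collect_eq)
    qed
    moreover have "\<Phi> y \<in> ?V" "?\<phi> (\<Phi> y) = y" if "y \<in> U" for y
    proof -
      have "Q y \<in> S" using Q_range by blast
      then have "f (\<Phi> y) = Q y" "\<Phi> y \<in> topspace X" using fh h_X unfolding \<Phi>_def by auto
      then show "\<Phi> y \<in> ?V" "?\<phi> (\<Phi> y) = y" using that U(3) by (auto simp: dd inv_into_f_f)
    qed
    ultimately show "\<exists>V \<phi> O'. flat_map V \<phi> \<and> inj_on \<phi> V \<and> open O' \<and> x \<in> O' \<and> \<Phi> ` O' \<subseteq> V \<and> (\<forall>y\<in>O'. \<phi> (\<Phi> y) = y)"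
      using U(1,2) by (intro exI[of _ ?V] exI[of _ ?\<phi>] exI[of _ U]) auto
  qed
  moreover have "range \<Phi> = topspace X"
  proof
    show "range \<Phi> \<subseteq> topspace X" unfolding \<Phi>_def using h_X Q_range by blast
    show "topspace X \<subseteq> range \<Phi>"
    proof
      fix p assume p: "p \<in> topspace X"
      then obtain x where "f p = Q x" using f_S Q_range by blast
      then have "\<Phi> x = p" using hf[OF p] by (simp add: \<Phi>_def)
      then show "p \<in> range \<Phi>" by blast
    qed
  qed
  moreover have "\<Phi> x = \<Phi> y \<longleftrightarrow> Q x = Q y" for x y
  proof -
    have "Q x \<in> S" "Q y \<in> S" using Q_range by blast+
    then show ?thesis unfolding \<Phi>_def using fh by metis
  qed
  ultimately show ?thesis by (rule that)
qed

end

section \<open>The dimension of the solution space\<close>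

lemma sum_fun_apply: "(\<Sum>i\<in>I. f i) x = (\<Sum>i\<in>I. f i x)"
  for f :: "'i \<Rightarrow> 'a \<Rightarrow> 'b::comm_monoid_add"
  by (induction I rule: infinite_finite_induct) auto

text \<open>The derivative is locally constant, hence constant on the connected space; subtracting
  the corresponding linear function leaves a function with zero derivative.\<close>

lemma locally_affine_imp_affine:
  fixes f :: "'a::euclidean_space \<Rightarrow> real"
  assumes "\<And>x. \<exists>U a b. open U \<and> x \<in> U \<and> (\<forall>y\<in>U. f y = a + b \<bullet> y)"
  obtains a b where "\<And>x. f x = a + b \<bullet> x"
proof -
  have D: "\<exists>U b. open U \<and> x \<in> U \<and> (\<forall>y\<in>U. (f has_derivative (\<lambda>v. b \<bullet> v)) (at y))" for x
  proof -
    obtain U a b where U: "open U" "x \<in> U" "\<And>y. y \<in> U \<Longrightarrow> f y = a + b \<bullet> y" using assms by metis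
    have "(f has_derivative (\<lambda>v. b \<bullet> v)) (at y)" if "y \<in> U" for y
    proof -
      have "((\<lambda>y. a + b \<bullet> y) has_derivative (\<lambda>v. b \<bullet> v)) (at y)" by (auto intro!: derivative_eq_intros)
      moreover have "(f has_derivative D) (at y) \<longleftrightarrow> ((\<lambda>y. a + b \<bullet> y) has_derivative D) (at y)" for D
        by (rule has_derivative_cong_open[OF U(1) that]) (rule U(3))
      ultimately show ?thesis by simp
    qed
    then show ?thesis using U(1,2) by blast
  qed
  have conn: "connected_space (euclidean :: 'a topology)"
    using connected_UNIV[where 'a = 'a] by (simp add: connectedin_topspace[symmetric])
  have const: "frechet_derivative f (at x) = frechet_derivative f (at 0)" for x
  proof (rule locally_constant_on_connected_space[OF conn])
    fix p :: 'a
    obtain U b where U: "open U" "p \<in> U" "\<And>y. y \<in> U \<Longrightarrow> (f has_derivative (\<lambda>v. b \<bullet> v)) (at y)" using D by metis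
    have "frechet_derivative f (at y) = (\<lambda>v. b \<bullet> v)" if "y \<in> U" for y
      using frechet_derivative_at[OF U(3)[OF that]] by simp
    then show "\<exists>U. openin euclidean U \<and> p \<in> U \<and> (\<forall>q\<in>U. frechet_derivative f (at q) = frechet_derivative f (at p))"
      using U(1,2) by (intro exI[of _ U]) auto
  qed auto
  obtain b where b: "(f has_derivative (\<lambda>v. b \<bullet> v)) (at 0)" using D[of 0] by blast
  have der: "(f has_derivative (\<lambda>v. b \<bullet> v)) (at x)" for x
  proof -
    obtain b' where b': "(f has_derivative (\<lambda>v. b' \<bullet> v)) (at x)" using D[of x] by blast
    have "frechet_derivative f (at x) = (\<lambda>v. b \<bullet> v)"
      using const[of x] frechet_derivative_at[OF b] by simp
    then show ?thesis using b' frechet_derivative_at[OF b'] by simp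
  qed
  have "f x - b \<bullet> x = f 0 - b \<bullet> 0" for x
  proof (rule has_derivative_zero_unique[of UNIV "\<lambda>x. f x - b \<bullet> x"])
    fix x
    have "((\<lambda>x. f x - b \<bullet> x) has_derivative (\<lambda>v. b \<bullet> v - b \<bullet> v)) (at x)"
      by (intro has_derivative_diff der) (auto intro!: derivative_eq_intros)
    then show "((\<lambda>x. f x - b \<bullet> x) has_derivative (\<lambda>h. 0)) (at x within UNIV)" by simp
  qed auto
  then have "f x = f 0 + b \<bullet> x" for x by (metis add.commute diff_add_cancel diff_zero inner_zero_right)
  then show ?thesis by (rule that)
qed

context riemannian
begin

section \<open>Affine functions read through a developing map\<close>

text \<open>Components of flat maps have parallel differentials by
  \<open>flat_coords_parallel\<close>, and both conditions in \<open>affine_fn\<close> are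
  local.\<close>

lemma affine_fn_local:
  assumes loc: "\<And>p. p \<in> topspace X \<Longrightarrow> \<exists>V \<phi> i. flat_map V \<phi> \<and> p \<in> V \<and> (\<forall>q\<in>V. w q = \<phi> q $ i)"
  shows "affine_fn w"
proof -
  have ex: "\<exists>T. open T \<and> y \<in> T \<and> T \<subseteq> cran c \<and> smooth_on T (w \<circ> cinv c) \<and> parallel_form M c T (cgrad (w \<circ> cinv c))"
    if c: "c \<in> atlas M" and y: "y \<in> cran c" for c y
  proof -
    interpret riem_chart M c using riem_chart[OF c] .
    obtain p where p: "p \<in> cdom c" "y = cmap c p" using y by blast
    have "p \<in> topspace X" using p cdom_subset[OF c] by blast
    from loc[OF this] obtain V \<phi> i where V: "flat_map V \<phi>" "p \<in> V" "\<And>q. q \<in> V \<Longrightarrow> w q = \<phi> q $ i" by blast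
    let ?T = "cmap c ` (V \<inter> cdom c)"
    have T: "open ?T" by (rule open_chart_image[OF c flat_map_openin[OF V(1)]])
    have Tc: "?T \<subseteq> cran c" by auto
    have fl: "flat_coords M c ?T (\<phi> \<circ> cinv c)" by (rule flat_map_coords[OF V(1) c])
    then have sm: "smooth_on ?T (\<phi> \<circ> cinv c)" by (simp add: flat_coords_def)
    have eq: "(w \<circ> cinv c) z = (\<phi> \<circ> cinv c) z $ i" if "z \<in> ?T" for z
      using that V(3) cinv_cmap[OF c] by auto
    have "smooth_on ?T (w \<circ> cinv c)"
      unfolding smooth_on_def by (intro allI Ck_on_eqI[OF T Ck_on_nth[OF T smooth_onD[OF sm]] eq])
    moreover have "parallel_form M c ?T (cgrad (w \<circ> cinv c))"
    proof (rule parallel_form_cong[OF T _ flat_coords_parallel[OF T Tc fl, of i]])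
      fix z assume z: "z \<in> ?T"
      have "frechet_derivative (w \<circ> cinv c) (at z) = frechet_derivative (\<lambda>x. (\<phi> \<circ> cinv c) x $ i) (at z)"
        by (rule frechet_derivative_cong_open[OF T z]) (rule eq)
      then show "cgrad (w \<circ> cinv c) z = cgrad (\<lambda>x. (\<phi> \<circ> cinv c) x $ i) z"
        by (simp add: cgrad_def partial_def)
    qed
    ultimately show ?thesis using T Tc p V(2) by (intro exI[of _ ?T]) auto
  qed
  show ?thesis
    unfolding affine_fn_def
  proof (intro ballI conjI)
    fix c assume c: "c \<in> atlas M"
    show "smooth_on (cran c) (w \<circ> cinv c)"
      unfolding smooth_on_def
    proof (intro allI Ck_on_local)
      fix m y assume "y \<in> cran c"
      from ex[OF c this] obtain T where T: "open T" "y \<in> T" "smooth_on T (w \<circ> cinv c)" by blast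
      show "\<exists>T. open T \<and> y \<in> T \<and> Ck_on m T (w \<circ> cinv c)"
        by (intro exI[of _ T] conjI T(1,2) smooth_onD[OF T(3)])
    qed
    show "parallel_form M c (cran c) (cgrad (w \<circ> cinv c))"
      unfolding parallel_form_def smooth_on_def
    proof (intro conjI allI ballI Ck_on_local)
      fix m y assume "y \<in> cran c"
      from ex[OF c this] obtain T where T: "open T" "y \<in> T" and par: "parallel_form M c T (cgrad (w \<circ> cinv c))" by blast
      have "smooth_on T (cgrad (w \<circ> cinv c))" using par by (simp add: parallel_form_def)
      from smooth_onD[OF this] show "\<exists>T. open T \<and> y \<in> T \<and> Ck_on m T (cgrad (w \<circ> cinv c))"
        using T by blast
    next
      fix y l assume "y \<in> cran c"
      from ex[OF c this] obtain T where T: "open T" "y \<in> T" and par: "parallel_form M c T (cgrad (w \<circ> cinv c))" by blast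
      then show "frechet_derivative (cgrad (w \<circ> cinv c)) (at y) (axis l 1) = conn M c y l *v cgrad (w \<circ> cinv c) y"
        by (simp add: parallel_form_def)
    qed
  qed
qed

text \<open>Near each point \<open>w\<close> is affine in flat coordinates, and \<Phi> inverts these
  coordinates; the local formulas are then joined on R^n.\<close>

lemma affine_fn_developing:
  assumes \<Phi>: "developing \<Phi>" and w: "affine_fn w"
  obtains a b where "\<And>x. w (\<Phi> x) = a + b \<bullet> x"
proof (rule locally_affine_imp_affine)
  fix x
  obtain V \<phi> where V: "flat_map V \<phi>" "inj_on \<phi> V" "\<Phi> x \<in> V" "\<And>q. q \<in> V \<Longrightarrow> \<Phi> (\<phi> q) = q" "\<phi> (\<Phi> x) = x"
    "\<And>y. y \<in> \<phi> ` V \<Longrightarrow> \<Phi> y \<in> V \<and> \<phi> (\<Phi> y) = y"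
    by (rule developing_local[OF \<Phi>, of x]) blast
  let ?p = "\<Phi> x"
  have o: "openin X V" by (rule flat_map_openin[OF V(1)])
  then obtain c where c: "c \<in> atlas M" "?p \<in> cdom c" using chart_at V(3) openin_subset by blast
  interpret riem_chart M c using riem_chart[OF c(1)] .
  obtain r where r: "r > 0" "ball (cmap c ?p) r \<subseteq> cmap c ` (V \<inter> cdom c)"
    "openin X {q \<in> cdom c. cmap c q \<in> ball (cmap c ?p) r}" "{q \<in> cdom c. cmap c q \<in> ball (cmap c ?p) r} \<subseteq> V"
    by (rule chart_ball[OF o V(3) c]) blast
  let ?B = "ball (cmap c ?p) r" and ?W = "{q \<in> cdom c. cmap c q \<in> ball (cmap c ?p) r}"
  have B: "?B \<subseteq> cran c" using r(2) by auto
  have fl: "flat_coords M c ?B (\<phi> \<circ> cinv c)"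
    by (rule flat_coords_subset[OF flat_map_coords[OF V(1) c(1)] r(2)])
  have sm: "smooth_on ?B (w \<circ> cinv c)" and par: "parallel_form M c ?B (cgrad (w \<circ> cinv c))"
    using w c(1) smooth_on_subset[OF _ B] parallel_form_subset[OF _ B] unfolding affine_fn_def by blast+
  obtain a b where ab: "\<And>y. y \<in> ?B \<Longrightarrow> (w \<circ> cinv c) y = a + b \<bullet> (\<phi> \<circ> cinv c) y"
    by (rule parallel_affine_in_flat_coords[OF B fl sm par]) blast
  have wq: "w q = a + b \<bullet> \<phi> q" if "q \<in> ?W" for q
    using ab[of "cmap c q"] that cinv_cmap[OF c(1)] by simp
  have "open (\<phi> ` ?W)" by (rule flat_map_open_image[OF V(1) r(3,4)])
  moreover have "?p \<in> ?W" using c(2) r(1) by simp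
  then have "x \<in> \<phi> ` ?W" by (rule image_eqI[rotated]) (simp add: V(5))
  moreover have "w (\<Phi> y) = a + b \<bullet> y" if "y \<in> \<phi> ` ?W" for y
  proof -
    obtain q where q: "q \<in> ?W" "y = \<phi> q" using \<open>y \<in> \<phi> ` ?W\<close> by blast
    then have "\<Phi> y = q" using V(4) r(4) by blast
    then show ?thesis using wq[OF q(1)] q(2) by simp
  qed
  ultimately show "\<exists>U a b. open U \<and> x \<in> U \<and> (\<forall>y\<in>U. w (\<Phi> y) = a + b \<bullet> y)" by blast
qed (rule that)

text \<open>Through \<Phi> the solutions are the affine functions on R^n that are constant on
  fibres: they are spanned by \<open>one_fn\<close> and the coordinates other than \<open>k\<close>,
  with coordinate \<open>k\<close> added when \<Phi> is injective. Besides \<open>n\<close>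
  independent solutions a finite spanning set is produced, because \<open>dim\<close> is the
  cardinality of a basis and \<open>card\<close> of an infinite set is 0.\<close>

theorem dim_W_e_developing:
  assumes \<Phi>: "developing \<Phi>" and range: "range \<Phi> = topspace X"
    and fib: "\<And>x y i. \<Phi> x = \<Phi> y \<Longrightarrow> i \<noteq> k \<Longrightarrow> x $ i = y $ i"
    and per: "inj \<Phi> \<or> (\<exists>d. d \<noteq> 0 \<and> (\<forall>x. \<Phi> (x + d *\<^sub>R axis k 1) = \<Phi> x))"
  shows "real_fun.dim (W_e M) \<ge> CARD('n)"
proof -
  \<comment> \<open>The coordinate of an arbitrary preimage; the choice is immaterial when the
    coordinate is constant on fibres.\<close>
  define coord where "coord i p = (if p \<in> topspace X then (SOME x. \<Phi> x = p) $ i else 0)" for i p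
  have top: "\<Phi> x \<in> topspace X" for x using range by blast
  have coord_inj: "coord i (\<Phi> x) = x $ i" if "i \<noteq> k \<or> inj \<Phi>" for i x
  proof -
    have "\<Phi> (SOME y. \<Phi> y = \<Phi> x) = \<Phi> x" by (rule someI[of _ x]) simp
    then show ?thesis using that fib[of "SOME y. \<Phi> y = \<Phi> x" x i] top
      by (auto simp: coord_def dest: injD)
  qed
  have coord_W: "coord i \<in> W_e M" if i: "i \<noteq> k \<or> inj \<Phi>" for i
    unfolding W_e_iff
  proof
    show "\<forall>p. p \<notin> topspace X \<longrightarrow> coord i p = 0" by (simp add: coord_def)
    show "affine_fn (coord i)"
    proof (rule affine_fn_local)
      fix p assume "p \<in> topspace X"
      then obtain x where x: "p = \<Phi> x" using range by blast
      obtain V \<phi> where V: "flat_map V \<phi>" "\<Phi> x \<in> V" "\<And>q. q \<in> V \<Longrightarrow> \<Phi> (\<phi> q) = q"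
        by (rule developing_local[OF \<Phi>, of x]) blast
      have "coord i q = \<phi> q $ i" if "q \<in> V" for q using coord_inj[OF i, of "\<phi> q"] V(3)[OF that] by simp
      then show "\<exists>V \<phi> i'. flat_map V \<phi> \<and> p \<in> V \<and> (\<forall>q\<in>V. coord i q = \<phi> q $ i')" using V(1,2) x by blast
    qed
  qed
  define I where "I = (if inj \<Phi> then UNIV else UNIV - {k})"
  have I: "i \<in> I \<Longrightarrow> i \<noteq> k \<or> inj \<Phi>" for i by (auto simp: I_def split: if_splits)
  have one: "one_fn (\<Phi> x) = 1" for x using top by (simp add: one_fn_def)
  have span: "W_e M \<subseteq> real_fun.span (insert one_fn (coord ` I))"
  proof
    fix w assume w: "w \<in> W_e M"
    then have "affine_fn w" using W_e_iff by blast
    then obtain a b where ab: "\<And>x. w (\<Phi> x) = a + b \<bullet> x" by (rule affine_fn_developing[OF \<Phi>]) blast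
    \<comment> \<open>Invariance under a nonzero shift along axis \<open>k\<close> leaves no slope
      in that direction.\<close>
    have bk: "b $ k = 0" if ninj: "\<not> inj \<Phi>"
    proof -
      obtain d where d: "d \<noteq> 0" "\<And>x. \<Phi> (x + d *\<^sub>R axis k 1) = \<Phi> x" using per ninj by blast
      have "a + b \<bullet> (0 + d *\<^sub>R axis k 1) = a + b \<bullet> 0" using ab[of "0 + d *\<^sub>R axis k 1"] ab[of 0] d(2)[of 0] by simp
      then show ?thesis using d(1) by (simp add: inner_axis)
    qed
    have sumI: "(\<Sum>i\<in>I. b $ i * x $ i) = b \<bullet> x" for x
    proof -
      have "(\<Sum>i\<in>I. b $ i * x $ i) = (\<Sum>i\<in>UNIV. b $ i * x $ i)"
        by (rule sum.mono_neutral_left) (use bk in \<open>auto simp: I_def split: if_splits\<close>)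
      then show ?thesis by (simp add: inner_vec_def)
    qed
    have "w = (\<lambda>p. a * one_fn p) + (\<Sum>i\<in>I. (\<lambda>p. b $ i * coord i p))"
    proof
      fix p
      show "w p = ((\<lambda>p. a * one_fn p) + (\<Sum>i\<in>I. (\<lambda>p. b $ i * coord i p))) p"
      proof (cases "p \<in> topspace X")
        case True
        then obtain x where x: "p = \<Phi> x" using range by blast
        show ?thesis unfolding x plus_fun_apply sum_fun_apply one ab
          using sumI[of x] coord_inj[OF I] by simp
      next
        case False
        then show ?thesis using w unfolding plus_fun_apply sum_fun_apply
          by (simp add: W_e_iff one_fn_def coord_def)
      qed
    qed
    also have "\<dots> \<in> real_fun.span (insert one_fn (coord ` I))"
      by (intro real_fun.span_add real_fun.span_sum real_fun.span_scale real_fun.span_base) auto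
    finally show "w \<in> real_fun.span (insert one_fn (coord ` I))" .
  qed
  \<comment> \<open>The index \<open>k\<close> is given to the constant, so the family has exactly
    one member per element of \<open>'n\<close> whether or not \<Phi> is injective.\<close>
  define b where "b i = (if i = k then one_fn else coord i)" for i
  have bW: "b i \<in> W_e M" for i using coord_W one_fn_W_e by (simp add: b_def)
  have b\<Phi>: "b i (\<Phi> x) = (if i = k then 1 else x $ i)" for i x using one coord_inj by (simp add: b_def)
  have indep: "c j = 0" if z: "\<And>p. (\<Sum>i\<in>UNIV. c i * b i p) = 0" for c j
  proof -
    have s: "c k + (\<Sum>i\<in>UNIV - {k}. c i * x $ i) = 0" for x
    proof -
      have "(\<Sum>i\<in>UNIV. c i * b i (\<Phi> x)) = c k * b k (\<Phi> x) + (\<Sum>i\<in>UNIV - {k}. c i * b i (\<Phi> x))"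
        by (rule sum.remove) auto
      also have "(\<Sum>i\<in>UNIV - {k}. c i * b i (\<Phi> x)) = (\<Sum>i\<in>UNIV - {k}. c i * x $ i)"
        by (rule sum.cong) (auto simp: b\<Phi>)
      finally show ?thesis using z[of "\<Phi> x"] by (simp add: b\<Phi>)
    qed
    have ck: "c k = 0" using s[of 0] by simp
    show ?thesis
    proof (cases "j = k")
      case False
      have "(\<Sum>i\<in>UNIV - {k}. c i * (axis j 1 :: real^'n) $ i) = (\<Sum>i\<in>UNIV - {k}. if i = j then c i else 0)"
        by (rule sum.cong) (auto simp: axis_def)
      also have "\<dots> = c j" using False by simp
      finally show ?thesis using s[of "axis j 1"] ck by simp
    qed (simp add: ck)
  qed
  have inj: "inj b"
  proof (rule injI, rule ccontr)
    fix i j assume ij: "b i = b j" "i \<noteq> j"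
    let ?c = "\<lambda>l. if l = i then 1 else if l = j then -1 else (0::real)"
    have "(\<Sum>l\<in>UNIV. ?c l * b l p) = (\<Sum>l\<in>{i, j}. ?c l * b l p)" for p
      by (rule sum.mono_neutral_right) auto
    then have "(\<Sum>l\<in>UNIV. ?c l * b l p) = 0" for p using ij by simp
    from indep[of ?c, OF this, of i] show False by simp
  qed
  have ind: "real_fun.independent (range b)"
  proof (rule real_fun.independent_if_scalars_zero)
    fix f x assume 0: "(\<Sum>x\<in>range b. (\<lambda>p. f x * x p)) = (0 :: 'a \<Rightarrow> real)" and x: "x \<in> range b"
    have "(\<Sum>i\<in>UNIV. f (b i) * b i p) = 0" for p
    proof -
      have "(\<Sum>i\<in>UNIV. f (b i) * b i p) = (\<Sum>x\<in>range b. f x * x p)"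
        by (subst sum.reindex[OF inj]) simp
      also have "\<dots> = (\<Sum>x\<in>range b. (\<lambda>p. f x * x p)) p" by (simp add: sum_fun_apply)
      finally show ?thesis using 0 by simp
    qed
    from indep[of "\<lambda>i. f (b i)", OF this] show "f x = 0" using x by blast
  qed simp
  obtain B where B: "B \<subseteq> W_e M" "real_fun.independent B" "W_e M \<subseteq> real_fun.span B" "card B = real_fun.dim (W_e M)"
    by (rule real_fun.basis_exists)
  have "finite B"
    using real_fun.independent_span_bound[OF _ B(2), of "insert one_fn (coord ` I)"] B(1) span by auto
  then have "card (range b) \<le> card B"
    using real_fun.independent_span_bound[OF _ ind, of B] bW B(3) by blast
  then show ?thesis using B(4) card_image[OF inj] by simp
qed

end

section \<open>Euclidean space and the cylinder\<close>

lemma model_euclidean: "model UNIV (\<lambda>x::real^'n::finite. x)"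
proof
  show "smooth_on UNIV (\<lambda>x::real^'n. x)"
    unfolding smooth_on_def using Ck_on_bounded_linear[OF bounded_linear_ident open_UNIV] by blast
  show "frechet_derivative (\<lambda>x::real^'n. x) (at x) v \<bullet> frechet_derivative (\<lambda>x::real^'n. x) (at x) v' = v \<bullet> v'" for x v v' :: "real^'n"
    using frechet_derivative_at[OF has_derivative_ident, of x] by (simp add: fun_eq_iff)
  show "\<exists>U. open U \<and> x \<in> U \<and> inj_on (\<lambda>x. x) U" for x :: "real^'n" by (intro exI[of _ UNIV]) auto
qed auto

section \<open>The cylinder as a quotient of Euclidean space\<close>

text \<open>The angle is \<open>x $ k / \<rho>\<close>, so that the circle is traversed at unit
  speed and the map is isometric.\<close>

definition roll :: "'n::finite \<Rightarrow> real \<Rightarrow> real^'n \<Rightarrow> (real^'n) \<times> complex" where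
  "roll k \<rho> x = (\<chi> i. if i = k then 0 else x $ i, of_real \<rho> * cis (x $ k / \<rho>))"

lemma cis_eq_iff: "cis a = cis b \<longleftrightarrow> (\<exists>m::int. b = a + 2 * pi * of_int m)"
proof -
  have "cis a = cis b \<longleftrightarrow> (\<exists>n::int. \<i> * of_real a = \<i> * of_real b + (of_int (2 * n) * pi) * \<i>)"
    unfolding cis_conv_exp exp_eq by simp
  also have "\<dots> \<longleftrightarrow> (\<exists>n::int. a = b + 2 * of_int n * pi)"
  proof -
    have "\<i> * of_real a = \<i> * of_real b + (of_int (2 * n) * pi) * \<i> \<longleftrightarrow> a = b + 2 * of_int n * pi" for n :: int
      by (auto simp: complex_eq_iff)
    then show ?thesis by simp
  qed
  also have "\<dots> \<longleftrightarrow> (\<exists>m::int. b = a + 2 * pi * of_int m)"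
  proof
    assume "\<exists>n::int. a = b + 2 * of_int n * pi"
    then obtain n :: int where "a = b + 2 * of_int n * pi" by blast
    then show "\<exists>m::int. b = a + 2 * pi * of_int m" by (intro exI[of _ "- n"]) simp
  next
    assume "\<exists>m::int. b = a + 2 * pi * of_int m"
    then obtain m :: int where "b = a + 2 * pi * of_int m" by blast
    then show "\<exists>n::int. a = b + 2 * of_int n * pi" by (intro exI[of _ "- m"]) simp
  qed
  finally show ?thesis .
qed

text \<open>Expressed with \<open>flip\<close>, to match the fibres of a developing map whose period
  is the circumference \<open>2 * pi * \<rho>\<close>.\<close>

lemma roll_eq_iff:
  fixes k :: "'n::finite"
  assumes "\<rho> > 0"
  shows "roll k \<rho> x = roll k \<rho> y \<longleftrightarrow> (\<exists>m::int. y = flip k 1 (of_int m * (2 * pi * \<rho>)) x)"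
proof -
  have "roll k \<rho> x = roll k \<rho> y \<longleftrightarrow> (\<forall>i. i \<noteq> k \<longrightarrow> x $ i = y $ i) \<and> cis (x $ k / \<rho>) = cis (y $ k / \<rho>)"
    using assms by (auto simp: roll_def vec_eq_iff)
  also have "\<dots> \<longleftrightarrow> (\<exists>m::int. (\<forall>i. i \<noteq> k \<longrightarrow> x $ i = y $ i) \<and> y $ k / \<rho> = x $ k / \<rho> + 2 * pi * of_int m)"
    unfolding cis_eq_iff by blast
  also have "\<dots> \<longleftrightarrow> (\<exists>m::int. y = flip k 1 (of_int m * (2 * pi * \<rho>)) x)"
  proof -
    have "(\<forall>i. i \<noteq> k \<longrightarrow> x $ i = y $ i) \<and> y $ k / \<rho> = x $ k / \<rho> + 2 * pi * of_int m \<longleftrightarrow>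
        y = flip k 1 (of_int m * (2 * pi * \<rho>)) x" for m :: int
      using assms by (auto simp: vec_eq_iff flip_nth field_simps)
    then show ?thesis by simp
  qed
  finally show ?thesis .
qed

text \<open>The factor \<open>c\<close> is arbitrary in the induction because each differentiation
  multiplies it by \<open>\<i>\<close>.\<close>

lemma Ck_on_cis: "Ck_on m UNIV (\<lambda>t::real. c * cis t)"
proof (induction m arbitrary: c)
  case 0
  then show ?case by (auto intro!: continuous_intros continuous_on_cis)
next
  case (Suc m)
  show ?case
  proof (rule Ck_on_SucI)
    show "((\<lambda>t. c * cis t) has_derivative (\<lambda>v. v *\<^sub>R ((c * \<i>) * cis t))) (at t)" for t :: real
      by (auto intro!: derivative_eq_intros simp: scaleR_conv_of_real mult_ac)
    show "Ck_on m UNIV (\<lambda>t. v *\<^sub>R ((c * \<i>) * cis t))" for v :: real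
      by (intro Ck_on_scaleR Ck_on_const open_UNIV Suc.IH)
  qed auto
qed

lemma roll_has_derivative:
  fixes k :: "'n::finite"
  assumes "\<rho> > 0"
  shows "(roll k \<rho> has_derivative (\<lambda>v. (\<chi> i. if i = k then 0 else v $ i, v $ k *\<^sub>R (\<i> * cis (x $ k / \<rho>))))) (at x)"
proof -
  have "bounded_linear (\<lambda>x::real^'n. \<chi> i. if i = k then 0 else x $ i)"
    by (rule linear_conv_bounded_linear[THEN iffD1]) (auto simp: linear_iff vec_eq_iff)
  then have 1: "((\<lambda>x::real^'n. \<chi> i. if i = k then 0 else x $ i) has_derivative (\<lambda>v. \<chi> i. if i = k then 0 else v $ i)) (at x)"
    by (rule bounded_linear_imp_has_derivative)
  have "((\<lambda>x::real^'n. x $ k / \<rho>) has_derivative (\<lambda>v. v $ k / \<rho>)) (at x)"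
    by (intro bounded_linear_imp_has_derivative bounded_linear_divide bounded_linear_compose[OF bounded_linear_divide bounded_linear_vec_nth])
  moreover have "((\<lambda>t. of_real \<rho> * cis t) has_derivative (\<lambda>v. v *\<^sub>R ((of_real \<rho> * \<i>) * cis (x $ k / \<rho>)))) (at (x $ k / \<rho>))"
    by (auto intro!: derivative_eq_intros simp: scaleR_conv_of_real mult_ac)
  ultimately have "((\<lambda>x. of_real \<rho> * cis (x $ k / \<rho>)) has_derivative
      (\<lambda>v. (v $ k / \<rho>) *\<^sub>R ((of_real \<rho> * \<i>) * cis (x $ k / \<rho>)))) (at x)"
    by (rule has_derivative_compose)
  moreover have "(\<lambda>v::real^'n. (v $ k / \<rho>) *\<^sub>R ((of_real \<rho> * \<i>) * cis (x $ k / \<rho>))) = (\<lambda>v. v $ k *\<^sub>R (\<i> * cis (x $ k / \<rho>)))"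
    using assms by (simp add: fun_eq_iff scaleR_conv_of_real)
  ultimately have 2: "((\<lambda>x. of_real \<rho> * cis (x $ k / \<rho>)) has_derivative (\<lambda>v. v $ k *\<^sub>R (\<i> * cis (x $ k / \<rho>)))) (at x)"
    by simp
  show ?thesis unfolding roll_def[abs_def] using has_derivative_Pair[OF 1 2] .
qed

lemma smooth_on_roll: "smooth_on UNIV (roll (k::'n::finite) \<rho>)"
  unfolding smooth_on_def
proof
  fix m
  have "bounded_linear (\<lambda>x::real^'n. (\<chi> i. if i = k then 0 else x $ i, 0::complex))"
    by (rule linear_conv_bounded_linear[THEN iffD1]) (auto simp: linear_iff vec_eq_iff)
  then have 1: "Ck_on m UNIV (\<lambda>x::real^'n. (\<chi> i. if i = k then 0 else x $ i, 0::complex))"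
    by (rule Ck_on_bounded_linear) simp
  have "bounded_linear (\<lambda>x::real^'n. x $ k / \<rho>)"
    by (rule bounded_linear_compose[OF bounded_linear_divide bounded_linear_vec_nth])
  then have "Ck_on m UNIV (\<lambda>x::real^'n. x $ k / \<rho>)" by (rule Ck_on_bounded_linear) simp
  then have "Ck_on m UNIV (\<lambda>x::real^'n. of_real \<rho> * cis (x $ k / \<rho>))"
    by (rule Ck_on_compose[OF open_UNIV open_UNIV _ Ck_on_cis]) simp
  moreover have "bounded_linear (\<lambda>z::complex. (0::real^'n, z))"
    by (rule linear_conv_bounded_linear[THEN iffD1]) (auto simp: linear_iff)
  ultimately have 2: "Ck_on m UNIV (\<lambda>x::real^'n. (0::real^'n, of_real \<rho> * cis (x $ k / \<rho>)))"
    using Ck_on_bounded_linear_compose[OF _ open_UNIV] by blast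
  show "Ck_on m UNIV (roll k \<rho>)"
    using Ck_on_add[OF open_UNIV 1 2] by (simp add: roll_def[abs_def])
qed

lemma model_cylinder:
  fixes k :: "'n::finite"
  assumes \<rho>: "\<rho> > 0"
  shows "model ({x. x $ k = 0} \<times> sphere 0 \<rho>) (roll k \<rho>)"
proof
  let ?S = "{x::real^'n. x $ k = 0} \<times> sphere (0::complex) \<rho>"
  show "smooth_on UNIV (roll k \<rho>)" by (rule smooth_on_roll)
  show "frechet_derivative (roll k \<rho>) (at x) v \<bullet> frechet_derivative (roll k \<rho>) (at x) v' = v \<bullet> v'" for x v v'
  proof -
    have "frechet_derivative (roll k \<rho>) (at x) = (\<lambda>v. (\<chi> i. if i = k then 0 else v $ i, v $ k *\<^sub>R (\<i> * cis (x $ k / \<rho>))))"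
      by (rule frechet_derivative_at[OF roll_has_derivative[OF \<rho>], symmetric])
    moreover have "(\<chi> i. if i = k then 0 else v $ i) \<bullet> (\<chi> i. if i = k then 0 else v' $ i) = (\<Sum>i\<in>UNIV - {k}. v $ i * v' $ i)"
    proof -
      have "(\<chi> i. if i = k then 0 else v $ i) \<bullet> (\<chi> i. if i = k then 0 else v' $ i) =
          (\<Sum>i\<in>UNIV. if i = k then 0 else v $ i * v' $ i)"
        unfolding inner_vec_def by (rule sum.cong) auto
      also have "\<dots> = (\<Sum>i\<in>UNIV - {k}. v $ i * v' $ i)"
        by (rule sum.mono_neutral_cong_right) auto
      finally show ?thesis .
    qed
    moreover have "(\<i> * cis t) \<bullet> (\<i> * cis t) = 1" for t
      by (simp add: dot_square_norm norm_mult)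
    moreover have "v \<bullet> v' = v $ k * v' $ k + (\<Sum>i\<in>UNIV - {k}. v $ i * v' $ i)"
      unfolding inner_vec_def by (subst sum.remove[of UNIV k]) auto
    ultimately show ?thesis by (simp add: inner_Pair)
  qed
  have sub: "roll k \<rho> x \<in> ?S" for x using \<rho> by (simp add: roll_def norm_mult)
  \<comment> \<open>The argument is measured from the image of \<open>x\<close>, so that the branch
    cut of \<open>Arg\<close> lies opposite to that image. The same explicit preimage gives
    surjectivity, with \<open>x = 0\<close>, and openness near
    \<open>roll k \<rho> x\<close>.\<close>
  have lift: "roll k \<rho> (\<chi> i. if i = k then x $ k + \<rho> * Arg (z / (of_real \<rho> * cis (x $ k / \<rho>))) else q $ i) = (q, z)"
    if s: "(q, z) \<in> ?S" for q z x
  proof -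
    let ?z0 = "of_real \<rho> * cis (x $ k / \<rho>)"
    have z: "z / ?z0 \<noteq> 0" "norm (z / ?z0) = 1" using s \<rho> by (auto simp: norm_mult norm_divide)
    have "cis ((x $ k + \<rho> * Arg (z / ?z0)) / \<rho>) = cis (x $ k / \<rho>) * cis (Arg (z / ?z0))"
      using \<rho> by (simp add: cis_mult add_divide_distrib)
    also have "cis (Arg (z / ?z0)) = z / ?z0"
      using cis_Arg[OF z(1)] z(2) by (simp add: sgn_div_norm del: norm_divide)
    finally show ?thesis using s \<rho> by (auto simp: roll_def vec_eq_iff)
  qed
  show "range (roll k \<rho>) = ?S"
  proof
    show "?S \<subseteq> range (roll k \<rho>)"
    proof
      fix s assume s: "s \<in> ?S"
      obtain q z where qz: "s = (q, z)" by (cases s)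
      have "(q, z) \<in> ?S" using s unfolding qz .
      from lift[OF this, of 0] show "s \<in> range (roll k \<rho>)" unfolding qz by (rule range_eqI[OF sym])
    qed
  qed (use sub in blast)
  show "openin (top_of_set ?S) (roll k \<rho> ` W)" if W: "open W" for W :: "(real^'n) set"
  proof (subst openin_subopen, intro ballI)
    fix s assume "s \<in> roll k \<rho> ` W"
    then obtain x where x: "x \<in> W" "s = roll k \<rho> x" by blast
    let ?z0 = "of_real \<rho> * cis (x $ k / \<rho>)"
    define Y where "Y s = (\<chi> i. if i = k then x $ k + \<rho> * Arg (snd s / ?z0) else fst s $ i)" for s :: "(real^'n) \<times> complex"
    have Ys: "Y s = x" using \<rho> by (simp add: Y_def x(2) roll_def vec_eq_iff)
    have "isCont Y s"
    proof -
      \<comment> \<open>The quotient is 1 at \<open>s\<close>, away from the branch cut.\<close>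
      have "snd s / ?z0 \<notin> \<real>\<^sub>\<le>\<^sub>0" using \<rho> by (simp add: x(2) roll_def)
      then have "isCont Arg (snd s / ?z0)" by (rule continuous_at_Arg)
      moreover have "isCont (\<lambda>s. snd s / ?z0) s" using \<rho> by (intro continuous_intros) auto
      ultimately have "isCont (\<lambda>s. Arg (snd s / ?z0)) s" by (rule isCont_o2[rotated])
      then have "isCont (\<lambda>s. if i = k then x $ k + \<rho> * Arg (snd s / ?z0) else fst s $ i) s" for i
        by (cases "i = k") (auto intro!: continuous_intros)
      then show ?thesis unfolding Y_def[abs_def] isCont_def by (intro vec_tendstoI) (simp add: isCont_def)
    qed
    then obtain e where e: "e > 0" "\<And>t. dist t s < e \<Longrightarrow> Y t \<in> W"
      using continuous_at_open[of s Y] W x(1) Ys unfolding open_dist by (metis (no_types, lifting))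
    have "?S \<inter> ball s e \<subseteq> roll k \<rho> ` W"
    proof
      fix t assume t: "t \<in> ?S \<inter> ball s e"
      then have "roll k \<rho> (Y t) = t" using lift[of "fst t" "snd t" x] by (simp add: Y_def)
      then show "t \<in> roll k \<rho> ` W" using e(2)[of t] t by (metis IntD2 dist_commute image_eqI mem_ball)
    qed
    moreover have "s \<in> ?S \<inter> ball s e" using x(2) sub[of x] e(1) by (simp only: IntI centre_in_ball)
    moreover have "openin (top_of_set ?S) (?S \<inter> ball s e)" by (simp add: openin_open_Int)
    ultimately show "\<exists>T. openin (top_of_set ?S) T \<and> s \<in> T \<and> T \<subseteq> roll k \<rho> ` W" by blast
  qed
  \<comment> \<open>The radius is half the period, so two points of the ball are less than one
    period apart.\<close>
  show "\<exists>U. open U \<and> x \<in> U \<and> inj_on (roll k \<rho>) U" for x :: "real^'n"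
  proof (intro exI[of _ "ball x (pi * \<rho>)"] conjI inj_onI)
    show "x \<in> ball x (pi * \<rho>)" using \<rho> by simp
    fix y z assume y: "y \<in> ball x (pi * \<rho>)" "z \<in> ball x (pi * \<rho>)" and "roll k \<rho> y = roll k \<rho> z"
    then obtain m :: int where m: "z = flip k 1 (of_int m * (2 * pi * \<rho>)) y" using roll_eq_iff[OF \<rho>] by blast
    have "\<bar>z $ k - y $ k\<bar> \<le> dist z y" using component_le_norm_cart[of "z - y" k] by (simp add: dist_norm)
    also have "\<dots> < 2 * (pi * \<rho>)" using y dist_triangle[of z y x] by (simp add: dist_commute)
    finally have "\<bar>of_int m\<bar> * (2 * pi * \<rho>) < 1 * (2 * pi * \<rho>)" using \<rho> by (simp add: m flip_nth abs_mult)
    then have "\<bar>of_int m\<bar> < (1::real)" using \<rho> by (simp add: mult_less_cancel_right)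
    then have "m = 0" by linarith
    then show "y = z" by (simp add: m vec_eq_iff flip_nth)
  qed simp
qed

text \<open>Both directions go through a local isometry \<Phi> from R^n with the fibres of the model
  map. The index \<open>k\<close> selects the hyperplane that realises R^(n-1), and the same
  \<open>k\<close> is the direction left out when the affine functions are orthonormalised.\<close>

theorem theorem5p1:
  fixes M :: "('a, 'n::finite) riem" and k :: 'n
  assumes "riemannian_manifold M"
    and "connected_space (mtop M)"
    and "complete_riem M"
  shows "real_fun.dim (W_e M) \<ge> CARD('n) \<longleftrightarrow>
    isometric M (euclidean_riem :: (real^'n, 'n) riem) \<or>
    (\<exists>\<rho>>0. isometric M (cylinder_riem k \<rho>))"
proof -
  interpret riemannian M by unfold_locales (rule assms(1))
  show ?thesis
  proof
    assume dim: "real_fun.dim (W_e M) \<ge> CARD('n)"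
    show "isometric M (euclidean_riem :: (real^'n, 'n) riem) \<or> (\<exists>\<rho>>0. isometric M (cylinder_riem k \<rho>))"
    proof (rule developing_map[OF assms(2,3) dim, where k = k])
      fix \<Phi> assume "developing \<Phi>" "range \<Phi> = topspace X" "inj \<Phi>"
      then have "isometric M (submanifold UNIV :: (real^'n, 'n) riem)"
        by (intro isometric_model[OF model_euclidean]) (auto dest: injD)
      then show ?thesis by (simp add: euclidean_riem_def)
    next
      fix \<Phi> T assume \<Phi>: "developing \<Phi>" "range \<Phi> = topspace X" and T: "T > (0::real)"
        and fib: "\<And>x y. \<Phi> x = \<Phi> y \<longleftrightarrow> (\<exists>m::int. y = flip k 1 (of_int m * T) x)"
      \<comment> \<open>The period \<open>T\<close> of the deck translations becomes the
        circumference of the circle.\<close>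
      define \<rho> where "\<rho> = T / (2 * pi)"
      have \<rho>: "\<rho> > 0" "2 * pi * \<rho> = T" using T by (simp_all add: \<rho>_def)
      have "isometric M (submanifold ({x. x $ k = 0} \<times> sphere 0 \<rho>) :: ((real^'n) \<times> complex, 'n) riem)"
        by (rule isometric_model[OF model_cylinder[OF \<rho>(1)] \<Phi>]) (simp add: fib roll_eq_iff[OF \<rho>(1)] \<rho>(2))
      then show ?thesis using \<rho>(1) unfolding cylinder_riem_def by blast
    qed
  next
    assume "isometric M (euclidean_riem :: (real^'n, 'n) riem) \<or> (\<exists>\<rho>>0. isometric M (cylinder_riem k \<rho>))"
    then show "real_fun.dim (W_e M) \<ge> CARD('n)"
    proof
      assume "isometric M (euclidean_riem :: (real^'n, 'n) riem)"
      then have "isometric M (submanifold UNIV :: (real^'n, 'n) riem)" by (simp add: euclidean_riem_def)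
      then obtain \<Phi> where \<Phi>: "developing \<Phi>" "range \<Phi> = topspace X" "\<And>x y. \<Phi> x = \<Phi> y \<longleftrightarrow> x = y"
        by (rule isometric_model_developing[OF model_euclidean]) blast
      show ?thesis by (rule dim_W_e_developing[OF \<Phi>(1,2), of k]) (auto simp: \<Phi>(3) inj_def)
    next
      assume "\<exists>\<rho>>0. isometric M (cylinder_riem k \<rho>)"
      then obtain \<rho> where \<rho>: "\<rho> > 0" and
        iso: "isometric M (submanifold ({x. x $ k = 0} \<times> sphere 0 \<rho>) :: ((real^'n) \<times> complex, 'n) riem)"
        unfolding cylinder_riem_def by blast
      obtain \<Phi> where \<Phi>: "developing \<Phi>" "range \<Phi> = topspace X" "\<And>x y. \<Phi> x = \<Phi> y \<longleftrightarrow> roll k \<rho> x = roll k \<rho> y"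
        by (rule isometric_model_developing[OF model_cylinder[OF \<rho>] iso]) blast
      have fib: "\<Phi> x = \<Phi> y \<longleftrightarrow> (\<exists>m::int. y = flip k 1 (of_int m * (2 * pi * \<rho>)) x)" for x y
        unfolding \<Phi>(3) by (rule roll_eq_iff[OF \<rho>])
      have "\<Phi> x = \<Phi> (x + (2 * pi * \<rho>) *\<^sub>R axis k 1)" for x
        unfolding fib by (rule exI[of _ 1]) (simp add: vec_eq_iff flip_nth axis_def)
      then have "\<exists>d. d \<noteq> 0 \<and> (\<forall>x. \<Phi> (x + d *\<^sub>R axis k 1) = \<Phi> x)"
        using \<rho> by (intro exI[of _ "2 * pi * \<rho>"]) auto
      then show ?thesis
        by (intro dim_W_e_developing[OF \<Phi>(1,2), of k]) (auto simp: fib flip_nth)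
    qed
  qed
qed

end
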